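(* Let $N\geq1$ and $0\leq n\leq N-1$ be integers, let $q\in W^{N,\infty}(\mathbb R;\mathbb C)$, and let $\gamma_n:\mathbb R\to(0,\infty)$ be an even function for which there are constants $c_n,C_n>0$ with $$c_n(1+|t|)^{-n}\leq\gamma_n(t)\leq C_n(1+|t|)^{-n},\qquad t\in\mathbb R.$$ Put $$\Omega_{n,+}^{\rm D}=\{z\in\mathbb C:\ \operatorname{Im}z>\gamma_n(\operatorname{Re}z)\},\qquad \Omega_{n,-}^{\rm D}=\{z\in\mathbb C:\ -\operatorname{Im}z>\gamma_n(\operatorname{Re}z)\}.$$ Let $m_\pm$ be the Weyl functions of the non-self-adjoint Dirac operator $$D_q^{\rm ns}=i\begin{pmatrix}1&0\\0&-1\end{pmatrix}\frac{d}{dx}+\begin{pmatrix}0&q\\ -\overline q&0\end{pmatrix}.$$ If the lower-bound constant $c_n$ is chosen sufficiently large (depending on $q,N,n$), then $m_+$ is analytic in $\Omega_{n,-}^{\rm D}$ and $m_-$ is analytic in $\Omega_{n,+}^{\rm D}$. Moreover, as $|z|\to\infty$, $$m_+(z)=\sum_{j=1}^{N-n-1}c_j(0)z^{-j}+O(|z|^{n-N}),\qquad z\in\Omega_{n,-}^{\rm D},$$ $$m_-(z)=\sum_{j=1}^{N-n-1}c_j(0)z^{-j}+O(|z|^{n-N}),\qquad z\in\Omega_{n,+}^{\rm D},$$ with error terms uniform in the indicated regions. The coefficients (the same for $m_+$ and $m_-$) are determined by $$c_1=-\frac{\overline q}{2},\qquad c_{j+1}=-\frac i2c_j'+\frac q2\sum_{\ell=1}^{j-1}c_\ell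 c_{j-\ell},\quad j\geq1.$$
   Context: $W^{N,\infty}(\mathbb R;\mathbb C)$ is the space of complex-valued functions on $\mathbb R$ whose weak derivatives up to order $N$ are in $L^\infty$ (continuous representatives are used). $\mathbb C_\pm=\{z\in\mathbb C:\pm\operatorname{Im}z>0\}$. The functions $c_j$ (coefficients of the expansion) are not to be confused with the constant $c_n$ in the lower bound for $\gamma_n$. Weyl functions: let $\boldsymbol f_+(\cdot,z)$ and $\boldsymbol f_-(\cdot,z)$ denote nonzero $\mathbb C^2$-valued solutions of $D_q^{\rm ns}\boldsymbol f=z\boldsymbol f$ on $\mathbb R$ that are square integrable near $+\infty$ and near $-\infty$, respectively, with components $f_{\pm,1},f_{\pm,2}$. Define $$m_+(z)=\frac{f_{+,2}(0,z)}{f_{+,1}(0,z)}\ \text{ for } z\in\mathbb C_-,\qquad m_-(z)=\frac{f_{-,2}(0,z)}{f_{-,1}(0,z)}\ \text{ for } z\in\mathbb C_+,$$ wherever such solutions exist, are unique up to a constant factor, and the denominators do not vanish; analyticity of $m_\pm$ in a region includes being well defined (in this sense) there. The $O$-statements mean: there are constants $C,R>0$ such that for all $z$ in the indicated region with $|z|\ge R$ the remainder is bounded in modulus by $C|z|^{n-N}$. Empty sums are zero. *)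

theory Defs
  imports "HOL-Analysis.Analysis"
begin

definition test_function :: "(real \<Rightarrow> real) \<Rightarrow> bool" where
  "test_function \<phi> \<longleftrightarrow>
     (\<forall>k x. (deriv ^^ k) \<phi> differentiable (at x)) \<and> compact (closure {x. \<phi> x \<noteq> 0})"

text \<open>Functions rather than almost-everywhere classes.\<close>

definition L_infinity :: "(real \<Rightarrow> complex) set" where
  "L_infinity = {g. g \<in> borel_measurable lborel \<and> (\<exists>M. AE x in lborel. norm (g x) \<le> M)}"

definition has_weak_derivative :: "nat \<Rightarrow> (real \<Rightarrow> complex) \<Rightarrow> (real \<Rightarrow> complex) \<Rightarrow> bool" where
  "has_weak_derivative k f g \<longleftrightarrow>
     (\<forall>\<phi>. test_function \<phi> \<longrightarrow>
        (LINT x|lborel. (deriv ^^ k) \<phi> x *\<^sub>R f x) = (-1) ^ k * (LINT x|lborel. \<phi> x *\<^sub>R g x))"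

definition sobolev_infinity :: "nat \<Rightarrow> (real \<Rightarrow> complex) set" where
  "sobolev_infinity N =
     {f \<in> L_infinity. \<forall>k\<le>N. \<exists>g\<in>L_infinity. has_weak_derivative k f g}"

definition dirac_ns :: "(real \<Rightarrow> complex) \<Rightarrow> (real \<Rightarrow> complex ^ 2) \<Rightarrow> real \<Rightarrow> complex ^ 2" where
  "dirac_ns q f x =
     \<i> *s ((vector [vector [1, 0], vector [0, -1]] :: complex ^ 2 ^ 2) *v vector_derivative f (at x))
     + (vector [vector [0, q x], vector [- cnj (q x), 0]] :: complex ^ 2 ^ 2) *v f x"

text \<open>Solutions are classical, which for continuous \<open>q\<close> is no restriction: every locally
  absolutely continuous solution is then continuously differentiable.\<close>

definition dirac_ns_solution ::
    "(real \<Rightarrow> complex) \<Rightarrow> complex \<Rightarrow> (real \<Rightarrow> complex ^ 2) \<Rightarrow> bool" where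
  "dirac_ns_solution q z f \<longleftrightarrow>
     (\<forall>x. f differentiable (at x) \<and> dirac_ns q f x = z *s f x)"

definition weyl_solution_plus ::
    "(real \<Rightarrow> complex) \<Rightarrow> complex \<Rightarrow> (real \<Rightarrow> complex ^ 2) \<Rightarrow> bool" where
  "weyl_solution_plus q z f \<longleftrightarrow>
     dirac_ns_solution q z f \<and> (\<exists>x. f x \<noteq> 0) \<and>
     (\<exists>a. set_integrable lborel {a..} (\<lambda>x. (norm (f x))\<^sup>2))"

definition weyl_solution_minus ::
    "(real \<Rightarrow> complex) \<Rightarrow> complex \<Rightarrow> (real \<Rightarrow> complex ^ 2) \<Rightarrow> bool" where
  "weyl_solution_minus q z f \<longleftrightarrow>
     dirac_ns_solution q z f \<and> (\<exists>x. f x \<noteq> 0) \<and>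
     (\<exists>a. set_integrable lborel {..a} (\<lambda>x. (norm (f x))\<^sup>2))"

text \<open>The quotients \<open>weyl_plus\<close> and \<open>weyl_minus\<close> below are meaningful only on the following
  domains of definition.\<close>

definition weyl_plus_domain :: "(real \<Rightarrow> complex) \<Rightarrow> complex set" where
  "weyl_plus_domain q =
     {z. Im z < 0 \<and> (\<exists>f. weyl_solution_plus q z f) \<and>
         (\<forall>f g. weyl_solution_plus q z f \<longrightarrow> weyl_solution_plus q z g \<longrightarrow> (\<exists>a. g = (\<lambda>x. a *s f x))) \<and>
         (\<forall>f. weyl_solution_plus q z f \<longrightarrow> f 0 $ 1 \<noteq> 0)}"

definition weyl_minus_domain :: "(real \<Rightarrow> complex) \<Rightarrow> complex set" where
  "weyl_minus_domain q =
     {z. Im z > 0 \<and> (\<exists>f. weyl_solution_minus q z f) \<and>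
         (\<forall>f g. weyl_solution_minus q z f \<longrightarrow> weyl_solution_minus q z g \<longrightarrow> (\<exists>a. g = (\<lambda>x. a *s f x))) \<and>
         (\<forall>f. weyl_solution_minus q z f \<longrightarrow> f 0 $ 1 \<noteq> 0)}"

definition weyl_plus :: "(real \<Rightarrow> complex) \<Rightarrow> complex \<Rightarrow> complex" where
  "weyl_plus q z = (THE w. \<exists>f. weyl_solution_plus q z f \<and> w = f 0 $ 2 / f 0 $ 1)"

definition weyl_minus :: "(real \<Rightarrow> complex) \<Rightarrow> complex \<Rightarrow> complex" where
  "weyl_minus q z = (THE w. \<exists>f. weyl_solution_minus q z f \<and> w = f 0 $ 2 / f 0 $ 1)"

definition region_plus :: "(real \<Rightarrow> real) \<Rightarrow> complex set" where
  "region_plus \<gamma> = {z. Im z > \<gamma> (Re z)}"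

definition region_minus :: "(real \<Rightarrow> real) \<Rightarrow> complex set" where
  "region_minus \<gamma> = {z. - Im z > \<gamma> (Re z)}"

text \<open>The value at index 0 is a dummy. The derivative is the classical one: a continuous \<open>q\<close> in
  \<open>sobolev_infinity N\<close> is \<open>N - 1\<close> times continuously differentiable, and the coefficients with
  index at most \<open>N\<close> involve derivatives of \<open>q\<close> of order at most \<open>N - 1\<close> only.\<close>

fun dirac_coeff :: "(real \<Rightarrow> complex) \<Rightarrow> nat \<Rightarrow> real \<Rightarrow> complex" where
  "dirac_coeff q 0 = (\<lambda>x. 0)"
| "dirac_coeff q (Suc 0) = (\<lambda>x. - cnj (q x) / 2)"
| "dirac_coeff q (Suc (Suc j)) =
     (\<lambda>x. - (\<i> / 2) * vector_derivative (dirac_coeff q (Suc j)) (at x)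
          + q x / 2 * (\<Sum>l=1..j. dirac_coeff q l x * dirac_coeff q (Suc j - l) x))"

lemma dirac_coeff_rec:
  assumes "j \<ge> 1"
  shows "dirac_coeff q (j + 1) x =
     - (\<i> / 2) * vector_derivative (dirac_coeff q j) (at x)
     + q x / 2 * (\<Sum>l=1..j-1. dirac_coeff q l x * dirac_coeff q (j - l) x)"
  using assms by (cases j) simp_all

end

theory Submission
  imports Defs "HOL-Complex_Analysis.Cauchy_Integral_Formula"
begin

text \<open>In components the equation \<open>D f = z f\<close> reads \<open>f\<^sub>1' = - i z f\<^sub>1 + i q f\<^sub>2\<close> and
\<open>f\<^sub>2' = i z f\<^sub>2 + i (cnj q) f\<^sub>1\<close>, so a quotient \<open>m = f\<^sub>2 / f\<^sub>1\<close> satisfies the Riccati equation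
\<open>m' = 2 i z m + i (cnj q) - i q m\<^sup>2\<close>. Inserting a power series in \<open>1 / z\<close> yields the recursion for the
coefficients \<open>c\<^sub>j\<close>. Truncated after the \<open>N\<close>-th term, the series solves the Riccati equation up to an
error of order \<open>|z|\<^sup>-\<^sup>N\<close> (\<open>riccati_approximation\<close>); the last coefficient is only Lipschitz
continuous and is replaced by its average over an interval of length \<open>1 / |z|\<close>.

The point is to compare this approximate solution with the true Weyl function although, on the
region in question, \<open>Im z\<close> may be as small as \<open>|z|\<^sup>-\<^sup>n\<close>. For real \<open>z\<close> the coefficient matrix is
skew-Hermitian, hence the flow is unitary. An approximate Riccati solution \<open>m\<close> gives the orthogonal
frame \<open>(1, m)\<close>, \<open>(- cnj m, 1)\<close>, in which a solution has the coordinates \<open>w = f\<^sub>1 + cnj m f\<^sub>2\<close> and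
\<open>u = f\<^sub>2 - m f\<^sub>1\<close>. In this frame the system is diagonal up to the residual and up to a term of size
\<open>|m| |Im z|\<close>, and the real parts of the diagonal entries are \<open>\<plusminus>Im z\<close> plus a common term, which cancels in
the quadratic form \<open>(|u|\<^sup>2 - k\<^sup>2 |w|\<^sup>2) / (1 + |m|\<^sup>2)\<close>. Therefore, for \<open>Im z < 0\<close>, \<open>|m| \<le> 1 / 16\<close> and \<open>0 < k \<le> 1\<close>, and as soon
as the residual is at most \<open>k |Im z| / 8\<close>, this form increases along every solution, with derivative at least
\<open>|Im z| k\<^sup>2 |f|\<^sup>2\<close> (\<open>cone_form_derivative\<close>).

Everything follows from this monotonicity. A solution that is square integrable at \<open>+\<infinity>\<close> cannot have a
positive form anywhere, so it stays in the cone \<open>|u| \<le> k |w|\<close>. With \<open>k = 1\<close> this gives uniqueness and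
\<open>f\<^sub>1(0) \<noteq> 0\<close>; with \<open>k\<close> proportional to the quotient of residual and \<open>|Im z|\<close>, hence of order
\<open>|z|\<^sup>n\<^sup>-\<^sup>N\<close>, it is the asymptotic expansion (\<open>weyl_plus_near_approximation\<close>). Existence and
analyticity come from the solutions that satisfy \<open>f\<^sub>2(L) = 0\<close>: they lie in the cone on \<open>[0, L]\<close>, decay
exponentially there, and their quotients \<open>f\<^sub>2(0) / f\<^sub>1(0)\<close>, which are holomorphic in \<open>z\<close>, converge locally
uniformly as \<open>L \<rightarrow> \<infinity>\<close> (\<open>weyl_plus_lower_region\<close>).

Two supplements are needed. The classical smoothness of \<open>q\<close> is extracted from the weak derivatives by
mollification (\<open>sobolev_infinity_imp_bounded_smooth\<close>). The statement about \<open>m\<^sub>-\<close> follows from the one about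
\<open>m\<^sub>+\<close>, since \<open>x \<mapsto> - x\<close> turns the equation for \<open>q\<close> at \<open>z\<close> into the equation for \<open>- q(- x)\<close> at \<open>- z\<close>.\<close>

section \<open>Functions with bounded derivatives\<close>

lemma vector_derivative_bound_imp_lipschitz:
  fixes f :: "real \<Rightarrow> 'a::real_normed_vector"
  assumes "\<And>x. (f has_vector_derivative f' x) (at x)" "\<And>x. norm (f' x) \<le> B"
  shows "norm (f y - f x) \<le> B * \<bar>y - x\<bar>"
proof -
  have "norm (f y - f x) \<le> B * norm (y - x)"
    by (rule differentiable_bound[of UNIV f "\<lambda>x h. h *\<^sub>R f' x"])
      (use assms in \<open>auto simp: has_vector_derivative_def onorm_scaleR_left[OF bounded_linear_ident] onorm_id\<close>)
  then show ?thesis by simp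
qed

text \<open>A Landau-type inequality: Taylor's formula over a step \<open>h\<close> controls a first derivative by the function
and its second derivative. It turns uniform convergence of a sequence with bounded second derivatives
into uniform convergence of the first derivatives.\<close>

lemma derivative_interpolation_bound:
  fixes f :: "real \<Rightarrow> 'a::real_normed_vector"
  assumes f: "\<And>x. (f has_vector_derivative f' x) (at x)"
    and f': "\<And>x. (f' has_vector_derivative f'' x) (at x)"
    and A: "\<And>x. norm (f x) \<le> A" and B: "\<And>x. norm (f'' x) \<le> B" and "h > 0"
  shows "norm (f' x) \<le> 2 * A / h + B * h"
proof -
  have B0: "B \<ge> 0" using B[of 0] norm_ge_zero order_trans by blast
  have "norm (f (x + h) - f x - (x + h - x) *\<^sub>R f' x) \<le> norm (x + h - x) * (B * h)"
  proof (rule vector_differentiable_bound_linearization[where S = "{x..x + h}"])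
    show "(f has_vector_derivative f' y) (at y within {x..x+h})" for y
      using f has_vector_derivative_at_within by blast
    show "closed_segment x (x + h) \<subseteq> {x..x + h}"
      using \<open>h > 0\<close> by (simp add: closed_segment_eq_real_ivl)
    show "norm (f' y - f' x) \<le> B * h" if "y \<in> {x..x+h}" for y
    proof -
      have "norm (f' y - f' x) \<le> B * \<bar>y - x\<bar>"
        by (rule vector_derivative_bound_imp_lipschitz[OF f' B])
      also have "\<dots> \<le> B * h" using that B0 by (intro mult_left_mono) auto
      finally show ?thesis .
    qed
  qed (use \<open>h > 0\<close> in auto)
  then have 1: "norm (f (x + h) - f x - h *\<^sub>R f' x) \<le> B * h * h" using \<open>h > 0\<close> by (simp add: mult_ac)
  have "h * norm (f' x) = norm (h *\<^sub>R f' x)" using \<open>h > 0\<close> by simp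
  also have "\<dots> = norm (f (x + h) - f x - (f (x + h) - f x - h *\<^sub>R f' x))" by simp
  also have "\<dots> \<le> norm (f (x + h)) + norm (f x) + norm (f (x + h) - f x - h *\<^sub>R f' x)"
    using norm_triangle_ineq4[of "f (x + h) - f x" "f (x + h) - f x - h *\<^sub>R f' x"]
      norm_triangle_ineq4[of "f (x + h)" "f x"] by linarith
  also have "\<dots> \<le> A + A + B * h * h" using A 1 by (intro add_mono) auto
  finally have "norm (f' x) * h \<le> 2 * A + B * h * h" by (simp add: mult_ac)
  then show ?thesis using \<open>h > 0\<close> by (simp add: field_simps)
qed

text \<open>The classical form of \<open>W\<^sup>k\<^sup>+\<^sup>1\<^sup>,\<^sup>\<infinity>\<close>: all derivatives of order at most \<open>k\<close> exist and are bounded, and the one of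
order \<open>k\<close> is Lipschitz continuous.\<close>

fun bounded_smooth :: "nat \<Rightarrow> (real \<Rightarrow> complex) \<Rightarrow> bool" where
  "bounded_smooth 0 f \<longleftrightarrow> (\<exists>M. (\<forall>x. norm (f x) \<le> M) \<and> (\<forall>x y. norm (f y - f x) \<le> M * \<bar>y - x\<bar>))"
| "bounded_smooth (Suc k) f \<longleftrightarrow> (\<exists>M. \<forall>x. norm (f x) \<le> M) \<and>
     (\<exists>f'. (\<forall>x. (f has_vector_derivative f' x) (at x)) \<and> bounded_smooth k f')"

lemma bounded_smooth_0I:
  assumes "\<And>x. norm (f x) \<le> M" "\<And>x y. norm (f y - f x) \<le> M * \<bar>y - x\<bar>"
  shows "bounded_smooth 0 f"
  using assms by auto

lemma bounded_smooth_SucI: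
  assumes "\<And>x. norm (f x) \<le> M" "\<And>x. (f has_vector_derivative f' x) (at x)" "bounded_smooth k f'"
  shows "bounded_smooth (Suc k) f"
  using assms by auto

lemma bounded_smooth_SucE:
  assumes "bounded_smooth (Suc k) f"
  obtains M f' where "\<And>x. norm (f x) \<le> M" "\<And>x. (f has_vector_derivative f' x) (at x)" "bounded_smooth k f'"
  using assms by auto

lemma bounded_smooth_Suc_imp: "bounded_smooth (Suc k) f \<Longrightarrow> bounded_smooth k f"
proof (induction k arbitrary: f)
  case 0
  then obtain M f' where M: "\<forall>x. norm (f x) \<le> M" and f': "\<And>x. (f has_vector_derivative f' x) (at x)"
    and s: "bounded_smooth 0 f'" by auto
  obtain B where B: "\<And>x. norm (f' x) \<le> B" using s by auto
  have "norm (f y - f x) \<le> max M B * \<bar>y - x\<bar>" for x y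
    by (rule vector_derivative_bound_imp_lipschitz[OF f']) (use B in \<open>meson max.coboundedI2\<close>)
  moreover have "\<forall>x. norm (f x) \<le> max M B" using M by (meson max.coboundedI1)
  ultimately show ?case by auto
next
  case (Suc k)
  then show ?case by (metis bounded_smooth.simps(2))
qed

lemma bounded_smooth_mono: "bounded_smooth l f \<Longrightarrow> k \<le> l \<Longrightarrow> bounded_smooth k f"
proof (induction l)
  case (Suc l)
  then show ?case using bounded_smooth_Suc_imp le_Suc_eq by blast
qed simp

lemma bounded_smooth_lipschitz:
  assumes "bounded_smooth k f" obtains M where "M > 0" "\<And>x. norm (f x) \<le> M" "\<And>x y. norm (f y - f x) \<le> M * \<bar>y - x\<bar>"
proof -
  have "bounded_smooth 0 f" by (rule bounded_smooth_mono[OF assms]) simp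
  then obtain M where M: "\<forall>x. norm (f x) \<le> M" "\<forall>x y. norm (f y - f x) \<le> M * \<bar>y - x\<bar>" by auto
  show thesis
  proof (rule that[of "max M 1"])
    show "norm (f x) \<le> max M 1" for x using M by (meson max.coboundedI1)
    show "norm (f y - f x) \<le> max M 1 * \<bar>y - x\<bar>" for x y
      using M(2) by (meson abs_ge_zero max.cobounded1 mult_right_mono order_trans)
  qed simp
qed

lemma lipschitz_imp_continuous:
  fixes f :: "real \<Rightarrow> complex"
  assumes "\<And>x y. norm (f y - f x) \<le> M * \<bar>y - x\<bar>" shows "continuous_on A f"
proof (rule continuous_on_subset[of UNIV])
  have "M \<ge> 0" using assms[of 1 0] norm_ge_zero[of "f 1 - f 0"] by (simp del: norm_ge_zero)
  then have "M-lipschitz_on UNIV f"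
    using assms by (intro lipschitz_onI) (auto simp: dist_norm)
  then show "continuous_on UNIV f" by (rule lipschitz_on_continuous_on)
qed auto

lemma bounded_smooth_continuous: "bounded_smooth k f \<Longrightarrow> continuous_on A f"
  by (erule bounded_smooth_lipschitz) (rule lipschitz_imp_continuous)

lemma bounded_smooth_vector_derivative:
  "bounded_smooth (Suc k) f \<Longrightarrow> bounded_smooth k (\<lambda>x. vector_derivative f (at x))"
  "bounded_smooth (Suc k) f \<Longrightarrow> (f has_vector_derivative vector_derivative f (at x)) (at x)"
proof -
  assume "bounded_smooth (Suc k) f"
  then obtain f' where f': "\<forall>x. (f has_vector_derivative f' x) (at x)" "bounded_smooth k f'" by auto
  then have "(\<lambda>x. vector_derivative f (at x)) = f'" by (auto intro!: vector_derivative_at)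
  then show "bounded_smooth k (\<lambda>x. vector_derivative f (at x))"
    "(f has_vector_derivative vector_derivative f (at x)) (at x)" using f' by auto
qed

declare bounded_smooth.simps [simp del]

lemma bounded_smooth_const: "bounded_smooth k (\<lambda>x. c)"
proof (induction k arbitrary: c)
  case 0
  show ?case by (rule bounded_smooth_0I[of _ "norm c"]) auto
next
  case (Suc k)
  have "((\<lambda>x. c) has_vector_derivative 0) (at x)" for x by simp
  then show ?case using Suc[of 0] by (intro bounded_smooth_SucI[of _ "norm c"]) auto
qed

lemma bounded_smooth_add:
  "bounded_smooth k f \<Longrightarrow> bounded_smooth k g \<Longrightarrow> bounded_smooth k (\<lambda>x. f x + g x)"
proof (induction k arbitrary: f g)
  case 0
  obtain M where M: "\<And>x. norm (f x) \<le> M" "\<And>x y. norm (f y - f x) \<le> M * \<bar>y - x\<bar>"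
    by (rule bounded_smooth_lipschitz[OF 0(1)]) blast
  obtain L where L: "\<And>x. norm (g x) \<le> L" "\<And>x y. norm (g y - g x) \<le> L * \<bar>y - x\<bar>"
    by (rule bounded_smooth_lipschitz[OF 0(2)]) blast
  show ?case
  proof (rule bounded_smooth_0I[of _ "M + L"])
    show "norm (f x + g x) \<le> M + L" for x
      by (rule norm_triangle_le[OF add_mono[OF M(1) L(1)]])
    show "norm (f y + g y - (f x + g x)) \<le> (M + L) * \<bar>y - x\<bar>" for x y
      using norm_triangle_le[OF add_mono[OF M(2) L(2)], of y x y x] by (simp add: algebra_simps)
  qed
next
  case (Suc k)
  obtain M f' where f: "\<And>x. norm (f x) \<le> M" "\<And>x. (f has_vector_derivative f' x) (at x)" "bounded_smooth k f'"
    by (rule bounded_smooth_SucE[OF Suc.prems(1)]) blast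
  obtain L g' where g: "\<And>x. norm (g x) \<le> L" "\<And>x. (g has_vector_derivative g' x) (at x)" "bounded_smooth k g'"
    by (rule bounded_smooth_SucE[OF Suc.prems(2)]) blast
  show ?case
  proof (rule bounded_smooth_SucI[of _ "M + L"])
    show "norm (f x + g x) \<le> M + L" for x
      by (rule norm_triangle_le[OF add_mono[OF f(1) g(1)]])
    show "((\<lambda>x. f x + g x) has_vector_derivative (f' x + g' x)) (at x)" for x
      by (rule has_vector_derivative_add[OF f(2) g(2)])
    show "bounded_smooth k (\<lambda>x. f' x + g' x)" by (rule Suc.IH[OF f(3) g(3)])
  qed
qed

lemma bounded_smooth_mult:
  "bounded_smooth k f \<Longrightarrow> bounded_smooth k g \<Longrightarrow> bounded_smooth k (\<lambda>x. f x * g x)"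
proof (induction k arbitrary: f g)
  case 0
  obtain M where M0: "M > 0" and M: "\<And>x. norm (f x) \<le> M" "\<And>x y. norm (f y - f x) \<le> M * \<bar>y - x\<bar>"
    by (rule bounded_smooth_lipschitz[OF 0(1)]) blast
  obtain L where L0: "L > 0" and L: "\<And>x. norm (g x) \<le> L" "\<And>x y. norm (g y - g x) \<le> L * \<bar>y - x\<bar>"
    by (rule bounded_smooth_lipschitz[OF 0(2)]) blast
  show ?case
  proof (rule bounded_smooth_0I[of _ "2 * (M * L)"])
    show "norm (f x * g x) \<le> 2 * (M * L)" for x
    proof -
      have "norm (f x * g x) \<le> M * L"
        unfolding norm_mult using M(1)[of x] L(1)[of x] M0 by (intro mult_mono) auto
      moreover have "M * L > 0" using M0 L0 by simp
      ultimately show ?thesis by linarith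
    qed
    show "norm (f y * g y - f x * g x) \<le> 2 * (M * L) * \<bar>y - x\<bar>" for x y
    proof -
      have "norm (f y * g y - f x * g x) = norm ((f y - f x) * g y + f x * (g y - g x))" by (simp add: algebra_simps)
      also have "\<dots> \<le> norm (f y - f x) * norm (g y) + norm (f x) * norm (g y - g x)"
        by (metis norm_triangle_ineq norm_mult)
      also have "\<dots> \<le> (M * \<bar>y - x\<bar>) * L + M * (L * \<bar>y - x\<bar>)"
        using M L M0 by (intro add_mono mult_mono) auto
      finally show ?thesis by (simp add: algebra_simps)
    qed
  qed
next
  case (Suc k)
  obtain M f' where f: "\<And>x. norm (f x) \<le> M" "\<And>x. (f has_vector_derivative f' x) (at x)" "bounded_smooth k f'"
    by (rule bounded_smooth_SucE[OF Suc.prems(1)]) blast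
  obtain L g' where g: "\<And>x. norm (g x) \<le> L" "\<And>x. (g has_vector_derivative g' x) (at x)" "bounded_smooth k g'"
    by (rule bounded_smooth_SucE[OF Suc.prems(2)]) blast
  show ?case
  proof (rule bounded_smooth_SucI[of _ "M * L"])
    show "norm (f x * g x) \<le> M * L" for x
      unfolding norm_mult by (rule mult_mono[OF f(1) g(1) order_trans[OF norm_ge_zero f(1)] norm_ge_zero])
    show "((\<lambda>x. f x * g x) has_vector_derivative (f x * g' x + f' x * g x)) (at x)" for x
      by (rule has_vector_derivative_mult[OF f(2) g(2)])
    show "bounded_smooth k (\<lambda>x. f x * g' x + f' x * g x)"
      using f(3) g(3) Suc.prems[THEN bounded_smooth_Suc_imp] by (intro bounded_smooth_add Suc.IH)
  qed
qed

lemma bounded_smooth_cnj: "bounded_smooth k f \<Longrightarrow> bounded_smooth k (\<lambda>x. cnj (f x))"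
proof (induction k arbitrary: f)
  case 0
  obtain M where "\<And>x. norm (f x) \<le> M" "\<And>x y. norm (f y - f x) \<le> M * \<bar>y - x\<bar>"
    by (rule bounded_smooth_lipschitz[OF 0]) blast
  then show ?case
    by (intro bounded_smooth_0I[of _ M]) (simp_all flip: complex_cnj_diff)
next
  case (Suc k)
  obtain M f' where f: "\<And>x. norm (f x) \<le> M" "\<And>x. (f has_vector_derivative f' x) (at x)" "bounded_smooth k f'"
    by (rule bounded_smooth_SucE[OF Suc.prems]) blast
  show ?case
    by (rule bounded_smooth_SucI[where M = M, OF _ has_vector_derivative_cnj[OF f(2)] Suc.IH[OF f(3)]]) (simp add: f(1))
qed

lemma bounded_smooth_sum:
  "(\<And>i. i \<in> A \<Longrightarrow> bounded_smooth k (f i)) \<Longrightarrow> bounded_smooth k (\<lambda>x. \<Sum>i\<in>A. f i x)"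
  by (induction A rule: infinite_finite_induct) (auto simp: bounded_smooth_const bounded_smooth_add)

lemma reflected_derivative:
  assumes "(f has_vector_derivative f') (at (- x))"
  shows "((\<lambda>x. f (- x)) has_vector_derivative - f') (at x)"
proof -
  have "(uminus has_vector_derivative (- 1 :: real)) (at x)" by (auto intro!: derivative_eq_intros)
  then show ?thesis using vector_diff_chain_at[of uminus "-1" x f f'] assms by (auto simp: o_def)
qed

lemma bounded_smooth_reflect: "bounded_smooth k f \<Longrightarrow> bounded_smooth k (\<lambda>x. f (- x))"
proof (induction k arbitrary: f)
  case 0
  obtain M where M: "\<And>x. norm (f x) \<le> M" "\<And>x y. norm (f y - f x) \<le> M * \<bar>y - x\<bar>"
    by (rule bounded_smooth_lipschitz[OF 0]) blast
  have "norm (f (- y) - f (- x)) \<le> M * \<bar>y - x\<bar>" for x y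
    using M(2)[where x = "-x" and y = "-y"] by (simp add: abs_minus_commute)
  then show ?case using M(1) by (intro bounded_smooth_0I) auto
next
  case (Suc k)
  obtain M f' where f: "\<And>x. norm (f x) \<le> M" "\<And>x. (f has_vector_derivative f' x) (at x)" "bounded_smooth k f'"
    by (rule bounded_smooth_SucE[OF Suc.prems]) blast
  show ?case
  proof (rule bounded_smooth_SucI[of _ M])
    show "((\<lambda>x. f (- x)) has_vector_derivative (-1) * f' (- x)) (at x)" for x
      using reflected_derivative[OF f(2), of x] by simp
    show "bounded_smooth k (\<lambda>x. (-1) * f' (- x))"
      using Suc.IH[OF f(3)] by (intro bounded_smooth_mult bounded_smooth_const)
  qed (rule f(1))
qed

section \<open>A smooth bump\<close>

text \<open>This class of functions contains the standard bump \<open>exp (- 1 / (1 - x\<^sup>2))\<close> and is closed under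
differentiation, so that the bump is smooth.\<close>

definition bump_term :: "real poly \<Rightarrow> nat \<Rightarrow> real \<Rightarrow> real" where
  "bump_term p k x = (if \<bar>x\<bar> < 1 then poly p x / (1 - x\<^sup>2) ^ k * exp (- 1 / (1 - x\<^sup>2)) else 0)"

text \<open>The exponential beats every power of \<open>1 - y\<^sup>2\<close>. The quadratic bound is what makes the derivative at the
end points of the support vanish.\<close>

lemma bump_term_flat: "\<exists>C. \<forall>y. \<bar>y\<bar> < 1 \<longrightarrow> \<bar>bump_term p k y\<bar> \<le> C * (1 - y\<^sup>2)\<^sup>2"
proof -
  have "compact (poly p ` {-1..1})" by (intro compact_continuous_image continuous_intros) auto
  then obtain P where P: "\<And>y. y \<in> {-1..1} \<Longrightarrow> \<bar>poly p y\<bar> \<le> P"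
    unfolding compact_eq_bounded_closed bounded_iff by (metis imageI real_norm_def)
  \<comment> \<open>The power \<open>k\<close> cancels the denominator, the remaining two give the square.\<close>
  define m where "m = k + 2"
  have "\<bar>bump_term p k y\<bar> \<le> (P * real m ^ m) * (1 - y\<^sup>2)\<^sup>2" if "\<bar>y\<bar> < 1" for y
  proof -
    define t where "t = 1 - y\<^sup>2"
    have t: "t > 0" using that by (simp add: t_def abs_square_less_1)
    have m: "m > 0" by (simp add: m_def)
    have "(1 / (real m * t)) ^ m \<le> (1 + (1 / t) / real m) ^ m"
      using t m by (intro power_mono) (auto simp: field_simps)
    also have "\<dots> \<le> exp (1 / t)"
    proof (rule exp_ge_one_plus_x_over_n_power_n)
      have "0 \<le> 1 / t" using t by simp
      then show "- real m \<le> 1 / t" by linarith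
    qed (rule m)
    finally have "exp (- 1 / t) \<le> (real m * t) ^ m"
      using t m by (simp add: exp_minus field_simps power_divide)
    then have "exp (- 1 / t) / t ^ k \<le> real m ^ m * t\<^sup>2"
    proof -
      have "(real m * t) ^ m = real m ^ m * (t\<^sup>2 * t ^ k)"
        by (simp only: power_mult_distrib m_def power_add mult_ac)
      then show ?thesis using t \<open>exp (- 1 / t) \<le> (real m * t) ^ m\<close> by (simp add: divide_le_eq mult_ac)
    qed
    moreover have "\<bar>poly p y\<bar> \<le> P" using that by (intro P) auto
    ultimately have "\<bar>poly p y\<bar> * (exp (- 1 / t) / t ^ k) \<le> P * (real m ^ m * t\<^sup>2)"
      using t by (intro mult_mono) auto
    moreover have "\<bar>bump_term p k y\<bar> = \<bar>poly p y\<bar> * (exp (- 1 / t) / t ^ k)"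
      using that t by (simp add: bump_term_def abs_mult t_def[symmetric])
    ultimately show ?thesis by (simp add: t_def mult_ac)
  qed
  then show ?thesis by blast
qed

lemma bump_term_derivative:
  "\<exists>p'. \<forall>x. (bump_term p k has_real_derivative bump_term p' (k + 2) x) (at x)"
proof (intro exI allI)
  fix x :: real
  define s where "s = [:1, 0, -1::real:]"
  let ?p = "pderiv p * s\<^sup>2 + smult (2 * real k) ([:0, 1:] * p * s) - [:0, 2:] * p"
  show "(bump_term p k has_real_derivative bump_term ?p (k + 2) x) (at x)"
  proof (cases "\<bar>x\<bar> < 1")
    case True
    have t: "1 - x\<^sup>2 > 0" using True by (simp add: abs_square_less_1)
    have "((\<lambda>x. poly p x * inverse ((1 - x\<^sup>2) ^ k) * exp (- inverse (1 - x\<^sup>2))) has_real_derivative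
      poly ?p x / (1 - x\<^sup>2) ^ (k + 2) * exp (- 1 / (1 - x\<^sup>2))) (at x)"
    proof -
      define d where "d = ((poly (pderiv p) x * inverse ((1 - x\<^sup>2) ^ k)
         + poly p x * (real k * (2 * x) * (inverse ((1 - x\<^sup>2) ^ k) * inverse (1 - x\<^sup>2)))) * exp (- inverse (1 - x\<^sup>2))
         + poly p x * inverse ((1 - x\<^sup>2) ^ k) * (exp (- inverse (1 - x\<^sup>2)) * (- (2 * x) * (inverse (1 - x\<^sup>2))\<^sup>2)))"
      have i: "((\<lambda>x. inverse (1 - x\<^sup>2)) has_real_derivative 2 * x * (inverse (1 - x\<^sup>2))\<^sup>2) (at x)"
        using t by (auto intro!: derivative_eq_intros simp: power2_eq_square field_simps)
      have "((\<lambda>x. (inverse (1 - x\<^sup>2)) ^ k) has_real_derivative real k * (2 * x) * (inverse ((1 - x\<^sup>2) ^ k) * inverse (1 - x\<^sup>2))) (at x)"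
        using DERIV_power[OF i, of k] t
        by (cases k) (auto simp: power_inverse power2_eq_square distrib_left distrib_right mult_ac)
      then have i2: "((\<lambda>x. inverse ((1 - x\<^sup>2) ^ k)) has_real_derivative real k * (2 * x) * (inverse ((1 - x\<^sup>2) ^ k) * inverse (1 - x\<^sup>2))) (at x)"
        by (simp add: power_inverse)
      have i3: "((\<lambda>x. exp (- inverse (1 - x\<^sup>2))) has_real_derivative exp (- inverse (1 - x\<^sup>2)) * (- (2 * x) * (inverse (1 - x\<^sup>2))\<^sup>2)) (at x)"
        using DERIV_chain2[OF DERIV_exp DERIV_minus[OF i]] by (simp add: mult_ac)
      have "((\<lambda>x. poly p x * inverse ((1 - x\<^sup>2) ^ k) * exp (- inverse (1 - x\<^sup>2))) has_real_derivative d) (at x)"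
        using DERIV_mult[OF DERIV_mult[OF poly_DERIV[of p x] i2] i3] by (simp add: d_def algebra_simps)
      moreover have "d = poly ?p x / (1 - x\<^sup>2) ^ (k + 2) * exp (- 1 / (1 - x\<^sup>2))"
      proof -
        define T e a b c where "T = 1 - x\<^sup>2" and "e = exp (- 1 / T)" and "a = poly (pderiv p) x" and "b = poly p x" and "c = T ^ k"
        have T: "T \<noteq> 0" "c \<noteq> 0" using t by (auto simp: T_def c_def)
        have "poly s x = T" by (simp add: s_def T_def power2_eq_square)
        then have 1: "poly ?p x = a * T\<^sup>2 + 2 * real k * (x * b * T) - 2 * x * b" by (simp add: a_def b_def)
        have 2: "exp (- inverse T) = e" by (simp add: e_def inverse_eq_divide)
        have "d = ((a * inverse c + b * (real k * (2 * x) * (inverse c * inverse T))) * e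
          + b * inverse c * (e * (- (2 * x) * (inverse T)\<^sup>2)))"
          unfolding d_def T_def[symmetric] 2 a_def[symmetric] b_def[symmetric] c_def[symmetric] by simp
        also have "\<dots> = (a * T\<^sup>2 + 2 * real k * (x * b * T) - 2 * x * b) / (c * T\<^sup>2) * e"
          using T by (simp add: field_simps power2_eq_square)
        finally show ?thesis unfolding 1 T_def[symmetric] e_def[symmetric] c_def by (simp add: power_add power2_eq_square)
      qed
      ultimately show ?thesis by simp
    qed
    then have "((\<lambda>x. poly p x / (1 - x\<^sup>2) ^ k * exp (- 1 / (1 - x\<^sup>2))) has_real_derivative
      poly ?p x / (1 - x\<^sup>2) ^ (k + 2) * exp (- 1 / (1 - x\<^sup>2))) (at x)"
      by (simp add: field_simps)
    then have "(bump_term p k has_real_derivative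
      poly ?p x / (1 - x\<^sup>2) ^ (k + 2) * exp (- 1 / (1 - x\<^sup>2))) (at x)"
      by (rule has_field_derivative_transform_within_open[where S = "{-1<..<1}"])
        (use True in \<open>auto simp: bump_term_def\<close>)
    then show ?thesis using True by (simp add: bump_term_def)
  next
    case False
    obtain C where C: "\<And>y. \<bar>y\<bar> < 1 \<Longrightarrow> \<bar>bump_term p k y\<bar> \<le> C * (1 - y\<^sup>2)\<^sup>2"
      using bump_term_flat by blast
    have C0: "C \<ge> 0" using C[of 0] abs_ge_zero order_trans by fastforce
    have x0: "bump_term p k x = 0" using False by (simp add: bump_term_def)
    have bound: "\<bar>(bump_term p k (x + h) - bump_term p k x) / h\<bar> \<le> 4 * C * \<bar>h\<bar>" if "h \<noteq> 0" for h
    proof (cases "\<bar>x + h\<bar> < 1")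
      case True
      have "1 - (x + h)\<^sup>2 = (1 - \<bar>x + h\<bar>) * (1 + \<bar>x + h\<bar>)" by (simp add: algebra_simps power2_eq_square flip: abs_mult)
      also have "\<dots> \<le> \<bar>h\<bar> * 2" using True False by (intro mult_mono) auto
      finally have "(1 - (x + h)\<^sup>2)\<^sup>2 \<le> (2 * \<bar>h\<bar>)\<^sup>2"
        using True by (intro power_mono) (auto simp: abs_square_less_1 less_imp_le)
      then have "\<bar>bump_term p k (x + h)\<bar> \<le> C * (2 * \<bar>h\<bar>)\<^sup>2"
        using C[OF True] C0 by (meson mult_left_mono order_trans)
      then show ?thesis using that by (simp add: x0 field_simps power2_eq_square)
    next
      case False
      then have "bump_term p k (x + h) = 0" by (simp add: bump_term_def)
      then show ?thesis using C0 by (simp add: x0)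
    qed
    have "((\<lambda>h. (bump_term p k (x + h) - bump_term p k x) / h) \<longlongrightarrow> 0) (at 0)"
    proof (rule Lim_null_comparison)
      show "\<forall>\<^sub>F h in at 0. norm ((bump_term p k (x + h) - bump_term p k x) / h) \<le> 4 * C * \<bar>h\<bar>"
        using bound by (auto simp: eventually_at_filter)
      show "((\<lambda>h. 4 * C * \<bar>h\<bar>) \<longlongrightarrow> 0) (at 0)" by (auto intro!: tendsto_eq_intros)
    qed
    then show ?thesis using False by (simp add: DERIV_def bump_term_def)
  qed
qed

lemma smooth_bump_exists:
  obtains D :: "nat \<Rightarrow> real \<Rightarrow> real"
  where "\<And>k x. (D k has_real_derivative D (Suc k) x) (at x)"
    and "\<And>k x. 1 \<le> \<bar>x\<bar> \<Longrightarrow> D k x = 0"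
    and "\<And>x. D 0 x \<ge> 0"
    and "integrable lborel (D 0)" "(LINT x|lborel. D 0 x) = 1"
proof -
  define P where "P = (\<lambda>p k. SOME p'. \<forall>x. (bump_term p k has_real_derivative bump_term p' (k + 2) x) (at x))"
  have P: "(bump_term p k has_real_derivative bump_term (P p k) (k + 2) x) (at x)" for p k x
    using someI_ex[OF bump_term_derivative[of p k]] by (simp add: P_def)
  define b where "b = bump_term [:1:] 0"
  have bc: "continuous_on UNIV b" unfolding b_def
    using DERIV_isCont[OF P] by (simp add: continuous_at_imp_continuous_on)
  have b0: "b x \<ge> 0" for x by (simp add: b_def bump_term_def)
  have bz: "b x = 0" if "1 \<le> \<bar>x\<bar>" for x using that by (simp add: b_def bump_term_def)
  have bi: "set_integrable lborel {-1..1} b"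
    by (rule borel_integrable_atLeastAtMost') (use bc continuous_on_subset in blast)
  have ind: "indicator {-1..1} x *\<^sub>R b x = b x" for x :: real
    using bz[of x] by (cases "1 \<le> \<bar>x\<bar>") (auto simp: indicator_def)
  have bi': "integrable lborel b" using bi by (simp only: set_integrable_def ind)
  define I where "I = (LINT x|lborel. b x)"
  have "I > 0"
  proof -
    have "I = integral {-1..1} b"
      using set_borel_integral_eq_integral(2)[OF bi] by (simp only: I_def set_lebesgue_integral_def ind)
    moreover have "integral {-1..1} b \<noteq> 0"
    proof
      assume "integral {-1..1} b = 0"
      then have "b 0 = 0"
        using integral_eq_0_iff[of "-1" 1 b] continuous_on_subset[OF bc] b0 by auto
      then show False by (simp add: b_def bump_term_def)
    qed
    moreover have "I \<ge> 0" unfolding I_def using b0 by (intro integral_nonneg_AE) auto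
    ultimately show ?thesis by simp
  qed
  \<comment> \<open>The pairs of polynomial and exponent that represent the successive derivatives.\<close>
  define S where "S = rec_nat ([:1 / I:], 0) (\<lambda>_ (p, k). (P p k, k + 2))"
  define D where "D = (\<lambda>k. case S k of (p, j) \<Rightarrow> bump_term p j)"
  have D0: "D 0 = (\<lambda>x. b x / I)" by (auto simp: D_def S_def b_def bump_term_def fun_eq_iff)
  show thesis
  proof (rule that)
    show "(D k has_real_derivative D (Suc k) x) (at x)" for k x
      using P by (simp add: D_def S_def split: prod.split)
    show "D k x = 0" if "1 \<le> \<bar>x\<bar>" for k x
      using that by (simp add: D_def bump_term_def split: prod.split)
    show "D 0 x \<ge> 0" for x using b0 \<open>I > 0\<close> by (simp add: D0)
    show "integrable lborel (D 0)" using bi' by (simp add: D0)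
    show "(LINT x|lborel. D 0 x) = 1" using \<open>I > 0\<close> by (simp add: D0 I_def)
  qed
qed

section \<open>Weakly differentiable functions\<close>

text \<open>By the interpolation bound, uniform bounds on one derivative more make all lower derivatives converge
uniformly. The derivative of highest order is only a limit of uniformly Lipschitz functions.\<close>

lemma bounded_smooth_limit:
  assumes "\<And>j k x. k \<le> n \<Longrightarrow> (U j k has_vector_derivative U j (Suc k) x) (at x)"
    and "\<And>j k x. k \<le> Suc n \<Longrightarrow> norm (U j k x) \<le> M"
    and "uniform_limit UNIV (\<lambda>j. U j 0) q sequentially"
  shows "bounded_smooth n q"
  using assms
proof (induction n arbitrary: U q)
  case 0
  have lim: "(\<lambda>j. U j 0 x) \<longlonglongrightarrow> q x" for x
    using tendsto_uniform_limitI[OF 0(3)] by simp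
  show ?case
  proof (rule bounded_smooth_0I)
    show "norm (q x) \<le> M" for x
      by (rule tendsto_upperbound[OF tendsto_norm[OF lim]]) (use 0(2) in auto)
    show "norm (q y - q x) \<le> M * \<bar>y - x\<bar>" for x y
    proof (rule tendsto_upperbound[OF tendsto_norm[OF tendsto_diff[OF lim lim]]])
      show "\<forall>\<^sub>F j in sequentially. norm (U j 0 y - U j 0 x) \<le> M * \<bar>y - x\<bar>"
        by (intro always_eventually allI vector_derivative_bound_imp_lipschitz[OF 0(1)]) (use 0(2) in auto)
    qed simp
  qed
next
  case (Suc n)
  have lim: "(\<lambda>j. U j 0 x) \<longlonglongrightarrow> q x" for x
    using tendsto_uniform_limitI[OF Suc.prems(3)] by simp
  have M0: "M \<ge> 0" using Suc.prems(2)[of 0 0 0] norm_ge_zero order_trans by blast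
  have "uniformly_Cauchy_on UNIV (\<lambda>j. U j 1)"
    unfolding uniformly_Cauchy_on_def
  proof (intro allI impI)
    fix e :: real assume e: "e > 0"
    \<comment> \<open>The two terms of the interpolation bound for a difference of two members of the sequence
      are both made smaller than half of \<open>e\<close>: first the step, then the uniform distance.\<close>
    define h where "h = e / (4 * (2 * M + 1))"
    have h: "h > 0" using e M0 by (simp add: h_def)
    have hM: "2 * M * h \<le> e / 4"
    proof -
      have "2 * M * h \<le> (2 * M + 1) * h" using h by (simp add: algebra_simps)
      also have "\<dots> = e / 4" using M0 by (simp add: h_def field_simps)
      finally show ?thesis .
    qed
    have "uniformly_Cauchy_on UNIV (\<lambda>j. U j 0)"
      using Suc.prems(3) uniformly_convergent_on_def uniformly_convergent_Cauchy by blast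
    then obtain J where J: "\<And>x i j. i \<ge> J \<Longrightarrow> j \<ge> J \<Longrightarrow> dist (U i 0 x) (U j 0 x) < e * h / 8"
      unfolding uniformly_Cauchy_on_def using e h by (metis UNIV_I divide_pos_pos mult_pos_pos zero_less_numeral)
    have "dist (U i 1 x) (U j 1 x) < e" if "i \<ge> J" "j \<ge> J" for i j x
    proof -
      have "norm (U i 1 x - U j 1 x) \<le> 2 * (e * h / 8) / h + (2 * M) * h"
      proof (rule derivative_interpolation_bound[where f = "\<lambda>x. U i 0 x - U j 0 x" and f'' = "\<lambda>x. U i 2 x - U j 2 x"])
        show "((\<lambda>x. U i 0 x - U j 0 x) has_vector_derivative U i 1 x - U j 1 x) (at x)" for x
          using Suc.prems(1)[of 0 i x] Suc.prems(1)[of 0 j x] by (auto intro: has_vector_derivative_diff)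
        show "((\<lambda>x. U i 1 x - U j 1 x) has_vector_derivative U i 2 x - U j 2 x) (at x)" for x
          using Suc.prems(1)[of 1 i x] Suc.prems(1)[of 1 j x] by (auto intro: has_vector_derivative_diff simp: numeral_2_eq_2)
        show "norm (U i 0 x - U j 0 x) \<le> e * h / 8" for x
          using J[OF that, of x] by (simp add: dist_norm)
        show "norm (U i 2 x - U j 2 x) \<le> 2 * M" for x
          using Suc.prems(2)[of 2 i x] Suc.prems(2)[of 2 j x] norm_triangle_ineq4[of "U i 2 x" "U j 2 x"] by simp
      qed (use h in auto)
      then show ?thesis using h hM e by (simp add: dist_norm)
    qed
    then show "\<exists>J. \<forall>x\<in>UNIV. \<forall>i\<ge>J. \<forall>j\<ge>J. dist (U i 1 x) (U j 1 x) < e" by blast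
  qed
  then obtain r where r: "uniform_limit UNIV (\<lambda>j. U j 1) r sequentially"
    using Cauchy_uniformly_convergent uniformly_convergent_on_def by blast
  have "\<exists>g. \<forall>x\<in>UNIV. (\<lambda>j. U j 0 x) \<longlonglongrightarrow> g x \<and> (g has_derivative (\<lambda>h. h *\<^sub>R r x)) (at x within UNIV)"
  proof (rule has_derivative_sequence)
    show "((\<lambda>x. U j 0 x) has_derivative (\<lambda>h. h *\<^sub>R U j 1 x)) (at x within UNIV)" for j x
      using Suc.prems(1)[of 0 j x] by (simp add: has_vector_derivative_def)
    show "\<forall>\<^sub>F j in sequentially. \<forall>x\<in>UNIV. \<forall>h. norm (h *\<^sub>R U j 1 x - h *\<^sub>R r x) \<le> e * norm h" if "e > 0" for e
      using uniform_limitD[OF r that]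
    proof eventually_elim
      case (elim j)
      then show ?case
        by (simp add: dist_norm mult.commute[of e] less_imp_le mult_left_mono flip: scaleR_diff_right)
    qed
    show "(\<lambda>j. U j 0 0) \<longlonglongrightarrow> q 0" by (rule lim)
  qed auto
  then obtain g where "\<forall>x. (\<lambda>j. U j 0 x) \<longlonglongrightarrow> g x" and g: "\<forall>x. (g has_vector_derivative r x) (at x)"
    by (auto simp: has_vector_derivative_def)
  then have "g = q" using lim LIMSEQ_unique by blast
  show ?case
  proof (rule bounded_smooth_SucI)
    show "norm (q x) \<le> M" for x
      by (rule tendsto_upperbound[OF tendsto_norm[OF lim]]) (use Suc.prems(2) in auto)
    show "(q has_vector_derivative r x) (at x)" for x using g \<open>g = q\<close> by simp
    show "bounded_smooth n r"
    proof (rule Suc.IH[where U = "\<lambda>j k. U j (Suc k)"])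
      show "uniform_limit UNIV (\<lambda>j. U j (Suc 0)) r sequentially" using r by simp
    qed (use Suc.prems in auto)
  qed
qed

text \<open>The mollification \<open>U a k\<close> is the convolution of \<open>q\<close> with the \<open>k\<close>-th derivative of the bump of width
\<open>1 / a\<close>. Integration by parts against this test function replaces \<open>q\<close> by its \<open>k\<close>-th weak derivative, so
that \<open>U a k\<close> is bounded uniformly in \<open>a\<close>, and the limit theorem applies.\<close>

lemma sobolev_infinity_imp_bounded_smooth:
  assumes q: "q \<in> sobolev_infinity (Suc n)" and qc: "continuous_on UNIV q"
  shows "bounded_smooth n q"
proof -
  have "\<forall>k\<in>{..Suc n}. \<exists>g M. g \<in> borel_measurable lborel \<and> (AE x in lborel. norm (g x) \<le> M) \<and> has_weak_derivative k q g"
    using q by (fastforce simp: sobolev_infinity_def L_infinity_def)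
  then obtain g Mk where gm: "\<And>k. k \<le> Suc n \<Longrightarrow> g k \<in> borel_measurable lborel"
    and gM: "\<And>k. k \<le> Suc n \<Longrightarrow> AE x in lborel. norm (g k x) \<le> Mk k"
    and gw: "\<And>k. k \<le> Suc n \<Longrightarrow> has_weak_derivative k q (g k)"
    by (auto simp: bchoice_iff Ball_def choice_iff) metis
  define M where "M = (\<Sum>k\<le>Suc n. \<bar>Mk k\<bar>)"
  have M0: "M \<ge> 0" by (simp add: M_def sum_nonneg)
  have gM: "AE x in lborel. norm (g k x) \<le> M" if "k \<le> Suc n" for k
  proof -
    have "Mk k \<le> M" unfolding M_def
      using member_le_sum[of k "{..Suc n}" "\<lambda>k. \<bar>Mk k\<bar>"] that by auto
    then show ?thesis using gM[OF that] by (auto elim: order_trans)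
  qed
  obtain D :: "nat \<Rightarrow> real \<Rightarrow> real"
    where D: "\<And>k x. (D k has_real_derivative D (Suc k) x) (at x)"
      and Dz: "\<And>k x. 1 \<le> \<bar>x\<bar> \<Longrightarrow> D k x = 0"
      and D0: "\<And>x. D 0 x \<ge> 0"
      and Di: "integrable lborel (D 0)" "(LINT x|lborel. D 0 x) = 1"
    by (rule smooth_bump_exists) blast
  have Dc: "continuous_on A (D k)" for A k
    using DERIV_isCont[OF D] by (simp add: continuous_at_imp_continuous_on)
  define h where "h = (\<lambda>a x y. a * D 0 (a * (x - y)))"
  define U where "U = (\<lambda>a k x. LINT y|lborel. (a ^ Suc k * D k (a * (x - y))) *\<^sub>R q y)"
  have supp: "D k (a * (x - y)) = 0" if "a > 0" "1 / a \<le> \<bar>x - y\<bar>" for a x y k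
  proof (rule Dz)
    have "1 \<le> a * \<bar>x - y\<bar>" using that by (simp add: field_simps)
    then show "1 \<le> \<bar>a * (x - y)\<bar>" using that by (simp add: abs_mult)
  qed
  have derivs: "(deriv ^^ k) (h a x) = (\<lambda>y. a * (- a) ^ k * D k (a * (x - y)))" for a x k
  proof (induction k)
    case 0
    then show ?case by (simp add: h_def)
  next
    case (Suc k)
    have "((\<lambda>y. a * (- a) ^ k * D k (a * (x - y))) has_real_derivative a * (- a) ^ Suc k * D (Suc k) (a * (x - y))) (at y)" for y
      by (rule derivative_eq_intros DERIV_chain2[OF D] refl | simp)+
    then show ?case using Suc by (auto simp: DERIV_imp_deriv)
  qed
  have test: "test_function (h a x)" if a: "a > 0" for a x
    unfolding test_function_def
  proof (intro conjI allI)
    show "(deriv ^^ k) (h a x) differentiable at y" for k y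
    proof -
      have "((\<lambda>y. a * (- a) ^ k * D k (a * (x - y))) has_real_derivative a * (- a) ^ Suc k * D (Suc k) (a * (x - y))) (at y)" for y
        by (rule derivative_eq_intros DERIV_chain2[OF D] refl | simp)+
      then show ?thesis unfolding derivs using real_differentiable_def by blast
    qed
    have "y \<in> {x - 1 / a..x + 1 / a}" if "h a x y \<noteq> 0" for y
    proof (rule ccontr)
      assume "y \<notin> {x - 1 / a..x + 1 / a}"
      then have "D 0 (a * (x - y)) = 0" by (intro supp a) (auto simp: abs_if)
      then show False using that by (simp add: h_def)
    qed
    then have "bounded {y. h a x y \<noteq> 0}" by (auto intro!: bounded_subset[OF bounded_closed_interval[of "x - 1 / a" "x + 1 / a"]])
    then show "compact (closure {y. h a x y \<noteq> 0})" by (simp add: compact_closure)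
  qed
  have hi: "integrable lborel (h a x)" "(LINT y|lborel. h a x y) = 1" if a: "a > 0" for a x
  proof -
    have "integrable lborel (\<lambda>y. D 0 (a * x + (- a) * y))"
      using lborel_integrable_real_affine[OF Di(1), of "- a" "a * x"] a by simp
    then show "integrable lborel (h a x)" by (simp add: h_def algebra_simps)
    show "(LINT y|lborel. h a x y) = 1"
      using lborel_integral_real_affine[of "- a" "D 0" "a * x"] a Di(2) by (simp add: h_def algebra_simps)
  qed
  have h0: "h a x y \<ge> 0" if "a > 0" for a x y using D0 that by (simp add: h_def)
  have Ug: "U a k x = (LINT y|lborel. h a x y *\<^sub>R g k y)" if a: "a > 0" and k: "k \<le> Suc n" for a k x
  proof -
    have "(LINT y|lborel. (deriv ^^ k) (h a x) y *\<^sub>R q y) = (-1) ^ k * (LINT y|lborel. h a x y *\<^sub>R g k y)"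
      using gw[OF k] test[OF a] by (simp add: has_weak_derivative_def)
    moreover have "(LINT y|lborel. (deriv ^^ k) (h a x) y *\<^sub>R q y) = (-1) ^ k * U a k x"
    proof -
      have "(deriv ^^ k) (h a x) y *\<^sub>R q y = (-1) ^ k * ((a ^ Suc k * D k (a * (x - y))) *\<^sub>R q y)" for y
        unfolding derivs by (simp add: power_minus[of a] scaleR_conv_of_real mult_ac)
      then show ?thesis by (simp only: U_def integral_mult_right_zero)
    qed
    ultimately show ?thesis by simp
  qed
  have UM: "norm (U a k x) \<le> M" if a: "a > 0" and k: "k \<le> Suc n" for a k x
  proof -
    have "norm (U a k x) \<le> (LINT y|lborel. norm (h a x y *\<^sub>R g k y))"
      unfolding Ug[OF a k] by (rule integral_norm_bound)
    also have "\<dots> \<le> (LINT y|lborel. h a x y * M)"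
    proof (rule integral_mono_AE')
      show "integrable lborel (\<lambda>y. h a x y * M)" using hi[OF a] by simp
      show "AE y in lborel. norm (h a x y *\<^sub>R g k y) \<le> h a x y * M"
        using gM[OF k] by eventually_elim (use h0[OF a] in \<open>simp add: mult_left_mono\<close>)
      show "AE y in lborel. 0 \<le> h a x y * M" using h0[OF a] M0 by simp
    qed
    also have "\<dots> = M" using hi[OF a] by simp
    finally show ?thesis .
  qed
  have U_int: "U a k x = integral {l..r} (\<lambda>y. (a ^ Suc k * D k (a * (x - y))) *\<^sub>R q y)"
    if a: "a > 0" and lr: "l \<le> x - 1 / a" "x + 1 / a \<le> r" for a x l r k
  proof -
    have c: "continuous_on {l..r} (\<lambda>y. (a ^ Suc k * D k (a * (x - y))) *\<^sub>R q y)"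
      by (intro continuous_intros continuous_on_compose2[OF Dc[of UNIV]] continuous_on_subset[OF qc]) auto
    have "indicator {l..r} y *\<^sub>R ((a ^ Suc k * D k (a * (x - y))) *\<^sub>R q y) = (a ^ Suc k * D k (a * (x - y))) *\<^sub>R q y" for y
    proof (cases "y \<in> {l..r}")
      case False
      then have "D k (a * (x - y)) = 0" using lr by (intro supp a) (auto simp: abs_if)
      then show ?thesis by simp
    qed simp
    then have "U a k x = (LINT y:{l..r}|lborel. (a ^ Suc k * D k (a * (x - y))) *\<^sub>R q y)"
      by (simp only: U_def set_lebesgue_integral_def)
    also have "\<dots> = integral {l..r} (\<lambda>y. (a ^ Suc k * D k (a * (x - y))) *\<^sub>R q y)"
      by (rule set_borel_integral_eq_integral(2)[OF borel_integrable_atLeastAtMost'[OF c]])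
    finally show ?thesis .
  qed
  have UD: "(U a k has_vector_derivative U a (Suc k) x) (at x)" if a: "a > 0" for a k x
  proof -
    define l r where "l = x - 1 - 1 / a" and "r = x + 1 + 1 / a"
    let ?B = "ball x 1"
    have "((\<lambda>x. integral (cbox l r) (\<lambda>y. (a ^ Suc k * D k (a * (x - y))) *\<^sub>R q y)) has_vector_derivative
       integral (cbox l r) (\<lambda>y. (a ^ Suc (Suc k) * D (Suc k) (a * (x - y))) *\<^sub>R q y)) (at x within ?B)"
    proof (rule leibniz_rule_vector_derivative)
      show "((\<lambda>x. (a ^ Suc k * D k (a * (x - y))) *\<^sub>R q y) has_vector_derivative
          (a ^ Suc (Suc k) * D (Suc k) (a * (x' - y))) *\<^sub>R q y) (at x' within ?B)" for x' y
      proof -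
        have "((\<lambda>x. a ^ Suc k * D k (a * (x - y))) has_real_derivative a ^ Suc (Suc k) * D (Suc k) (a * (x' - y))) (at x')"
          by (rule derivative_eq_intros DERIV_chain2[OF D] refl | simp)+
        then have "((\<lambda>x. (a ^ Suc k * D k (a * (x - y))) *\<^sub>R q y) has_vector_derivative
          (a ^ Suc (Suc k) * D (Suc k) (a * (x' - y))) *\<^sub>R q y) (at x')"
          using has_vector_derivative_scaleR[OF _ has_vector_derivative_const[of "q y"]] by fastforce
        then show ?thesis by (rule has_vector_derivative_at_within)
      qed
      show "(\<lambda>y. (a ^ Suc k * D k (a * (x' - y))) *\<^sub>R q y) integrable_on cbox l r" for x'
        by (intro integrable_continuous continuous_intros continuous_on_compose2[OF Dc[of UNIV]] continuous_on_subset[OF qc]) auto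
      show "continuous_on (?B \<times> cbox l r) (\<lambda>(x, y). (a ^ Suc (Suc k) * D (Suc k) (a * (x - y))) *\<^sub>R q y)"
        unfolding split_beta
        by (intro continuous_intros continuous_on_compose2[OF Dc[of UNIV]] continuous_on_compose2[OF qc]) auto
    qed auto
    then have "((\<lambda>x. integral (cbox l r) (\<lambda>y. (a ^ Suc k * D k (a * (x - y))) *\<^sub>R q y)) has_vector_derivative U a (Suc k) x) (at x)"
      using U_int[OF a, of l x r "Suc k"] by (simp add: at_within_open[of x ?B] l_def r_def)
    then show ?thesis
      by (rule has_vector_derivative_transform_within_open[where S = ?B])
        (auto simp: U_int[OF a, of l _ r] l_def r_def dist_real_def abs_if split: if_splits)
  qed
  have close: "norm (U a 0 x - q x) \<le> e"
    if a: "a > 0" and e: "\<And>y. \<bar>y - x\<bar> \<le> 1 / a \<Longrightarrow> norm (q y - q x) \<le> e" for a x e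
  proof -
    define l r where "l = x - 1 / a" and "r = x + 1 / a"
    have e0: "e \<ge> 0" using e[of x] a by simp
    have ind: "indicator {l..r} y *\<^sub>R (h a x y *\<^sub>R f y) = h a x y *\<^sub>R f y" for y and f :: "real \<Rightarrow> complex"
    proof (cases "y \<in> {l..r}")
      case False
      then have "D 0 (a * (x - y)) = 0" by (intro supp a) (auto simp: abs_if l_def r_def)
      then show ?thesis by (simp add: h_def)
    qed simp
    have "continuous_on {l..r} (\<lambda>y. h a x y *\<^sub>R q y)" unfolding h_def
      by (intro continuous_intros continuous_on_compose2[OF Dc[of UNIV]] continuous_on_subset[OF qc]) auto
    then have "set_integrable lborel {l..r} (\<lambda>y. h a x y *\<^sub>R q y)" by (rule borel_integrable_atLeastAtMost')
    then have i1: "integrable lborel (\<lambda>y. h a x y *\<^sub>R q y)" by (simp only: set_integrable_def ind)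
    have i2: "integrable lborel (\<lambda>y. h a x y *\<^sub>R q x)" using hi[OF a] by simp
    have "U a 0 x - q x = (LINT y|lborel. h a x y *\<^sub>R q y) - (LINT y|lborel. h a x y *\<^sub>R q x)"
      using hi[OF a] by (simp add: U_def h_def)
    also have "\<dots> = (LINT y|lborel. h a x y *\<^sub>R (q y - q x))"
      using Bochner_Integration.integral_diff[OF i1 i2] by (simp add: scaleR_diff_right)
    finally have "norm (U a 0 x - q x) \<le> (LINT y|lborel. norm (h a x y *\<^sub>R (q y - q x)))"
      using integral_norm_bound by metis
    also have "\<dots> \<le> (LINT y|lborel. h a x y * e)"
    proof (rule integral_mono_AE')
      show "AE y in lborel. norm (h a x y *\<^sub>R (q y - q x)) \<le> h a x y * e"
      proof (intro AE_I2)
        fix y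
        show "norm (h a x y *\<^sub>R (q y - q x)) \<le> h a x y * e"
        proof (cases "\<bar>y - x\<bar> \<le> 1 / a")
          case True
          then show ?thesis using e h0[OF a] by (simp add: mult_left_mono)
        next
          case False
          then have "h a x y = 0" using supp[OF a, of x y 0] by (simp add: h_def abs_minus_commute)
          then show ?thesis by simp
        qed
      qed
    qed (use hi[OF a] h0[OF a] e0 in auto)
    also have "\<dots> = e" using hi[OF a] by simp
    finally show ?thesis .
  qed
  have lim: "(\<lambda>j. U (real (Suc j)) 0 x) \<longlonglongrightarrow> q x" for x
  proof (rule LIMSEQ_I)
    fix e :: real assume "e > 0"
    have "isCont q x" using qc by (simp add: continuous_on_eq_continuous_at)
    then obtain d where d: "d > 0" "\<And>y. \<bar>y - x\<bar> < d \<Longrightarrow> norm (q y - q x) < e / 2"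
      using \<open>e > 0\<close> unfolding continuous_at_eps_delta by (metis dist_norm real_norm_def half_gt_zero)
    obtain J where J: "inverse (real (Suc J)) < d" using reals_Archimedean d(1) by blast
    have "norm (U (real (Suc j)) 0 x - q x) < e" if "j \<ge> J" for j
    proof -
      have "1 / real (Suc j) \<le> inverse (real (Suc J))" using that by (simp add: field_simps)
      then have "norm (U (real (Suc j)) 0 x - q x) \<le> e / 2"
      proof (intro close)
        show "norm (q y - q x) \<le> e / 2" if "\<bar>y - x\<bar> \<le> 1 / real (Suc j)" for y
          by (rule less_imp_le[OF d(2)]) (use that J \<open>1 / real (Suc j) \<le> inverse (real (Suc J))\<close> in linarith)
      qed simp
      then show ?thesis using \<open>e > 0\<close> by simp
    qed
    then show "\<exists>J. \<forall>j\<ge>J. norm (U (real (Suc j)) 0 x - q x) < e" by blast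
  qed
  have lip: "norm (q y - q x) \<le> M * \<bar>y - x\<bar>" for x y
  proof (rule tendsto_upperbound[OF tendsto_norm[OF tendsto_diff[OF lim lim]]])
    show "\<forall>\<^sub>F j in sequentially. norm (U (real (Suc j)) 0 y - U (real (Suc j)) 0 x) \<le> M * \<bar>y - x\<bar>"
      by (intro always_eventually allI vector_derivative_bound_imp_lipschitz[OF UD] UM) auto
  qed simp
  show ?thesis
  proof (rule bounded_smooth_limit[where U = "\<lambda>j. U (real (Suc j))" and M = M])
    show "uniform_limit UNIV (\<lambda>j. U (real (Suc j)) 0) q sequentially"
    proof (rule uniform_limitI)
      fix e :: real assume "e > 0"
      obtain J where J: "inverse (real (Suc J)) < e / (M + 1)"
        using reals_Archimedean[of "e / (M + 1)"] \<open>e > 0\<close> M0 by auto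
      have "dist (U (real (Suc j)) 0 x) (q x) < e" if "j \<ge> J" for j x
      proof -
        have 1: "1 / real (Suc j) \<le> inverse (real (Suc J))" using that by (simp add: field_simps)
        have "norm (U (real (Suc j)) 0 x - q x) \<le> M * (1 / real (Suc j))"
          using M0 by (intro close order_trans[OF lip] mult_left_mono) auto
        also have "\<dots> \<le> (M + 1) * (1 / real (Suc j))" by (intro mult_right_mono) auto
        also have "\<dots> < (M + 1) * (e / (M + 1))" using 1 J M0 by (intro mult_strict_left_mono) auto
        finally show ?thesis using M0 by (simp add: dist_norm)
      qed
      then show "\<forall>\<^sub>F j in sequentially. \<forall>x\<in>UNIV. dist (U (real (Suc j)) 0 x) (q x) < e"
        by (auto simp: eventually_sequentially)
    qed
  qed (use UD UM in auto)
qed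

section \<open>Primitives and averages\<close>

text \<open>The primitive vanishing at 0. Rescaling to the unit interval treats both signs of \<open>x\<close> at once.\<close>

definition primitive :: "(real \<Rightarrow> complex) \<Rightarrow> real \<Rightarrow> complex" where
  "primitive f x = x *\<^sub>R integral {0..1} (\<lambda>s. f (x * s))"

lemma primitive_derivative:
  assumes f: "continuous_on UNIV f"
  shows "(primitive f has_vector_derivative f x) (at x)"
proof -
  define R where "R = \<bar>x\<bar> + 1"
  have x: "x \<in> {-R..R}" by (auto simp: R_def)
  define G where "G = (\<lambda>y. integral {-R..y} f)"
  have G: "(G has_vector_derivative f y) (at y within {-R..R})" if "y \<in> {-R..R}" for y
    unfolding G_def
    by (rule integral_has_vector_derivative) (use f continuous_on_subset that in auto)
  have eq: "primitive f y = G y - G 0" if y: "y \<in> {-R..R}" for y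
  proof -
    have scaled: "y * s \<in> {-R..R}" if "s \<in> {0..1}" for s
    proof -
      have "\<bar>y * s\<bar> \<le> \<bar>y\<bar> * 1" unfolding abs_mult using that by (intro mult_left_mono) auto
      then show ?thesis using y by auto
    qed
    have "((\<lambda>s. y *\<^sub>R f (y * s)) has_integral (G (y * 1) - G (y * 0))) {0..1}"
    proof (rule fundamental_theorem_of_calculus)
      fix s :: real assume s: "s \<in> {0..1}"
      have 1: "((\<lambda>s. y * s) has_vector_derivative y) (at s within {0..1})"
        by (auto intro!: derivative_eq_intros simp: has_real_derivative_iff_has_vector_derivative[symmetric])
      have 2: "(G has_vector_derivative f (y * s)) (at (y * s) within (\<lambda>s. y * s) ` {0..1})"
        by (rule has_vector_derivative_within_subset[OF G[OF scaled[OF s]]]) (use scaled in auto)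
      show "((\<lambda>s. G (y * s)) has_vector_derivative y *\<^sub>R f (y * s)) (at s within {0..1})"
        using vector_diff_chain_within[OF 1 2] by (simp add: o_def)
    qed simp
    then show ?thesis unfolding primitive_def
      by (metis integral_cmul integral_unique mult.right_neutral mult_zero_right)
  qed
  have "((\<lambda>y. G y - G 0) has_vector_derivative f x) (at x within {-R..R})"
    using has_vector_derivative_diff[OF G[of x] has_vector_derivative_const[of "G 0"]] x by simp
  then have "((\<lambda>y. G y - G 0) has_vector_derivative f x) (at x)"
    by (subst (asm) at_within_interior) (auto simp: R_def)
  then show ?thesis
    by (rule has_vector_derivative_transform_within_open[where S = "{-R<..<R}"])
      (use eq in \<open>auto simp: R_def\<close>)
qed

lemma primitive_continuous: "continuous_on UNIV f \<Longrightarrow> continuous_on A (primitive f)"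
  using has_vector_derivative_continuous[OF primitive_derivative] continuous_at_imp_continuous_on by blast

lemma primitive_0 [simp]: "primitive f 0 = 0"
  by (simp add: primitive_def)

text \<open>Averaging over an interval of length \<open>h\<close> makes a Lipschitz function differentiable at the cost of an
error proportional to \<open>h\<close>, and the derivative inherits the Lipschitz constant.\<close>

lemma bounded_smooth_average:
  fixes f :: "real \<Rightarrow> complex"
  assumes b: "\<And>x. norm (f x) \<le> M" and lip: "\<And>x y. norm (f y - f x) \<le> M * \<bar>y - x\<bar>" and h: "h > 0"
  obtains g g' where "\<And>x. (g has_vector_derivative g' x) (at x)"
    "\<And>x. norm (g x - f x) \<le> M * h" "\<And>x. norm (g' x) \<le> M"
proof
  have fc: "continuous_on UNIV f" using lip by (rule lipschitz_imp_continuous)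
  have M0: "M \<ge> 0" using b[of 0] norm_ge_zero order_trans by blast
  define g where "g = (\<lambda>x. (1 / h) *\<^sub>R (primitive f (x + h) - primitive f x))"
  define g' where "g' = (\<lambda>x. (1 / h) *\<^sub>R (f (x + h) - f x))"
  show "(g has_vector_derivative g' x) (at x)" for x
  proof -
    have "((\<lambda>x. x + h) has_vector_derivative 1) (at x)"
      by (auto intro!: derivative_eq_intros simp: has_real_derivative_iff_has_vector_derivative[symmetric])
    from vector_diff_chain_at[OF this primitive_derivative[OF fc]]
    have "((\<lambda>x. primitive f (x + h)) has_vector_derivative f (x + h)) (at x)" by (simp add: o_def)
    then have "((\<lambda>x. primitive f (x + h) - primitive f x) has_vector_derivative f (x + h) - f x) (at x)"
      using primitive_derivative[OF fc] by (rule has_vector_derivative_diff)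
    then show ?thesis unfolding g_def g'_def
      by (rule bounded_linear.has_vector_derivative[OF bounded_linear_scaleR_right])
  qed
  show "norm (g x - f x) \<le> M * h" for x
  proof -
    have "norm (primitive f (x + h) - primitive f x - (x + h - x) *\<^sub>R f x) \<le> norm (x + h - x) * (M * h)"
    proof (rule vector_differentiable_bound_linearization[where S = "{x..x + h}"])
      show "(primitive f has_vector_derivative f y) (at y within {x..x+h})" for y
        using primitive_derivative[OF fc] has_vector_derivative_at_within by blast
      show "closed_segment x (x + h) \<subseteq> {x..x + h}"
        using h by (simp add: closed_segment_eq_real_ivl)
      show "norm (f y - f x) \<le> M * h" if "y \<in> {x..x+h}" for y
        using that M0 by (intro order_trans[OF lip] mult_left_mono) auto
    qed (use h in auto)
    then have 1: "norm (primitive f (x + h) - primitive f x - h *\<^sub>R f x) \<le> h * (M * h)" using h by simp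
    have "g x - f x = (1 / h) *\<^sub>R (primitive f (x + h) - primitive f x - h *\<^sub>R f x)"
      using h by (simp add: g_def algebra_simps)
    then have "norm (g x - f x) = norm (primitive f (x + h) - primitive f x - h *\<^sub>R f x) / h"
      using h by (simp add: divide_inverse mult.commute)
    also have "\<dots> \<le> h * (M * h) / h" using 1 h by (intro divide_right_mono) auto
    finally show ?thesis using h by simp
  qed
  show "norm (g' x) \<le> M" for x
  proof -
    have "norm (g' x) = norm (f (x + h) - f x) / h" using h by (simp add: g'_def divide_inverse mult.commute)
    also have "\<dots> \<le> (M * h) / h" using lip[where x = x and y = "x + h"] h by (intro divide_right_mono) auto
    finally show ?thesis using h by simp
  qed
qed

section \<open>The formal Riccati solution\<close>

text \<open>Each step of the recursion costs one derivative, hence \<open>c\<^sub>N\<close> with \<open>N = n + 1\<close> is merely bounded and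
Lipschitz continuous.\<close>

lemma dirac_coeff_bounded_smooth:
  assumes q: "bounded_smooth n q"
  shows "1 \<le> j \<Longrightarrow> j \<le> Suc n \<Longrightarrow> bounded_smooth (Suc n - j) (dirac_coeff q j)"
proof (induction j rule: less_induct)
  case (less j)
  show ?case
  proof (cases "j = 1")
    case True
    have "bounded_smooth n (\<lambda>x. (- 1 / 2) * cnj (q x))"
      by (intro bounded_smooth_mult bounded_smooth_const bounded_smooth_cnj q)
    then show ?thesis using True by (simp add: field_simps)
  next
    case False
    then obtain i where j: "j = Suc (Suc i)" using less.prems by (metis One_nat_def Suc_leD not0_implies_Suc not_one_le_zero)
    have i: "Suc i \<le> n" using less.prems j by simp
    have e: "Suc n - Suc i = Suc (n - Suc i)" using i by simp
    have "bounded_smooth (Suc n - Suc i) (dirac_coeff q (Suc i))"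
      by (rule less.IH) (use j i in auto)
    then have "bounded_smooth (Suc (n - Suc i)) (dirac_coeff q (Suc i))" unfolding e .
    then have 1: "bounded_smooth (n - Suc i) (\<lambda>x. vector_derivative (dirac_coeff q (Suc i)) (at x))"
      by (rule bounded_smooth_vector_derivative(1))
    have 2: "bounded_smooth (n - Suc i) (dirac_coeff q l)" if "1 \<le> l" "l \<le> i" for l
      using less.IH[of l] that i j by (intro bounded_smooth_mono[of "Suc n - l" _ "n - Suc i"]) auto
    have 3: "bounded_smooth (n - Suc i) q" using bounded_smooth_mono[OF q] by simp
    have "bounded_smooth (n - Suc i) (\<lambda>x. - (\<i> / 2) * vector_derivative (dirac_coeff q (Suc i)) (at x)
          + (1 / 2) * q x * (\<Sum>l=1..i. dirac_coeff q l x * dirac_coeff q (Suc i - l) x))"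
      by (intro bounded_smooth_add bounded_smooth_mult bounded_smooth_const bounded_smooth_sum 1 2 3) auto
    then show ?thesis using j by simp
  qed
qed

lemma finite_uniform_constant:
  assumes "finite A" "\<And>j. j \<in> A \<Longrightarrow> \<exists>M::real. P j M" "\<And>j M L. P j M \<Longrightarrow> M \<le> L \<Longrightarrow> P j L"
  shows "\<exists>M>0. \<forall>j\<in>A. P j M"
  using assms(1,2)
proof (induction A)
  case empty
  show ?case by (auto intro: zero_less_one)
next
  case (insert a A)
  obtain M where "M > 0" "\<forall>j\<in>A. P j M" using insert by auto
  moreover obtain L where "P a L" using insert by auto
  ultimately show ?case using assms(3) by (intro exI[of _ "max M L"]) (auto intro: max.cobounded1 max.cobounded2)
qed

text \<open>In the residual of \<open>m = \<Sum> c\<^sub>j z\<^sup>-\<^sup>j\<close> all terms of order below \<open>N = n + 1\<close> cancel by the recursion. What remains is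
the part of \<open>m\<^sup>2\<close> with total degree at least \<open>N\<close>, the derivative of the last coefficient, and the error
\<open>2 i z (g - c\<^sub>N) z\<^sup>-\<^sup>N\<close> made by the average \<open>g\<close>; averaging over length \<open>1 / |z|\<close> gives all of these the
same order.\<close>

lemma riccati_approximation:
  assumes q: "bounded_smooth n q"
  shows "\<exists>C>0. \<forall>z. 1 \<le> norm z \<longrightarrow> (\<exists>m m'. (\<forall>x. (m has_vector_derivative m' x) (at x)) \<and>
    (\<forall>x. norm (2 * \<i> * z * m x + \<i> * cnj (q x) - \<i> * q x * (m x)\<^sup>2 - m' x) \<le> C * inverse (norm z) ^ Suc n) \<and>
    (\<forall>J\<le>n. \<forall>x. norm (m x - (\<Sum>j=1..J. dirac_coeff q j x * inverse z ^ j)) \<le> C * inverse (norm z) ^ Suc J))"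
proof -
  let ?c = "dirac_coeff q"
  define N where "N = Suc n"
  define c' where "c' = (\<lambda>j x. vector_derivative (?c j) (at x))"
  have bs: "bounded_smooth (N - j) (?c j)" if "1 \<le> j" "j \<le> N" for j
    using dirac_coeff_bounded_smooth[OF q] that by (simp add: N_def)
  have bs': "bounded_smooth (Suc (n - j)) (?c j)" if "1 \<le> j" "j \<le> n" for j
    using bs[of j] that by (simp add: N_def Suc_diff_le)
  have "\<exists>M>0. \<forall>j\<in>{1..N}. (\<forall>x. norm (?c j x) \<le> M) \<and> (\<forall>x y. norm (?c j y - ?c j x) \<le> M * \<bar>y - x\<bar>)"
  proof (rule finite_uniform_constant)
    fix j assume "j \<in> {1..N}"
    then have "bounded_smooth (N - j) (?c j)" by (simp add: bs)
    then show "\<exists>M. (\<forall>x. norm (?c j x) \<le> M) \<and> (\<forall>x y. norm (?c j y - ?c j x) \<le> M * \<bar>y - x\<bar>)"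
      by (rule bounded_smooth_lipschitz) blast
  next
    fix j M L assume "(\<forall>x. norm (?c j x) \<le> M) \<and> (\<forall>x y. norm (?c j y - ?c j x) \<le> M * \<bar>y - x\<bar>)" "M \<le> (L::real)"
    then show "(\<forall>x. norm (?c j x) \<le> L) \<and> (\<forall>x y. norm (?c j y - ?c j x) \<le> L * \<bar>y - x\<bar>)"
      by (meson abs_ge_zero mult_right_mono order_trans)
  qed simp
  then obtain M where M0: "M > 0" and M': "\<forall>j\<in>{1..N}. (\<forall>x. norm (?c j x) \<le> M) \<and> (\<forall>x y. norm (?c j y - ?c j x) \<le> M * \<bar>y - x\<bar>)"
    by blast
  have M: "norm (?c j x) \<le> M" "norm (?c j y - ?c j x) \<le> M * \<bar>y - x\<bar>" if "1 \<le> j" "j \<le> N" for j x y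
    using M' that by simp_all
  obtain Q where Q0: "Q > 0" and Q: "\<And>x. norm (q x) \<le> Q" by (rule bounded_smooth_lipschitz[OF q]) blast
  define C where "C = 2 * M * N + (3 * M + Q * (4 * M\<^sup>2 * N\<^sup>2))"
  have C: "C > 0" "2 * M * N \<le> C" "3 * M + Q * (4 * M\<^sup>2 * N\<^sup>2) \<le> C"
    using M0 Q0 by (auto simp: C_def N_def intro!: add_pos_nonneg mult_pos_pos)
  show ?thesis
  proof (intro exI[of _ C] conjI allI impI C(1))
    fix z :: complex assume z: "1 \<le> norm z"
    define \<zeta> where "\<zeta> = inverse z"
    have z0: "z \<noteq> 0" using z by auto
    have \<zeta>n: "norm \<zeta> = inverse (norm z)" by (simp add: \<zeta>_def norm_inverse)
    have \<zeta>1: "norm \<zeta> \<le> 1" using z by (simp add: \<zeta>n inverse_le_1_iff)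
    have \<zeta>0: "norm \<zeta> > 0" using z0 by (simp add: \<zeta>_def)
    obtain g g' where g: "\<And>x. (g has_vector_derivative g' x) (at x)"
      "\<And>x. norm (g x - ?c N x) \<le> M * norm \<zeta>" "\<And>x. norm (g' x) \<le> M"
    proof (rule bounded_smooth_average[of "?c N" M "norm \<zeta>"])
      show "norm (?c N x) \<le> M" "norm (?c N y - ?c N x) \<le> M * \<bar>y - x\<bar>" for x y
        using M[of N] by (simp_all add: N_def)
    qed (use \<zeta>0 in blast)+
    \<comment> \<open>The coefficients of the approximation: the last one is replaced by its average.\<close>
    define d where "d = (\<lambda>j. if j < N then ?c j else g)"
    define d' where "d' = (\<lambda>j. if j < N then c' j else g')"
    define m where "m = (\<lambda>x. \<Sum>j=1..N. d j x * \<zeta> ^ j)"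
    define m' where "m' = (\<lambda>x. \<Sum>j=1..N. d' j x * \<zeta> ^ j)"
    have dd: "(d j has_vector_derivative d' j x) (at x)" if "1 \<le> j" for j x
      using bounded_smooth_vector_derivative(2)[OF bs'[of j], of x] that g(1) by (auto simp: d_def d'_def c'_def N_def)
    have dM: "norm (d j x) \<le> 2 * M" if "1 \<le> j" for j x
    proof (cases "j < N")
      case True
      then show ?thesis using M(1)[of j x] that M0 by (simp add: d_def)
    next
      case False
      have "norm (g x) \<le> norm (g x - ?c N x) + norm (?c N x)" by norm
      also have "\<dots> \<le> M * norm \<zeta> + M" using g(2) M(1)[of N x] by (intro add_mono) (auto simp: N_def)
      also have "\<dots> \<le> 2 * M" using \<zeta>1 M0 by simp
      finally show ?thesis using False by (simp add: d_def)
    qed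
    have tail: "norm (m x - (\<Sum>j=1..J. ?c j x * \<zeta> ^ j)) \<le> C * norm \<zeta> ^ Suc J" if J: "J \<le> n" for J x
    proof -
      have "{1..N} = {1..J} \<union> {Suc J..N}" using J by (auto simp: N_def)
      then have "m x = (\<Sum>j=1..J. d j x * \<zeta> ^ j) + (\<Sum>j=Suc J..N. d j x * \<zeta> ^ j)"
        unfolding m_def by (simp add: sum.union_disjoint)
      also have "(\<Sum>j=1..J. d j x * \<zeta> ^ j) = (\<Sum>j=1..J. ?c j x * \<zeta> ^ j)"
        using J by (intro sum.cong) (auto simp: d_def N_def)
      finally have "norm (m x - (\<Sum>j=1..J. ?c j x * \<zeta> ^ j)) = norm (\<Sum>j=Suc J..N. d j x * \<zeta> ^ j)" by simp
      also have "\<dots> \<le> (\<Sum>j=Suc J..N. 2 * M * norm \<zeta> ^ Suc J)"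
        unfolding norm_mult norm_power
        by (intro sum_norm_le) (auto simp: norm_mult norm_power simp del: power_Suc intro!: mult_mono dM power_decreasing \<zeta>1 M0[THEN less_imp_le])
      also have "\<dots> \<le> N * (2 * M * norm \<zeta> ^ Suc J)"
        using M0 by (simp del: power_Suc) (intro mult_right_mono, auto)
      also have "\<dots> \<le> C * norm \<zeta> ^ Suc J"
        using mult_right_mono[OF C(2), of "norm \<zeta> ^ Suc J"] by (simp add: mult_ac)
      finally show ?thesis .
    qed
    define S where "S = (\<lambda>k x. \<Sum>l=1..k-1. ?c l x * ?c (k - l) x)"
    have msq: "\<exists>T. (m x)\<^sup>2 = (\<Sum>k=1..n. S k x * \<zeta> ^ k) + T \<and> norm T \<le> 4 * M\<^sup>2 * N\<^sup>2 * norm \<zeta> ^ N" for x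
    proof -
      \<comment> \<open>The pairs of total degree at most \<open>n\<close> only involve the unchanged coefficients.\<close>
      define P where "P = {1..N} \<times> {1..N}"
      define F where "F = (\<lambda>(j, l). (d j x * \<zeta> ^ j) * (d l x * \<zeta> ^ l))"
      define P1 where "P1 = {p \<in> P. fst p + snd p \<le> n}"
      define P2 where "P2 = {p \<in> P. \<not> fst p + snd p \<le> n}"
      have fin: "finite P" by (simp add: P_def)
      have "(m x)\<^sup>2 = sum F P"
        unfolding m_def power2_eq_square sum_product P_def F_def by (simp add: sum.cartesian_product)
      also have "\<dots> = sum F (P1 \<union> P2)" by (rule sum.cong) (auto simp: P1_def P2_def)
      also have "\<dots> = sum F P1 + sum F P2"
        using fin by (intro sum.union_disjoint) (auto simp: P1_def P2_def)
      also have "sum F P1 = (\<Sum>(k, l)\<in>Sigma {1..n} (\<lambda>k. {1..k-1}). ?c l x * ?c (k - l) x * \<zeta> ^ k)"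
        by (rule sum.reindex_bij_witness[where i = "\<lambda>(k, l). (l, k - l)" and j = "\<lambda>(j, l). (j + l, j)"])
          (auto simp: P1_def P_def F_def N_def d_def power_add mult_ac)
      also have "\<dots> = (\<Sum>k=1..n. S k x * \<zeta> ^ k)"
        by (simp add: sum.Sigma[symmetric] S_def sum_distrib_right)
      finally have 1: "(m x)\<^sup>2 = (\<Sum>k=1..n. S k x * \<zeta> ^ k) + sum F P2" .
      have "norm (sum F P2) \<le> (\<Sum>p\<in>P2. 4 * M\<^sup>2 * norm \<zeta> ^ N)"
      proof (rule sum_norm_le)
        fix p assume p: "p \<in> P2"
        obtain j l where jl: "p = (j, l)" by (cases p)
        have "norm (F p) = (norm (d j x) * norm (d l x)) * norm \<zeta> ^ (j + l)"
          by (simp add: jl F_def norm_mult norm_power power_add)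
        also have "\<dots> \<le> ((2 * M) * (2 * M)) * norm \<zeta> ^ N"
          using p M0 \<zeta>1 jl by (intro mult_mono dM power_decreasing) (auto simp: P2_def P_def N_def)
        finally show "norm (F p) \<le> 4 * M\<^sup>2 * norm \<zeta> ^ N" by (simp add: power2_eq_square)
      qed
      also have "\<dots> = card P2 * (4 * M\<^sup>2 * norm \<zeta> ^ N)" by simp
      also have "\<dots> \<le> N\<^sup>2 * (4 * M\<^sup>2 * norm \<zeta> ^ N)"
      proof (rule mult_right_mono)
        have "card P2 \<le> card P" using fin by (intro card_mono) (auto simp: P2_def)
        also have "\<dots> = N\<^sup>2" by (simp add: P_def power2_eq_square)
        finally show "real (card P2) \<le> real (N\<^sup>2)" by simp
      qed simp
      finally show ?thesis using 1 by (intro exI[of _ "sum F P2"]) (simp add: mult_ac)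
    qed
    have c_rec: "2 * \<i> * ?c (Suc k) x = c' k x + \<i> * q x * S k x" if "1 \<le> k" for k x
    proof -
      have "?c (Suc k) x = - (\<i> / 2) * c' k x + q x / 2 * S k x"
        using dirac_coeff_rec[OF that] by (simp add: c'_def S_def)
      then have "2 * \<i> * ?c (Suc k) x = 2 * \<i> * (- (\<i> / 2) * c' k x + q x / 2 * S k x)" by simp
      also have "\<dots> = c' k x + \<i> * q x * S k x" by (simp add: right_diff_distrib)
      finally show ?thesis .
    qed
    have resid: "norm (2 * \<i> * z * m x + \<i> * cnj (q x) - \<i> * q x * (m x)\<^sup>2 - m' x) \<le> C * norm \<zeta> ^ N" for x
    proof -
      obtain T where T: "(m x)\<^sup>2 = (\<Sum>k=1..n. S k x * \<zeta> ^ k) + T" "norm T \<le> 4 * M\<^sup>2 * N\<^sup>2 * norm \<zeta> ^ N"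
        using msq by blast
      have sh: "(\<Sum>j=1..N. f j) = f 1 + (\<Sum>k=1..n. f (Suc k))" for f :: "nat \<Rightarrow> complex"
        unfolding N_def by (simp add: sum.atLeast_Suc_atMost sum.shift_bounds_cl_Suc_ivl del: sum.cl_ivl_Suc)
      have "z * m x = (\<Sum>j=1..N. d j x * \<zeta> ^ (j - 1))"
        unfolding m_def sum_distrib_left
      proof (rule sum.cong)
        fix j assume "j \<in> {1..N}"
        then have "\<zeta> ^ j = \<zeta> * \<zeta> ^ (j - 1)" by (cases j) auto
        then show "z * (d j x * \<zeta> ^ j) = d j x * \<zeta> ^ (j - 1)" using z0 by (simp add: \<zeta>_def)
      qed simp
      also have "\<dots> = (\<Sum>j=1..N. ?c j x * \<zeta> ^ (j - 1)) + (\<Sum>j=1..N. (d j x - ?c j x) * \<zeta> ^ (j - 1))"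
        by (simp add: sum.distrib[symmetric] algebra_simps)
      also have "(\<Sum>j=1..N. (d j x - ?c j x) * \<zeta> ^ (j - 1)) = (g x - ?c N x) * \<zeta> ^ n"
        by (simp add: N_def d_def)
      also have "(\<Sum>j=1..N. ?c j x * \<zeta> ^ (j - 1)) = - cnj (q x) / 2 + (\<Sum>k=1..n. ?c (Suc k) x * \<zeta> ^ k)"
        by (subst sh) simp
      finally have "2 * \<i> * z * m x = 2 * \<i> * (- cnj (q x) / 2 + (\<Sum>k=1..n. ?c (Suc k) x * \<zeta> ^ k) + (g x - ?c N x) * \<zeta> ^ n)"
        by (simp add: mult.assoc)
      also have "\<dots> = - \<i> * cnj (q x) + (\<Sum>k=1..n. (2 * \<i> * ?c (Suc k) x) * \<zeta> ^ k) + 2 * \<i> * (g x - ?c N x) * \<zeta> ^ n"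
        by (simp add: ring_distribs sum_distrib_left mult.assoc)
      also have "(\<Sum>k=1..n. (2 * \<i> * ?c (Suc k) x) * \<zeta> ^ k) = (\<Sum>k=1..n. c' k x * \<zeta> ^ k) + \<i> * q x * (\<Sum>k=1..n. S k x * \<zeta> ^ k)"
        unfolding sum_distrib_left sum.distrib[symmetric]
      proof (rule sum.cong[OF refl])
        fix k assume "k \<in> {1..n}"
        then have "2 * \<i> * ?c (Suc k) x = c' k x + \<i> * q x * S k x" by (intro c_rec) simp
        then show "(2 * \<i> * ?c (Suc k) x) * \<zeta> ^ k = c' k x * \<zeta> ^ k + \<i> * q x * (S k x * \<zeta> ^ k)"
          by (simp only: distrib_right mult.assoc)
      qed
      finally have 1: "2 * \<i> * z * m x = - \<i> * cnj (q x) + ((\<Sum>k=1..n. c' k x * \<zeta> ^ k) + \<i> * q x * (\<Sum>k=1..n. S k x * \<zeta> ^ k)) + 2 * \<i> * (g x - ?c N x) * \<zeta> ^ n" .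
      have 2: "m' x = (\<Sum>k=1..n. c' k x * \<zeta> ^ k) + g' x * \<zeta> ^ N"
        unfolding m'_def by (simp add: N_def d'_def)
      have "2 * \<i> * z * m x + \<i> * cnj (q x) - \<i> * q x * (m x)\<^sup>2 - m' x
        = 2 * \<i> * (g x - ?c N x) * \<zeta> ^ n - \<i> * q x * T - g' x * \<zeta> ^ N"
        unfolding 1 2 T(1) by (simp add: algebra_simps)
      also have "norm \<dots> \<le> norm (2 * \<i> * (g x - ?c N x) * \<zeta> ^ n) + norm (\<i> * q x * T) + norm (g' x * \<zeta> ^ N)"
        by norm
      also have "\<dots> \<le> 2 * (M * norm \<zeta>) * norm \<zeta> ^ n + Q * (4 * M\<^sup>2 * N\<^sup>2 * norm \<zeta> ^ N) + M * norm \<zeta> ^ N"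
        unfolding norm_mult norm_power
        using Q0 less_imp_le[OF M0] g(2)[of x] g(3)[of x] Q[of x] T(2) by (intro add_mono mult_mono) auto
      also have "\<dots> = (3 * M + Q * (4 * M\<^sup>2 * N\<^sup>2)) * norm \<zeta> ^ N"
        by (simp add: N_def algebra_simps)
      also have "\<dots> \<le> C * norm \<zeta> ^ N" using C(3) by (intro mult_right_mono) auto
      finally show ?thesis .
    qed
    have "(m has_vector_derivative m' x) (at x)" for x
      unfolding m_def m'_def
      by (intro has_vector_derivative_sum has_vector_derivative_mult_left dd) auto
    then show "\<exists>m m'. (\<forall>x. (m has_vector_derivative m' x) (at x)) \<and>
      (\<forall>x. norm (2 * \<i> * z * m x + \<i> * cnj (q x) - \<i> * q x * (m x)\<^sup>2 - m' x) \<le> C * inverse (norm z) ^ Suc n) \<and>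
      (\<forall>J\<le>n. \<forall>x. norm (m x - (\<Sum>j=1..J. ?c j x * inverse z ^ j)) \<le> C * inverse (norm z) ^ Suc J)"
      using resid tail unfolding \<zeta>n[symmetric] N_def[symmetric] \<zeta>_def[symmetric] by blast
  qed
qed

section \<open>The Dirac system and its invariant cones\<close>

text \<open>The eigenvalue equation in components, solved for the derivatives.\<close>

definition dirac_system :: "(real \<Rightarrow> complex) \<Rightarrow> complex \<Rightarrow> (real \<Rightarrow> complex) \<Rightarrow> (real \<Rightarrow> complex) \<Rightarrow> bool" where
  "dirac_system q z f g \<longleftrightarrow>
     (\<forall>x. (f has_vector_derivative - \<i> * z * f x + \<i> * q x * g x) (at x)) \<and>
     (\<forall>x. (g has_vector_derivative \<i> * z * g x + \<i> * cnj (q x) * f x) (at x))"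

lemma has_vector_derivative_pair_iff:
  fixes f :: "real \<Rightarrow> complex ^ 2"
  shows "(f has_vector_derivative v) (at x) \<longleftrightarrow>
    ((\<lambda>x. f x $ 1) has_vector_derivative v $ 1) (at x) \<and> ((\<lambda>x. f x $ 2) has_vector_derivative v $ 2) (at x)"
    (is "?l \<longleftrightarrow> ?r")
proof
  show "?l \<Longrightarrow> ?r" by (auto intro: bounded_linear.has_vector_derivative[OF bounded_linear_vec_nth])
next
  have ax: "axis 1 (y $ 1) + axis 2 (y $ 2) = y" for y :: "complex ^ 2"
    by (simp add: vec_eq_iff axis_def forall_2)
  have bl: "bounded_linear (axis i :: complex \<Rightarrow> complex ^ 2)" for i
  proof -
    have "linear (axis i :: complex \<Rightarrow> complex ^ 2)" by (rule linearI) (auto simp: vec_eq_iff axis_def)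
    then show ?thesis by (simp add: linear_conv_bounded_linear)
  qed
  assume ?r
  then have "((\<lambda>x. axis 1 (f x $ 1) + axis 2 (f x $ 2)) has_vector_derivative (axis 1 (v $ 1) + axis 2 (v $ 2) :: complex ^ 2)) (at x)"
    by (intro has_vector_derivative_add bounded_linear.has_vector_derivative[OF bl]) auto
  then show ?l unfolding ax .
qed

lemma dirac_ns_components:
  "dirac_ns q f x $ 1 = \<i> * vector_derivative f (at x) $ 1 + q x * f x $ 2"
  "dirac_ns q f x $ 2 = - \<i> * vector_derivative f (at x) $ 2 - cnj (q x) * f x $ 1"
  by (simp_all add: dirac_ns_def matrix_vector_mult_def sum_2 vector_2)

lemma dirac_ns_solution_iff:
  "dirac_ns_solution q z f \<longleftrightarrow> dirac_system q z (\<lambda>x. f x $ 1) (\<lambda>x. f x $ 2)"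
proof -
  have lin1: "\<i> * v + a = b \<longleftrightarrow> v = - \<i> * b + \<i> * a" for v a b :: complex
  proof -
    have "\<i> * v + a = b \<longleftrightarrow> - \<i> * (\<i> * v + a) = - \<i> * b"
      by (metis complex_i_not_zero mult_cancel_left neg_equal_0_iff_equal)
    then show ?thesis by (auto simp: algebra_simps)
  qed
  have lin2: "- \<i> * v - a = b \<longleftrightarrow> v = \<i> * b + \<i> * a" for v a b :: complex
  proof -
    have "- \<i> * v - a = b \<longleftrightarrow> \<i> * (- \<i> * v - a) = \<i> * b"
      by (metis complex_i_not_zero mult_cancel_left)
    then show ?thesis by (auto simp: algebra_simps)
  qed
  have "f differentiable (at x) \<and> dirac_ns q f x = z *s f x \<longleftrightarrow>
    ((\<lambda>x. f x $ 1) has_vector_derivative - \<i> * z * f x $ 1 + \<i> * q x * f x $ 2) (at x) \<and>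
    ((\<lambda>x. f x $ 2) has_vector_derivative \<i> * z * f x $ 2 + \<i> * cnj (q x) * f x $ 1) (at x)" (is "?l \<longleftrightarrow> ?r") for x
  proof
    assume ?l
    let ?v = "vector_derivative f (at x)"
    have "\<i> * ?v $ 1 + q x * f x $ 2 = z * f x $ 1" "- \<i> * ?v $ 2 - cnj (q x) * f x $ 1 = z * f x $ 2"
      using \<open>?l\<close> dirac_ns_components[of q f x] by auto
    then have "?v $ 1 = - \<i> * z * f x $ 1 + \<i> * q x * f x $ 2" "?v $ 2 = \<i> * z * f x $ 2 + \<i> * cnj (q x) * f x $ 1"
      unfolding lin1 lin2 by (simp_all add: mult.assoc)
    moreover have "(f has_vector_derivative ?v) (at x)" using \<open>?l\<close> vector_derivative_works by blast
    ultimately show ?r unfolding has_vector_derivative_pair_iff by simp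
  next
    assume r: ?r
    define v :: "complex ^ 2" where "v = vector [- \<i> * z * f x $ 1 + \<i> * q x * f x $ 2, \<i> * z * f x $ 2 + \<i> * cnj (q x) * f x $ 1]"
    have v: "v $ 1 = - \<i> * z * f x $ 1 + \<i> * q x * f x $ 2" "v $ 2 = \<i> * z * f x $ 2 + \<i> * cnj (q x) * f x $ 1"
      by (simp_all add: v_def vector_2)
    have fv: "(f has_vector_derivative v) (at x)" unfolding has_vector_derivative_pair_iff using r v by simp
    then have vd: "vector_derivative f (at x) = v" by (rule vector_derivative_at)
    have "\<i> * v $ 1 + q x * f x $ 2 = z * f x $ 1" "- \<i> * v $ 2 - cnj (q x) * f x $ 1 = z * f x $ 2"
      unfolding lin1 lin2 using v by (simp_all add: mult.assoc)
    then have "dirac_ns q f x = z *s f x"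
      using dirac_ns_components[of q f x] by (simp add: vec_eq_iff forall_2 vd)
    then show ?l using fv differentiableI_vector by blast
  qed
  then show ?thesis unfolding dirac_ns_solution_def dirac_system_def by blast
qed

lemma dirac_system_combination:
  assumes "dirac_system q z f g" "dirac_system q z f' g'"
  shows "dirac_system q z (\<lambda>x. a * f x + b * f' x) (\<lambda>x. a * g x + b * g' x)"
proof -
  have "((\<lambda>x. a * f x + b * f' x) has_vector_derivative
    a * (- \<i> * z * f x + \<i> * q x * g x) + b * (- \<i> * z * f' x + \<i> * q x * g' x)) (at x)" for x
    using assms by (intro has_vector_derivative_add has_vector_derivative_mult_right) (auto simp: dirac_system_def)
  moreover have "((\<lambda>x. a * g x + b * g' x) has_vector_derivative
    a * (\<i> * z * g x + \<i> * cnj (q x) * f x) + b * (\<i> * z * g' x + \<i> * cnj (q x) * f' x)) (at x)" for x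
    using assms by (intro has_vector_derivative_add has_vector_derivative_mult_right) (auto simp: dirac_system_def)
  ultimately show ?thesis unfolding dirac_system_def by (simp add: algebra_simps)
qed

lemma norm_square_derivative:
  assumes "(f has_vector_derivative f') (at x)"
  shows "((\<lambda>x. (norm (f x))\<^sup>2) has_real_derivative 2 * Re (cnj (f x) * f')) (at x)"
proof -
  have "((\<lambda>x. Re (f x)) has_real_derivative Re f') (at x)" "((\<lambda>x. Im (f x)) has_real_derivative Im f') (at x)"
    unfolding has_real_derivative_iff_has_vector_derivative
    using assms by (auto intro: bounded_linear.has_vector_derivative bounded_linear_Re bounded_linear_Im)
  from DERIV_add[OF DERIV_power[OF this(1), of 2] DERIV_power[OF this(2), of 2]]
  show ?thesis by (simp add: cmod_power2 algebra_simps)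
qed

lemma exponential_growth:
  fixes h h' :: "real \<Rightarrow> real"
  assumes h: "\<And>x. (h has_real_derivative h' x) (at x)"
    and "\<And>x. a \<le> x \<Longrightarrow> x \<le> b \<Longrightarrow> r * h x \<le> h' x" and "a \<le> b"
  shows "h a * exp (r * (b - a)) \<le> h b"
proof -
  have "h a * exp (- r * a) \<le> h b * exp (- r * b)"
  proof (rule DERIV_nonneg_imp_nondecreasing[OF \<open>a \<le> b\<close>])
    fix x assume x: "a \<le> x" "x \<le> b"
    have "((\<lambda>x. h x * exp (- r * x)) has_real_derivative (h' x - r * h x) * exp (- r * x)) (at x)"
      by (rule derivative_eq_intros h refl | simp add: algebra_simps)+
    moreover have "(h' x - r * h x) * exp (- r * x) \<ge> 0" using assms(2)[OF x] by simp
    ultimately show "\<exists>y. ((\<lambda>x. h x * exp (- r * x)) has_real_derivative y) (at x) \<and> 0 \<le> y" by blast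
  qed
  then have "h a * exp (- r * a) * exp (r * b) \<le> h b * exp (- r * b) * exp (r * b)"
    by (rule mult_right_mono) simp
  then show ?thesis by (simp add: mult.assoc algebra_simps flip: exp_add)
qed

text \<open>The potential enters through a skew-Hermitian matrix and drops out of the derivative of the norm.\<close>

lemma dirac_system_norm_derivative:
  assumes "dirac_system q z f g"
  shows "((\<lambda>x. (norm (f x))\<^sup>2 + (norm (g x))\<^sup>2) has_real_derivative
    2 * Im z * ((norm (f x))\<^sup>2 - (norm (g x))\<^sup>2)) (at x)"
proof -
  have "((\<lambda>x. (norm (f x))\<^sup>2 + (norm (g x))\<^sup>2) has_real_derivative
    2 * Re (cnj (f x) * (- \<i> * z * f x + \<i> * q x * g x)) + 2 * Re (cnj (g x) * (\<i> * z * g x + \<i> * cnj (q x) * f x))) (at x)"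
    using assms by (intro DERIV_add norm_square_derivative) (auto simp: dirac_system_def)
  moreover have "2 * Re (cnj (f x) * (- \<i> * z * f x + \<i> * q x * g x)) + 2 * Re (cnj (g x) * (\<i> * z * g x + \<i> * cnj (q x) * f x))
    = 2 * Im z * ((norm (f x))\<^sup>2 - (norm (g x))\<^sup>2)"
    unfolding cmod_power2 by (simp add: power2_eq_square algebra_simps)
  ultimately show ?thesis by simp
qed

text \<open>Uniqueness for the initial value problem, in both directions, because the logarithmic derivative of the
squared norm is at most \<open>2 |Im z|\<close>.\<close>

lemma dirac_system_zero:
  assumes s: "dirac_system q z f g" and "f 0 = 0" "g 0 = 0"
  shows "f x = 0 \<and> g x = 0"
proof -
  define s where "s = (\<lambda>x. (norm (f x))\<^sup>2 + (norm (g x))\<^sup>2)"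
  define s' where "s' = (\<lambda>x. 2 * Im z * ((norm (f x))\<^sup>2 - (norm (g x))\<^sup>2))"
  have d: "(s has_real_derivative s' x) (at x)" for x
    unfolding s_def s'_def by (rule dirac_system_norm_derivative[OF s])
  have b: "\<bar>s' x\<bar> \<le> 2 * \<bar>Im z\<bar> * s x" for x
    unfolding s'_def s_def abs_mult by (intro mult_mono) (auto simp: abs_le_iff)
  have "s x \<le> 0"
  proof (cases "0 \<le> x")
    case True
    have "- s 0 * exp (2 * \<bar>Im z\<bar> * (x - 0)) \<le> - s x"
    proof (rule exponential_growth[where h = "\<lambda>x. - s x" and h' = "\<lambda>x. - s' x"])
      show "((\<lambda>x. - s x) has_real_derivative - s' x) (at x)" for x using d by (rule DERIV_minus)
      show "2 * \<bar>Im z\<bar> * - s x \<le> - s' x" for x using b[of x] by simp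
    qed (rule True)
    then show ?thesis using assms by (simp add: s_def)
  next
    case False
    have "s x * exp (- (2 * \<bar>Im z\<bar>) * (0 - x)) \<le> s 0"
    proof (rule exponential_growth[OF d])
      show "- (2 * \<bar>Im z\<bar>) * s x \<le> s' x" for x using b[of x] by simp
    qed (use False in simp)
    then show ?thesis using assms by (simp add: s_def mult_le_0_iff)
  qed
  then have "(norm (f x))\<^sup>2 = 0 \<and> (norm (g x))\<^sup>2 = 0"
    unfolding s_def using add_nonneg_eq_0_iff by (metis add_nonneg_nonneg order_antisym zero_le_power2)
  then show ?thesis by simp
qed

text \<open>The coordinates with respect to the vectors \<open>(- cnj c, 1)\<close> and \<open>(1, c)\<close>, which are orthogonal and of
equal length.\<close>

lemma frame_norm:
  "(norm (b - c * a))\<^sup>2 + (norm (a + cnj c * b))\<^sup>2 = (1 + (norm c)\<^sup>2) * ((norm a)\<^sup>2 + (norm b)\<^sup>2)"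
  for a b c :: complex
  unfolding cmod_power2 by (simp add: power2_eq_square algebra_simps)

lemma abs_2_Re: "\<bar>2 * Re c\<bar> \<le> 2 * norm c"
  using abs_Re_le_cmod[of c] by (simp add: abs_mult)

text \<open>An approximate solution \<open>m\<close> of the Riccati equation with residual at most \<open>e\<close>. The bound on \<open>e\<close> makes
the quadratic forms below increase for \<open>k = 1 / 2\<close> and \<open>k = 1\<close>.\<close>

locale approximate_weyl_function =
  fixes q :: "real \<Rightarrow> complex" and z :: complex and m m' :: "real \<Rightarrow> complex" and e :: real
  assumes lower: "Im z < 0"
    and m_deriv: "\<And>x. (m has_vector_derivative m' x) (at x)"
    and m_small: "\<And>x. norm (m x) \<le> 1 / 16"
    and residual: "\<And>x. norm (2 * \<i> * z * m x + \<i> * cnj (q x) - \<i> * q x * (m x)\<^sup>2 - m' x) \<le> e"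
    and e_small: "e \<le> - Im z / 16"
begin

definition cone_form :: "real \<Rightarrow> (real \<Rightarrow> complex) \<Rightarrow> (real \<Rightarrow> complex) \<Rightarrow> real \<Rightarrow> real" where
  "cone_form k f g x = ((norm (g x - m x * f x))\<^sup>2 - k\<^sup>2 * (norm (f x + cnj (m x) * g x))\<^sup>2) / (1 + (norm (m x))\<^sup>2)"

text \<open>With \<open>\<eta> = - Im z\<close> and \<open>\<kappa> = Im (q m)\<close> the squares of \<open>|u|\<close> and \<open>|w|\<close> grow with the rates \<open>2 (\<kappa> + \<eta>)\<close> and
\<open>2 (\<kappa> - \<eta>)\<close>, and the weight \<open>\<rho> = 1 + |m|\<^sup>2\<close> with the rate \<open>2 \<kappa>\<close>, up to the error terms \<open>X\<close>, \<open>Y\<close> and \<open>Z\<close>. In the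
quotient \<open>\<kappa>\<close> cancels, which is essential: it is bounded only by a multiple of \<open>1 / |z|\<close>, which may
exceed \<open>\<eta>\<close> by far. The errors consume less than half of the gain.\<close>

lemma cone_form_derivative:
  assumes s: "dirac_system q z f g" and k: "0 < k" "k \<le> 1" and ek: "e \<le> k * (- Im z) / 8"
  shows "\<exists>D. (cone_form k f g has_real_derivative D) (at x) \<and>
    - Im z * k\<^sup>2 * ((norm (f x))\<^sup>2 + (norm (g x))\<^sup>2) \<le> D"
proof -
  define \<eta> where "\<eta> = - Im z"
  have \<eta>: "\<eta> > 0" using lower by (simp add: \<eta>_def)
  define E where "E = 2 * \<i> * z * m x + \<i> * cnj (q x) - \<i> * q x * (m x)\<^sup>2 - m' x"
  have Ee: "norm E \<le> e" unfolding E_def by (rule residual)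
  have m'x: "m' x = 2 * \<i> * z * m x + \<i> * cnj (q x) - \<i> * q x * (m x)\<^sup>2 - E" by (simp add: E_def)
  define u w \<rho> where "u = (\<lambda>x. g x - m x * f x)" and "w = (\<lambda>x. f x + cnj (m x) * g x)" and "\<rho> = (\<lambda>x. 1 + (norm (m x))\<^sup>2)"
  define u' where "u' = (\<i> * z - \<i> * q x * m x) * u x + E * f x"
  define w' where "w' = (- \<i> * z + \<i> * cnj (q x) * cnj (m x)) * w x + (4 * of_real \<eta> * cnj (m x) - cnj E) * g x"
  have fd: "(f has_vector_derivative - \<i> * z * f x + \<i> * q x * g x) (at x)"
    and gd: "(g has_vector_derivative \<i> * z * g x + \<i> * cnj (q x) * f x) (at x)"
    using s by (auto simp: dirac_system_def)
  have ud: "(u has_vector_derivative u') (at x)"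
  proof -
    have "(u has_vector_derivative (\<i> * z * g x + \<i> * cnj (q x) * f x)
       - (m x * (- \<i> * z * f x + \<i> * q x * g x) + m' x * f x)) (at x)"
      unfolding u_def by (intro has_vector_derivative_diff has_vector_derivative_mult fd gd m_deriv)
    moreover have "(\<i> * z * g x + \<i> * cnj (q x) * f x) - (m x * (- \<i> * z * f x + \<i> * q x * g x) + m' x * f x) = u'"
      unfolding u'_def m'x u_def by (simp add: algebra_simps power2_eq_square)
    ultimately show ?thesis by simp
  qed
  have wd: "(w has_vector_derivative w') (at x)"
  proof -
    have "(w has_vector_derivative (- \<i> * z * f x + \<i> * q x * g x)
       + (cnj (m x) * (\<i> * z * g x + \<i> * cnj (q x) * f x) + cnj (m' x) * g x)) (at x)"
      unfolding w_def by (intro has_vector_derivative_add has_vector_derivative_mult has_vector_derivative_cnj fd gd m_deriv)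
    moreover have "(- \<i> * z * f x + \<i> * q x * g x) + (cnj (m x) * (\<i> * z * g x + \<i> * cnj (q x) * f x) + cnj (m' x) * g x) = w'"
    proof -
      have c: "cnj z = z + 2 * \<i> * of_real \<eta>" by (simp add: complex_eq_iff \<eta>_def)
      show ?thesis unfolding w'_def m'x w_def
        by (simp add: c algebra_simps power2_eq_square)
    qed
    ultimately show ?thesis by simp
  qed
  define A B where "A = (norm (u x))\<^sup>2" and "B = (norm (w x))\<^sup>2"
  define \<kappa> where "\<kappa> = Im (q x * m x)"
  define X where "X = 2 * Re (cnj (u x) * E * f x)"
  define Y where "Y = 2 * Re (cnj (w x) * (4 * of_real \<eta> * cnj (m x) - cnj E) * g x)"
  define Z where "Z = 4 * \<eta> * (norm (m x))\<^sup>2 - 2 * Re (cnj (m x) * E)"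
  have Ad: "((\<lambda>x. (norm (u x))\<^sup>2) has_real_derivative 2 * (\<eta> + \<kappa>) * A + X) (at x)"
  proof -
    have "2 * Re (cnj (u x) * u') = 2 * (\<eta> + \<kappa>) * A + X"
      unfolding u'_def A_def X_def \<kappa>_def \<eta>_def
      unfolding cmod_power2 by (simp add: power2_eq_square algebra_simps)
    then show ?thesis using norm_square_derivative[OF ud] by simp
  qed
  have Bd: "((\<lambda>x. (norm (w x))\<^sup>2) has_real_derivative 2 * (\<kappa> - \<eta>) * B + Y) (at x)"
  proof -
    have "2 * Re (cnj (w x) * w') = 2 * (\<kappa> - \<eta>) * B + Y"
      unfolding w'_def B_def Y_def \<kappa>_def \<eta>_def
      unfolding cmod_power2 by (simp add: power2_eq_square algebra_simps)
    then show ?thesis using norm_square_derivative[OF wd] by simp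
  qed
  have Rd: "(\<rho> has_real_derivative 2 * \<kappa> * \<rho> x + Z) (at x)"
  proof -
    have "2 * Re (cnj (m x) * m' x) = 2 * \<kappa> * \<rho> x + Z"
      unfolding m'x \<rho>_def Z_def \<kappa>_def \<eta>_def
      unfolding cmod_power2 by (simp add: power2_eq_square algebra_simps)
    moreover have "(\<rho> has_real_derivative 0 + 2 * Re (cnj (m x) * m' x)) (at x)"
      unfolding \<rho>_def by (rule DERIV_add[OF DERIV_const norm_square_derivative[OF m_deriv]])
    ultimately show ?thesis by simp
  qed
  have \<rho>1: "\<rho> x \<ge> 1" by (simp add: \<rho>_def)
  define D where "D = ((2 * (\<eta> + \<kappa>) * A + X - k\<^sup>2 * (2 * (\<kappa> - \<eta>) * B + Y)) * \<rho> x - (A - k\<^sup>2 * B) * (2 * \<kappa> * \<rho> x + Z)) / (\<rho> x)\<^sup>2"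
  have "((\<lambda>x. ((norm (u x))\<^sup>2 - k\<^sup>2 * (norm (w x))\<^sup>2) / \<rho> x) has_real_derivative D) (at x)"
    unfolding D_def A_def B_def power2_eq_square[of "\<rho> x"]
    by (intro DERIV_divide DERIV_diff DERIV_cmult Rd) (use Ad Bd \<rho>1 in \<open>auto simp: A_def B_def\<close>)
  moreover have "cone_form k f g = (\<lambda>x. ((norm (u x))\<^sup>2 - k\<^sup>2 * (norm (w x))\<^sup>2) / \<rho> x)"
    by (simp add: cone_form_def u_def w_def \<rho>_def fun_eq_iff)
  moreover have "\<eta> * k\<^sup>2 * ((norm (f x))\<^sup>2 + (norm (g x))\<^sup>2) \<le> D"
  proof -
    define a b where "a = norm (u x)" and "b = norm (w x)"
    define S where "S = A + k\<^sup>2 * B"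
    have ab0: "a \<ge> 0" "b \<ge> 0" by (auto simp: a_def b_def)
    have A: "A = a\<^sup>2" and B: "B = b\<^sup>2" by (auto simp: A_def B_def a_def b_def)
    have e: "norm E \<le> k * \<eta> / 8" using Ee ek by (simp add: \<eta>_def)
    have e2: "norm E \<le> \<eta> / 8"
      by (rule order_trans[OF e]) (use mult_right_mono[OF k(2), of \<eta>] \<eta> in simp)
    have frame: "of_real (\<rho> x) * f x = w x - cnj (m x) * u x" "of_real (\<rho> x) * g x = u x + m x * w x"
      unfolding \<rho>_def u_def w_def by (simp_all add: complex_norm_square algebra_simps flip: of_real_power)
    have fb: "norm (f x) \<le> b + a / 16"
    proof -
      have "norm (f x) \<le> \<rho> x * norm (f x)" using mult_right_mono[OF \<rho>1, of "norm (f x)"] by simp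
      also have "\<dots> = norm (w x - cnj (m x) * u x)" unfolding frame(1)[symmetric] norm_mult using \<rho>1 by simp
      also have "\<dots> \<le> b + norm (m x) * a" using norm_triangle_ineq4[of "w x" "cnj (m x) * u x"] by (simp add: norm_mult a_def b_def)
      also have "\<dots> \<le> b + (1 / 16) * a" using m_small[of x] ab0 by (intro add_mono mult_right_mono) auto
      finally show ?thesis by simp
    qed
    have gb: "norm (g x) \<le> a + b / 16"
    proof -
      have "norm (g x) \<le> \<rho> x * norm (g x)" using mult_right_mono[OF \<rho>1, of "norm (g x)"] by simp
      also have "\<dots> = norm (u x + m x * w x)" unfolding frame(2)[symmetric] norm_mult using \<rho>1 by simp
      also have "\<dots> \<le> a + norm (m x) * b" using norm_triangle_ineq[of "u x" "m x * w x"] by (simp add: norm_mult a_def b_def)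
      also have "\<dots> \<le> a + (1 / 16) * b" using m_small[of x] ab0 by (intro add_mono mult_right_mono) auto
      finally show ?thesis by simp
    qed
    have S0: "S \<ge> 0" by (simp add: S_def A B)
    have kab: "2 * (k * (a * b)) \<le> S"
      using sum_squares_bound[of a "k * b"] by (simp add: S_def A B power_mult_distrib mult_ac)
    have aS: "a\<^sup>2 \<le> S" and bS: "k\<^sup>2 * b\<^sup>2 \<le> S" by (simp_all add: S_def A B)
    have Xb: "\<bar>X\<bar> \<le> 9 / 64 * (\<eta> * S)"
    proof -
      have "\<bar>X\<bar> \<le> 2 * norm (cnj (u x) * E * f x)" unfolding X_def by (rule abs_2_Re)
      also have "\<dots> = 2 * (a * norm E * norm (f x))" by (simp add: norm_mult a_def)
      also have "\<dots> \<le> 2 * (a * (k * \<eta> / 8) * (b + a / 16))"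
        using e fb ab0 k \<eta> by (intro mult_left_mono mult_mono) auto
      also have "\<dots> = \<eta> / 8 * (2 * (k * (a * b))) + \<eta> / 64 * (k * a\<^sup>2)" by (simp add: algebra_simps power2_eq_square)
      also have "\<dots> \<le> \<eta> / 8 * S + \<eta> / 64 * S"
      proof -
        have "k * a\<^sup>2 \<le> 1 * a\<^sup>2" using k by (intro mult_right_mono) auto
        then have "k * a\<^sup>2 \<le> S" using aS by simp
        then show ?thesis using kab \<eta> by (intro add_mono mult_left_mono) auto
      qed
      also have "\<dots> = 9 / 64 * (\<eta> * S)" by (simp add: algebra_simps)
      finally show ?thesis .
    qed
    have Yb: "\<bar>k\<^sup>2 * Y\<bar> \<le> 27 / 64 * (\<eta> * S)"
    proof -
      have "norm (4 * of_real \<eta> * cnj (m x) - cnj E) \<le> norm (4 * of_real \<eta> * cnj (m x)) + norm (cnj E)" by (rule norm_triangle_ineq4)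
      also have "\<dots> \<le> 4 * \<eta> * (1 / 16) + \<eta> / 8"
        using m_small[of x] e2 \<eta> by (intro add_mono) (auto simp: norm_mult)
      finally have F: "norm (4 * of_real \<eta> * cnj (m x) - cnj E) \<le> 3 / 8 * \<eta>" by simp
      have "\<bar>Y\<bar> \<le> 2 * norm (cnj (w x) * (4 * of_real \<eta> * cnj (m x) - cnj E) * g x)"
        unfolding Y_def by (rule abs_2_Re)
      also have "\<dots> = 2 * (b * norm (4 * of_real \<eta> * cnj (m x) - cnj E) * norm (g x))" by (simp add: norm_mult b_def)
      also have "\<dots> \<le> 2 * (b * (3 / 8 * \<eta>) * (a + b / 16))"
        using F gb ab0 \<eta> by (intro mult_left_mono mult_mono) auto
      finally have "k\<^sup>2 * \<bar>Y\<bar> \<le> k\<^sup>2 * (2 * (b * (3 / 8 * \<eta>) * (a + b / 16)))" by (rule mult_left_mono) simp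
      also have "\<dots> = 3 / 8 * \<eta> * (k * (2 * (k * (a * b)))) + 3 / 64 * \<eta> * (k\<^sup>2 * b\<^sup>2)"
        by (simp add: algebra_simps power2_eq_square)
      also have "\<dots> \<le> 3 / 8 * \<eta> * S + 3 / 64 * \<eta> * S"
      proof -
        have "k * (2 * (k * (a * b))) \<le> 1 * (2 * (k * (a * b)))" using k ab0 by (intro mult_right_mono) auto
        then have "k * (2 * (k * (a * b))) \<le> S" using kab by linarith
        then show ?thesis using bS \<eta> by (intro add_mono mult_left_mono) auto
      qed
      also have "\<dots> = 27 / 64 * (\<eta> * S)" by (simp add: algebra_simps)
      finally show ?thesis by (simp add: abs_mult)
    qed
    have Zb: "\<bar>Z\<bar> \<le> 1 / 32 * \<eta>"
    proof -
      have "\<bar>Re (cnj (m x) * E)\<bar> \<le> norm (m x) * norm E" using abs_Re_le_cmod[of "cnj (m x) * E"] by (simp add: norm_mult)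
      also have "\<dots> \<le> 1 / 16 * (\<eta> / 8)" using m_small[of x] e2 by (intro mult_mono) auto
      finally have 1: "\<bar>Re (cnj (m x) * E)\<bar> \<le> 1 / 16 * (\<eta> / 8)" .
      have "(norm (m x))\<^sup>2 \<le> (1 / 16)\<^sup>2" using m_small[of x] by (intro power_mono) auto
      then have "\<eta> * (norm (m x))\<^sup>2 \<le> \<eta> * (1 / 16)\<^sup>2" "0 \<le> \<eta> * (norm (m x))\<^sup>2" using \<eta> by (auto intro: mult_left_mono)
      moreover have "Z = 4 * (\<eta> * (norm (m x))\<^sup>2) - 2 * Re (cnj (m x) * E)" by (simp add: Z_def)
      moreover have "\<eta> * (1 / 16)\<^sup>2 = \<eta> / 256" by (simp add: power2_eq_square)
      ultimately show ?thesis using 1 unfolding abs_le_iff by linarith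
    qed
    have NZ: "\<bar>(A - k\<^sup>2 * B) * Z\<bar> \<le> \<rho> x * (1 / 32 * (\<eta> * S))"
    proof -
      have "\<bar>A - k\<^sup>2 * B\<bar> \<le> S" unfolding S_def A B by (simp add: abs_le_iff)
      then have "\<bar>(A - k\<^sup>2 * B) * Z\<bar> \<le> S * (1 / 32 * \<eta>)" unfolding abs_mult using Zb S0 by (intro mult_mono) auto
      also have "\<dots> \<le> \<rho> x * (S * (1 / 32 * \<eta>))" using mult_right_mono[OF \<rho>1, of "S * (1 / 32 * \<eta>)"] S0 \<eta> by simp
      finally show ?thesis by (simp add: mult_ac)
    qed
    have "\<rho> x * (\<eta> * S) \<le> \<rho> x * (2 * (\<eta> * S) + (X - k\<^sup>2 * Y)) - (A - k\<^sup>2 * B) * Z"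
    proof -
      have "\<eta> * S \<ge> 0" using \<eta> S0 by simp
      then have "\<eta> * S + 1 / 32 * (\<eta> * S) \<le> 2 * (\<eta> * S) + (X - k\<^sup>2 * Y)" using Xb Yb unfolding abs_le_iff by linarith
      then have "\<rho> x * (\<eta> * S + 1 / 32 * (\<eta> * S)) \<le> \<rho> x * (2 * (\<eta> * S) + (X - k\<^sup>2 * Y))" using \<rho>1 by (intro mult_left_mono) auto
      then show ?thesis using NZ unfolding abs_le_iff distrib_left by linarith
    qed
    also have "\<dots> = (2 * (\<eta> + \<kappa>) * A + X - k\<^sup>2 * (2 * (\<kappa> - \<eta>) * B + Y)) * \<rho> x - (A - k\<^sup>2 * B) * (2 * \<kappa> * \<rho> x + Z)"
      by (simp add: S_def algebra_simps)
    finally have "\<rho> x * (\<eta> * S) / (\<rho> x)\<^sup>2 \<le> D" unfolding D_def using \<rho>1 by (intro divide_right_mono) auto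
    moreover have "\<rho> x * (\<eta> * S) / (\<rho> x)\<^sup>2 = \<eta> * S / \<rho> x" using \<rho>1 by (simp add: power2_eq_square)
    moreover have "\<eta> * k\<^sup>2 * ((norm (f x))\<^sup>2 + (norm (g x))\<^sup>2) \<le> \<eta> * S / \<rho> x"
    proof -
      have "\<rho> x * ((norm (f x))\<^sup>2 + (norm (g x))\<^sup>2) = A + B"
        using frame_norm[of "g x" "m x" "f x"] by (simp add: \<rho>_def A_def B_def u_def w_def)
      then have "(norm (f x))\<^sup>2 + (norm (g x))\<^sup>2 = (A + B) / \<rho> x" using \<rho>1 by (simp add: field_simps)
      then have "\<eta> * k\<^sup>2 * ((norm (f x))\<^sup>2 + (norm (g x))\<^sup>2) = \<eta> * (k\<^sup>2 * A + k\<^sup>2 * B) / \<rho> x" by (simp add: algebra_simps)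
      moreover have "k\<^sup>2 * A \<le> 1 * A" using k by (intro mult_right_mono) (auto simp: A power_le_one)
      ultimately show ?thesis using \<eta> \<rho>1 by (auto simp: S_def intro!: divide_right_mono mult_left_mono)
    qed
    ultimately show ?thesis by simp
  qed
  ultimately show ?thesis unfolding \<eta>_def by auto
qed

end

text \<open>In a thin frame (\<open>|c| \<le> 1 / 16\<close>) membership in the cone is a statement about the quotient \<open>b / a\<close>.\<close>

lemma cone_imp_ratio:
  fixes a b c :: complex
  assumes cone: "norm (b - c * a) \<le> k * norm (a + cnj c * b)" and k: "0 \<le> k" "k \<le> 1" and c: "norm c \<le> 1 / 16"
  shows "norm b \<le> 2 * norm a" "norm (b - c * a) \<le> 2 * k * norm a"
proof -
  have ca: "norm (c * a) \<le> 1 / 16 * norm a" "norm (cnj c * b) \<le> 1 / 16 * norm b"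
    unfolding norm_mult complex_mod_cnj using c by (rule mult_right_mono, simp)+
  have w: "norm (a + cnj c * b) \<le> norm a + 1 / 16 * norm b"
    using norm_triangle_ineq[of a "cnj c * b"] ca by linarith
  have "k * norm (a + cnj c * b) \<le> 1 * norm (a + cnj c * b)" using k by (intro mult_right_mono) auto
  moreover have "norm b \<le> norm (b - c * a) + norm (c * a)" using norm_triangle_ineq[of "b - c * a" "c * a"] by simp
  ultimately show b: "norm b \<le> 2 * norm a" using cone w ca norm_ge_zero[of a] norm_ge_zero[of b] by linarith
  have "norm (b - c * a) \<le> k * (norm a + 1 / 16 * norm b)" using cone w k by (meson mult_left_mono order_trans)
  also have "\<dots> \<le> k * (2 * norm a)" by (rule mult_left_mono) (use b k norm_ge_zero[of a] in linarith)+
  finally show "norm (b - c * a) \<le> 2 * k * norm a" by simp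
qed

lemma integrable_at_top_small_value:
  fixes h :: "real \<Rightarrow> real"
  assumes "set_integrable lborel {a..} h" "c > 0"
  shows "\<exists>x\<ge>b. h x < c"
proof (rule ccontr)
  assume "\<not> ?thesis"
  then have h: "\<And>x. x \<ge> b \<Longrightarrow> c \<le> h x" by (meson not_le)
  define d where "d = max a b"
  have "set_integrable lborel {d..} h"
    by (rule set_integrable_subset[OF assms(1)]) (auto simp: d_def)
  then have "set_integrable lborel {d..} (\<lambda>x. c)"
    by (rule set_integrable_bound) (use h \<open>c > 0\<close> in \<open>auto simp: d_def set_borel_measurable_def intro!: AE_I2\<close>, fastforce)
  then have "integrable lborel (\<lambda>x. (1 / c) *\<^sub>R (indicator {d..} x *\<^sub>R c))"
    unfolding set_integrable_def by (rule integrable_scaleR_right)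
  then have "integrable lborel (indicator {d..} :: real \<Rightarrow> real)" using \<open>c > 0\<close> by simp
  then have fin: "emeasure lborel {d..} < \<infinity>" by (simp add: integrable_indicator_iff)
  then obtain r where r: "emeasure lborel {d..} = ennreal r" "r \<ge> 0" by (metis ennreal_cases less_irrefl infinity_ennreal_def)
  obtain n :: nat where n: "r < real n" using reals_Archimedean2 by blast
  have "emeasure lborel {d..d + real n} \<le> emeasure lborel {d..}" by (intro emeasure_mono) auto
  then have "ennreal (real n) \<le> ennreal r" unfolding r(1) by simp
  then show False using n r(2) by simp
qed

context approximate_weyl_function
begin

lemma rho_pos: "0 < 1 + (norm (m x))\<^sup>2"
  by (rule add_pos_nonneg) auto

lemma cone_form_le: "cone_form k f g x \<le> (norm (f x))\<^sup>2 + (norm (g x))\<^sup>2"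
proof -
  have "cone_form k f g x \<le> ((1 + (norm (m x))\<^sup>2) * ((norm (f x))\<^sup>2 + (norm (g x))\<^sup>2)) / (1 + (norm (m x))\<^sup>2)"
    unfolding cone_form_def frame_norm[of "g x" "m x" "f x", symmetric]
    by (intro divide_right_mono) (auto intro: order_trans[OF _ zero_le_power2])
  also have "\<dots> = (norm (f x))\<^sup>2 + (norm (g x))\<^sup>2"
    using rho_pos[of x] by (intro nonzero_mult_div_cancel_left) linarith
  finally show ?thesis .
qed

lemma cone_form_nonpos:
  assumes "cone_form k f g x \<le> 0" "0 \<le> k"
  shows "norm (g x - m x * f x) \<le> k * norm (f x + cnj (m x) * g x)"
proof (rule power2_le_imp_le)
  have "(norm (g x - m x * f x))\<^sup>2 - k\<^sup>2 * (norm (f x + cnj (m x) * g x))\<^sup>2 \<le> 0"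
    using assms(1) rho_pos[of x] unfolding cone_form_def divide_le_0_iff by linarith
  then show "(norm (g x - m x * f x))\<^sup>2 \<le> (k * norm (f x + cnj (m x) * g x))\<^sup>2" by (simp add: power_mult_distrib)
qed (use assms in auto)

lemma cone_form_at_f_0:
  assumes "f x = 0" "0 \<le> k" "k \<le> 1"
  shows "1 / 2 * (norm (g x))\<^sup>2 \<le> cone_form k f g x"
proof -
  have m2: "(norm (m x))\<^sup>2 \<le> (1 / 16)\<^sup>2" using m_small[of x] by (intro power_mono) auto
  have "k\<^sup>2 * (norm (m x))\<^sup>2 \<le> 1 * (norm (m x))\<^sup>2" using assms by (intro mult_right_mono power_le_one) auto
  then have "1 / 2 * (1 + (norm (m x))\<^sup>2) \<le> 1 - k\<^sup>2 * (norm (m x))\<^sup>2"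
    using m2 by (simp add: power2_eq_square)
  then have "(1 / 2 * (1 + (norm (m x))\<^sup>2)) * (norm (g x))\<^sup>2 \<le> (1 - k\<^sup>2 * (norm (m x))\<^sup>2) * (norm (g x))\<^sup>2"
    by (rule mult_right_mono) simp
  moreover have "cone_form k f g x = ((1 - k\<^sup>2 * (norm (m x))\<^sup>2) * (norm (g x))\<^sup>2) / (1 + (norm (m x))\<^sup>2)"
    by (simp add: cone_form_def assms norm_mult power_mult_distrib algebra_simps)
  ultimately show ?thesis using rho_pos[of x] by (simp only: pos_le_divide_eq mult_ac)
qed

lemma cone_form_at_g_0:
  assumes "g x = 0" "1 / 16 \<le> k"
  shows "cone_form k f g x \<le> 0"
proof -
  have "norm (m x) \<le> k" using m_small[of x] assms by linarith
  then have "(norm (m x))\<^sup>2 * (norm (f x))\<^sup>2 \<le> k\<^sup>2 * (norm (f x))\<^sup>2" by (intro mult_right_mono power_mono) auto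
  then have "(norm (m x))\<^sup>2 * (norm (f x))\<^sup>2 - k\<^sup>2 * (norm (f x))\<^sup>2 \<le> 0" by simp
  then have "((norm (m x))\<^sup>2 * (norm (f x))\<^sup>2 - k\<^sup>2 * (norm (f x))\<^sup>2) / (1 + (norm (m x))\<^sup>2) \<le> 0"
    using rho_pos[of x] by (rule divide_nonpos_pos)
  then show ?thesis by (simp add: cone_form_def assms norm_mult power_mult_distrib)
qed

lemma cone_form_mono:
  assumes "dirac_system q z f g" "0 < k" "k \<le> 1" "e \<le> k * (- Im z) / 8" "x \<le> y"
  shows "cone_form k f g x \<le> cone_form k f g y"
proof (rule DERIV_nonneg_imp_nondecreasing[OF \<open>x \<le> y\<close>])
  fix t
  have "0 \<le> - Im z * k\<^sup>2 * ((norm (f t))\<^sup>2 + (norm (g t))\<^sup>2)"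
    using lower by (intro mult_nonneg_nonneg) auto
  then show "\<exists>D. (cone_form k f g has_real_derivative D) (at t) \<and> 0 \<le> D"
    using cone_form_derivative[OF assms(1-4), of t] order_trans by blast
qed

text \<open>If the form were positive at one point, it would stay above this value, and so would the norm of the
solution.\<close>

lemma square_integrable_imp_cone_form_nonpos:
  assumes s: "dirac_system q z f g" "0 < k" "k \<le> 1" "e \<le> k * (- Im z) / 8"
    and i: "set_integrable lborel {a..} (\<lambda>x. (norm (f x))\<^sup>2 + (norm (g x))\<^sup>2)"
  shows "cone_form k f g x \<le> 0"
proof (rule ccontr)
  assume "\<not> cone_form k f g x \<le> 0"
  then obtain y where "y \<ge> x" "(norm (f y))\<^sup>2 + (norm (g y))\<^sup>2 < cone_form k f g x"
    using integrable_at_top_small_value[OF i, of "cone_form k f g x" x] by auto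
  then show False using cone_form_mono[OF s \<open>y \<ge> x\<close>] cone_form_le[of k f g y] by linarith
qed

lemma cone_form_growth:
  assumes s: "dirac_system q z f g" and "f 0 = 0" "0 \<le> x"
  shows "1 / 2 * (norm (g 0))\<^sup>2 * exp (- Im z * x) \<le> cone_form 1 f g x"
proof -
  have "\<forall>x. \<exists>D. (cone_form 1 f g has_real_derivative D) (at x) \<and> - Im z * ((norm (f x))\<^sup>2 + (norm (g x))\<^sup>2) \<le> D"
    using cone_form_derivative[OF s, of 1] e_small lower by auto
  then obtain D where D: "\<And>x. (cone_form 1 f g has_real_derivative D x) (at x)"
    "\<And>x. - Im z * ((norm (f x))\<^sup>2 + (norm (g x))\<^sup>2) \<le> D x" by metis
  have "- Im z * cone_form 1 f g x \<le> D x" for x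
    by (rule order_trans[OF _ D(2)], rule mult_left_mono[OF cone_form_le]) (use lower in simp)
  then have "cone_form 1 f g 0 * exp (- Im z * (x - 0)) \<le> cone_form 1 f g x"
    by (intro exponential_growth[OF D(1)] \<open>0 \<le> x\<close>) auto
  moreover have "1 / 2 * (norm (g 0))\<^sup>2 * exp (- Im z * x) \<le> cone_form 1 f g 0 * exp (- Im z * x)"
    using cone_form_at_f_0[of f 0 1 g] assms(2) by (intro mult_right_mono) auto
  ultimately show ?thesis unfolding diff_zero by linarith
qed

text \<open>The narrow cone \<open>k = 1 / 2\<close> is used to see that inside it the form for \<open>k = 1\<close> is comparable to the square
of the norm; the latter form then decays exponentially in modulus.\<close>

lemma norm_decay:
  assumes s: "dirac_system q z f g" and g0: "g L = 0" and x: "0 \<le> x" "x \<le> L"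
  shows "(norm (f x))\<^sup>2 + (norm (g x))\<^sup>2 \<le> 2 * exp (Im z * x) * ((norm (f 0))\<^sup>2 + (norm (g 0))\<^sup>2)"
proof -
  have "\<forall>x. \<exists>D. (cone_form 1 f g has_real_derivative D) (at x) \<and> - Im z * ((norm (f x))\<^sup>2 + (norm (g x))\<^sup>2) \<le> D"
    using cone_form_derivative[OF s, of 1] e_small lower by auto
  then obtain D where D: "\<And>x. (cone_form 1 f g has_real_derivative D x) (at x)"
    "\<And>x. - Im z * ((norm (f x))\<^sup>2 + (norm (g x))\<^sup>2) \<le> D x" by metis
  have upper: "- cone_form 1 f g t \<le> (norm (f t))\<^sup>2 + (norm (g t))\<^sup>2" for t
  proof -
    define \<rho> where "\<rho> = 1 + (norm (m t))\<^sup>2"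
    have r: "\<rho> > 0" unfolding \<rho>_def by (rule rho_pos)
    have "- cone_form 1 f g t \<le> (\<rho> * ((norm (f t))\<^sup>2 + (norm (g t))\<^sup>2)) / \<rho>"
      unfolding cone_form_def \<rho>_def frame_norm[of "g t" "m t" "f t", symmetric] minus_divide_left
      by (intro divide_right_mono) auto
    then show ?thesis using r by simp
  qed
  have lower_bound: "1 / 2 * ((norm (f t))\<^sup>2 + (norm (g t))\<^sup>2) \<le> - cone_form 1 f g t" if "t \<le> L" for t
  proof -
    define \<rho> A B where "\<rho> = 1 + (norm (m t))\<^sup>2" and "A = (norm (g t - m t * f t))\<^sup>2" and "B = (norm (f t + cnj (m t) * g t))\<^sup>2"
    have r: "\<rho> > 0" unfolding \<rho>_def by (rule rho_pos)
    have "cone_form (1 / 2) f g t \<le> cone_form (1 / 2) f g L"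
      by (rule cone_form_mono[OF s]) (use e_small that in auto)
    also have "\<dots> \<le> 0" by (rule cone_form_at_g_0) (simp_all add: g0)
    finally have "norm (g t - m t * f t) \<le> 1 / 2 * norm (f t + cnj (m t) * g t)" by (rule cone_form_nonpos) simp
    then have "A \<le> (1 / 2 * norm (f t + cnj (m t) * g t))\<^sup>2" unfolding A_def by (rule power_mono) simp
    then have AB: "A \<le> B / 4" by (simp add: B_def power_mult_distrib power2_eq_square)
    have B0: "0 \<le> B" by (simp add: B_def)
    have fr: "A + B = \<rho> * ((norm (f t))\<^sup>2 + (norm (g t))\<^sup>2)"
      using frame_norm[of "g t" "m t" "f t"] by (simp add: A_def B_def \<rho>_def)
    have "1 / 2 * (A + B) \<le> B - A" using AB B0 by simp
    then have "1 / 2 * (A + B) / \<rho> \<le> (B - A) / \<rho>" using r by (intro divide_right_mono) auto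
    moreover have "1 / 2 * (A + B) / \<rho> = 1 / 2 * ((norm (f t))\<^sup>2 + (norm (g t))\<^sup>2)" unfolding fr using r by simp
    moreover have "(B - A) / \<rho> = - cone_form 1 f g t" by (simp add: cone_form_def A_def B_def \<rho>_def minus_divide_left)
    ultimately show ?thesis by linarith
  qed
  have "cone_form 1 f g 0 * exp (Im z * (x - 0)) \<le> cone_form 1 f g x"
  proof (rule exponential_growth[OF D(1)])
    fix t assume "0 \<le> t" "t \<le> x"
    have "Im z * cone_form 1 f g t = - Im z * (- cone_form 1 f g t)" by simp
    also have "\<dots> \<le> - Im z * ((norm (f t))\<^sup>2 + (norm (g t))\<^sup>2)" using lower upper by (intro mult_left_mono) auto
    also have "\<dots> \<le> D t" by (rule D(2))
    finally show "Im z * cone_form 1 f g t \<le> D t" .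
  qed (rule x)
  then have "- cone_form 1 f g x \<le> - cone_form 1 f g 0 * exp (Im z * x)" by simp
  also have "\<dots> \<le> ((norm (f 0))\<^sup>2 + (norm (g 0))\<^sup>2) * exp (Im z * x)" using upper by (intro mult_right_mono) auto
  finally have 1: "- cone_form 1 f g x \<le> ((norm (f 0))\<^sup>2 + (norm (g 0))\<^sup>2) * exp (Im z * x)" .
  have "(norm (f x))\<^sup>2 + (norm (g x))\<^sup>2 \<le> 2 * (((norm (f 0))\<^sup>2 + (norm (g 0))\<^sup>2) * exp (Im z * x))"
    using order_trans[OF lower_bound[OF x(2)] 1] by simp
  then show ?thesis by (simp add: mult_ac)
qed

end

section \<open>Entire families of solutions\<close>

text \<open>Polynomials in the spectral parameter with continuous coefficients. The Picard iterates have this form,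
which makes their holomorphy in \<open>z\<close> evident.\<close>

inductive entire_family :: "(complex \<Rightarrow> real \<Rightarrow> complex) \<Rightarrow> bool" where
  const: "continuous_on UNIV a \<Longrightarrow> entire_family (\<lambda>z. a)"
| parameter: "entire_family F \<Longrightarrow> entire_family (\<lambda>z x. z * F z x)"
| add: "entire_family F \<Longrightarrow> entire_family G \<Longrightarrow> entire_family (\<lambda>z x. F z x + G z x)"

lemma entire_family_continuous: "entire_family F \<Longrightarrow> continuous_on UNIV (F z)"
  by (induction rule: entire_family.induct) (auto intro!: continuous_intros)

lemma entire_family_holomorphic: "entire_family F \<Longrightarrow> (\<lambda>z. F z x) holomorphic_on UNIV"
  by (induction rule: entire_family.induct) (auto intro!: holomorphic_intros)

lemma entire_family_mult:
  assumes "entire_family F" "continuous_on UNIV b" shows "entire_family (\<lambda>z x. b x * F z x)"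
  using assms(1)
proof (induction rule: entire_family.induct)
  case (const a)
  then show ?case using assms(2) by (intro entire_family.const continuous_intros)
next
  case (parameter F)
  then show ?case using entire_family.parameter[OF parameter.IH] by (simp add: mult_ac)
next
  case (add F G)
  then show ?case using entire_family.add[OF add.IH] by (simp add: distrib_left)
qed

lemma primitive_integrable:
  fixes f :: "real \<Rightarrow> complex"
  assumes "continuous_on UNIV f" shows "(\<lambda>s. f (x * s)) integrable_on {0..1::real}"
  by (intro integrable_continuous_real continuous_on_compose2[OF assms] continuous_intros) auto

lemma primitive_add:
  assumes "continuous_on UNIV f" "continuous_on UNIV g"
  shows "primitive (\<lambda>x. f x + g x) x = primitive f x + primitive g x"
  by (simp add: primitive_def integral_add[OF primitive_integrable primitive_integrable] assms scaleR_add_right)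

lemma primitive_diff:
  assumes "continuous_on UNIV f" "continuous_on UNIV g"
  shows "primitive (\<lambda>x. f x - g x) x = primitive f x - primitive g x"
  by (simp add: primitive_def integral_diff[OF primitive_integrable primitive_integrable] assms scaleR_diff_right)

lemma primitive_mult: "primitive (\<lambda>x. c * f x) x = c * primitive f x"
  by (simp add: primitive_def)

lemma entire_family_primitive: "entire_family F \<Longrightarrow> entire_family (\<lambda>z. primitive (F z))"
proof (induction rule: entire_family.induct)
  case (const a)
  then show ?case by (intro entire_family.const primitive_continuous)
next
  case (parameter F)
  have "(\<lambda>z. primitive (\<lambda>x. z * F z x)) = (\<lambda>z x. z * primitive (F z) x)" by (simp add: fun_eq_iff primitive_mult)
  then show ?case using entire_family.parameter[OF parameter.IH] by simp
next
  case (add F G)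
  have "(\<lambda>z. primitive (\<lambda>x. F z x + G z x)) = (\<lambda>z x. primitive (F z) x + primitive (G z) x)"
    using add.hyps by (simp add: fun_eq_iff primitive_add entire_family_continuous)
  then show ?case using entire_family.add[OF add.IH] by simp
qed

text \<open>Integration gains the factor \<open>1 / r\<close> in the weighted supremum norm with weight \<open>exp (- r |x|)\<close>. A large
\<open>r\<close> makes the Picard iteration contract on the whole line.\<close>

lemma primitive_exp_bound:
  assumes f: "continuous_on UNIV f" and b: "\<And>x. norm (f x) \<le> C * exp (r * \<bar>x\<bar>)" and r: "r > 0"
  shows "norm (primitive f x) \<le> C / r * exp (r * \<bar>x\<bar>)"
proof (cases "x = 0")
  case True
  have "0 \<le> C" using b[of 0] norm_ge_zero[of "f 0"] by (simp del: norm_ge_zero)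
  then show ?thesis using r True by simp
next
  case False
  have C0: "0 \<le> C" using b[of 0] norm_ge_zero[of "f 0"] by (simp del: norm_ge_zero)
  define a where "a = r * \<bar>x\<bar>"
  have a: "a > 0" using r False by (simp add: a_def)
  have i: "((\<lambda>s. C * exp (a * s)) has_integral (C / a * exp (a * 1) - C / a * exp (a * 0))) {0..1}"
  proof (rule fundamental_theorem_of_calculus)
    fix s :: real
    have "((\<lambda>s. C / a * exp (a * s)) has_real_derivative C * exp (a * s)) (at s within {0..1})"
      using a by (auto intro!: derivative_eq_intros)
    then show "((\<lambda>s. C / a * exp (a * s)) has_vector_derivative C * exp (a * s)) (at s within {0..1})"
      by (simp add: has_real_derivative_iff_has_vector_derivative)
  qed simp
  have "norm (integral {0..1} (\<lambda>s. f (x * s))) \<le> integral {0..1} (\<lambda>s. C * exp (a * s))"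
  proof (rule integral_norm_bound_integral[OF primitive_integrable[OF f]])
    show "(\<lambda>s. C * exp (a * s)) integrable_on {0..1}" using i by blast
    show "norm (f (x * s)) \<le> C * exp (a * s)" if "s \<in> {0..1}" for s
      using b[of "x * s"] that by (simp add: a_def abs_mult mult_ac)
  qed
  also have "\<dots> = C / a * exp a - C / a" using integral_unique[OF i] by simp
  also have "\<dots> \<le> C / a * exp a" using C0 a by simp
  finally have "norm (primitive f x) \<le> \<bar>x\<bar> * (C / a * exp a)"
    unfolding primitive_def norm_scaleR by (intro mult_left_mono) auto
  also have "\<dots> = C / r * exp (r * \<bar>x\<bar>)" using False r by (simp add: a_def)
  finally show ?thesis .
qed

fun picard :: "(real \<Rightarrow> complex) \<Rightarrow> complex \<Rightarrow> complex \<Rightarrow> nat \<Rightarrow> complex \<Rightarrow> (real \<Rightarrow> complex) \<times> (real \<Rightarrow> complex)" where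
  "picard q \<alpha> \<beta> 0 z = (\<lambda>x. \<alpha>, \<lambda>x. \<beta>)"
| "picard q \<alpha> \<beta> (Suc k) z =
    (primitive (\<lambda>x. - \<i> * (z * fst (picard q \<alpha> \<beta> k z) x) + \<i> * q x * snd (picard q \<alpha> \<beta> k z) x),
     primitive (\<lambda>x. \<i> * (z * snd (picard q \<alpha> \<beta> k z) x) + \<i> * cnj (q x) * fst (picard q \<alpha> \<beta> k z) x))"

lemma picard_entire_family:
  assumes q: "continuous_on UNIV q"
  shows "entire_family (\<lambda>z. fst (picard q \<alpha> \<beta> k z)) \<and> entire_family (\<lambda>z. snd (picard q \<alpha> \<beta> k z))"
proof (induction k)
  case 0
  then show ?case by (auto intro!: entire_family.const)
next
  case (Suc k)
  let ?P = "\<lambda>z. fst (picard q \<alpha> \<beta> k z)" and ?Q = "\<lambda>z. snd (picard q \<alpha> \<beta> k z)"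
  have P: "entire_family ?P" and Q: "entire_family ?Q" using Suc by auto
  have "entire_family (\<lambda>z x. - \<i> * (z * ?P z x) + \<i> * q x * ?Q z x)"
    by (intro entire_family.add entire_family_mult entire_family.parameter P Q continuous_intros q)
  note 1 = entire_family_primitive[OF this]
  have "entire_family (\<lambda>z x. \<i> * (z * ?Q z x) + \<i> * cnj (q x) * ?P z x)"
    by (intro entire_family.add entire_family_mult entire_family.parameter P Q continuous_intros continuous_on_cnj q)
  from 1 entire_family_primitive[OF this] show ?case by simp
qed

lemma picard_bound:
  assumes q: "continuous_on UNIV q" and Q: "\<And>x. norm (q x) \<le> Q" "Q > 0" and z: "norm z \<le> R"
  shows "norm (fst (picard q \<alpha> \<beta> k z) x) \<le> (norm \<alpha> + norm \<beta>) * (1/2) ^ k * exp (2 * (R + Q) * \<bar>x\<bar>) \<and>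
         norm (snd (picard q \<alpha> \<beta> k z) x) \<le> (norm \<alpha> + norm \<beta>) * (1/2) ^ k * exp (2 * (R + Q) * \<bar>x\<bar>)"
proof (induction k arbitrary: x)
  case 0
  have "R \<ge> 0" using z norm_ge_zero order_trans by blast
  then have "1 \<le> exp (2 * (R + Q) * \<bar>x\<bar>)" using Q(2) by simp
  then have "(norm \<alpha> + norm \<beta>) * 1 \<le> (norm \<alpha> + norm \<beta>) * exp (2 * (R + Q) * \<bar>x\<bar>)" by (intro mult_left_mono) auto
  then show ?case using norm_ge_zero[of \<alpha>] norm_ge_zero[of \<beta>] by (simp del: norm_ge_zero)
next
  case (Suc k)
  let ?P = "fst (picard q \<alpha> \<beta> k z)" and ?Q = "snd (picard q \<alpha> \<beta> k z)"
  have R0: "R \<ge> 0" using z norm_ge_zero order_trans by blast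
  have c: "continuous_on UNIV ?P" "continuous_on UNIV ?Q"
    using picard_entire_family[OF q] entire_family_continuous by blast+
  define C where "C = (norm \<alpha> + norm \<beta>) * (1/2) ^ k"
  have C0: "C \<ge> 0" by (simp add: C_def)
  have step: "norm (primitive (\<lambda>x. a * (z * F x) + b x * G x) x) \<le> (norm \<alpha> + norm \<beta>) * (1/2) ^ Suc k * exp (2 * (R + Q) * \<bar>x\<bar>)"
    if F: "continuous_on UNIV F" "\<And>x. norm (F x) \<le> C * exp (2 * (R + Q) * \<bar>x\<bar>)"
      and G: "continuous_on UNIV G" "\<And>x. norm (G x) \<le> C * exp (2 * (R + Q) * \<bar>x\<bar>)"
      and a: "norm a = 1" and b: "continuous_on UNIV b" "\<And>x. norm (b x) \<le> Q" for F G a b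
  proof -
    have "norm (primitive (\<lambda>x. a * (z * F x) + b x * G x) x) \<le> ((R + Q) * C) / (2 * (R + Q)) * exp (2 * (R + Q) * \<bar>x\<bar>)"
    proof (rule primitive_exp_bound)
      show "continuous_on UNIV (\<lambda>x. a * (z * F x) + b x * G x)" by (intro continuous_intros F G b)
      show "norm (a * (z * F x) + b x * G x) \<le> (R + Q) * C * exp (2 * (R + Q) * \<bar>x\<bar>)" for x
      proof -
        have "norm (a * (z * F x) + b x * G x) \<le> norm z * norm (F x) + norm (b x) * norm (G x)"
          using norm_triangle_ineq[of "a * (z * F x)" "b x * G x"] a by (simp add: norm_mult)
        also have "\<dots> \<le> R * (C * exp (2 * (R + Q) * \<bar>x\<bar>)) + Q * (C * exp (2 * (R + Q) * \<bar>x\<bar>))"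
          using F(2) G(2) b(2) z R0 Q(2) by (intro add_mono mult_mono) auto
        finally show ?thesis by (simp add: algebra_simps)
      qed
    qed (use R0 Q(2) in auto)
    also have "((R + Q) * C) / (2 * (R + Q)) = (norm \<alpha> + norm \<beta>) * (1/2) ^ Suc k"
    proof -
      have "R + Q \<noteq> 0" using R0 Q(2) by linarith
      then have "((R + Q) * C) / (2 * (R + Q)) = C / 2" unfolding mult.commute[of 2] by (rule mult_divide_mult_cancel_left)
      then show ?thesis by (simp add: C_def)
    qed
    finally show ?thesis .
  qed
  show ?case unfolding picard.simps fst_conv snd_conv
    using Suc.IH c Q q
    by (intro conjI step continuous_intros continuous_on_cnj) (auto simp: C_def norm_mult)
qed

text \<open>The sum of the Picard iterates. Since the majorant is geometric and uniform for bounded \<open>z\<close> and \<open>x\<close>, the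
sum is holomorphic in \<open>z\<close>, continuous in \<open>x\<close>, and satisfies the integral equation.\<close>

theorem dirac_system_entire_solution:
  assumes q: "continuous_on UNIV q" and Q: "\<And>x. norm (q x) \<le> Q"
  obtains f g where "\<And>z. dirac_system q z (f z) (g z)" "\<And>z. f z 0 = \<alpha>" "\<And>z. g z 0 = \<beta>"
    "\<And>x. (\<lambda>z. f z x) holomorphic_on UNIV" "\<And>x. (\<lambda>z. g z x) holomorphic_on UNIV"
proof -
  define Q' where "Q' = max Q 1"
  have Q': "\<And>x. norm (q x) \<le> Q'" "Q' > 0" using Q by (auto simp: Q'_def intro: max.coboundedI1)
  define K where "K = norm \<alpha> + norm \<beta>"
  \<comment> \<open>The two components are indexed by a truth value in order to treat them together.\<close>
  define pt where "pt = (\<lambda>(b::bool) k z. if b then fst (picard q \<alpha> \<beta> k z) else snd (picard q \<alpha> \<beta> k z))"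
  have bound: "norm (pt b k z x) \<le> K * (1/2) ^ k * exp (2 * (R + Q') * \<bar>x\<bar>)" if "norm z \<le> R" for b k z x R
    using picard_bound[OF q Q' that] by (auto simp: pt_def K_def)
  have ef: "entire_family (pt b k)" for b k
    using picard_entire_family[OF q] by (cases b) (simp_all add: pt_def)
  define F where "F = (\<lambda>b z x. \<Sum>k. pt b k z x)"
  have geo: "summable (\<lambda>k. K * (1/2) ^ k * c)" for c :: real by (intro summable_mult summable_mult2 summable_geometric) simp
  have sums: "summable (\<lambda>k. pt b k z x)" for b z x
    by (rule summable_comparison_test'[OF geo bound[OF order_refl]])
  have hol: "(\<lambda>z. F b z x) holomorphic_on UNIV" for b x
  proof (rule holomorphic_uniform_sequence)
    show "(\<lambda>z. \<Sum>k<n. pt b k z x) holomorphic_on UNIV" for n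
      by (intro holomorphic_intros entire_family_holomorphic ef)
    show "\<exists>d>0. cball z d \<subseteq> UNIV \<and> uniform_limit (cball z d) (\<lambda>n z. \<Sum>k<n. pt b k z x) (\<lambda>z. F b z x) sequentially" for z
    proof (intro exI[of _ 1] conjI)
      show "uniform_limit (cball z 1) (\<lambda>n z. \<Sum>k<n. pt b k z x) (\<lambda>z. F b z x) sequentially"
        unfolding F_def
      proof (rule Weierstrass_m_test)
        show "norm (pt b k w x) \<le> K * (1/2) ^ k * exp (2 * ((norm z + 1) + Q') * \<bar>x\<bar>)" if "w \<in> cball z 1" for k w
        proof (rule bound)
          show "norm w \<le> norm z + 1" using that norm_triangle_ineq3[of w z] by (simp add: dist_norm norm_minus_commute)
        qed
      qed (rule geo)
    qed auto
  qed auto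
  have cont: "continuous_on UNIV (F b z)" for b z
  proof -
    have "isCont (F b z) x" for x
    proof -
      define r where "r = \<bar>x\<bar> + 1"
      have "uniform_limit {-r..r} (\<lambda>n x. \<Sum>k<n. pt b k z x) (F b z) sequentially"
        unfolding F_def
      proof (rule Weierstrass_m_test)
        show "norm (pt b k z y) \<le> K * (1/2) ^ k * exp (2 * (norm z + Q') * r)" if "y \<in> {-r..r}" for k y
        proof -
          have "2 * (norm z + Q') * \<bar>y\<bar> \<le> 2 * (norm z + Q') * r"
            using that Q'(2) by (intro mult_left_mono) auto
          moreover have "0 \<le> K * (1/2) ^ k" by (simp add: K_def)
          ultimately show ?thesis using bound[OF order_refl, of b k z y] by (meson exp_le_cancel_iff mult_left_mono order_trans)
        qed
      qed (rule geo)
      then have "continuous_on {-r..r} (F b z)"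
        by (rule uniform_limit_theorem[rotated])
          (auto intro!: always_eventually continuous_on_sum continuous_on_subset[OF entire_family_continuous[OF ef]])
      then show ?thesis
        by (rule continuous_on_interior) (auto simp: r_def)
    qed
    then show ?thesis by (simp add: continuous_at_imp_continuous_on)
  qed
  have tail: "norm (F b z x - (\<Sum>k<n. pt b k z x)) \<le> 2 * K * (1/2) ^ n * exp (2 * (norm z + Q') * \<bar>x\<bar>)" for b z x n
  proof -
    have "F b z x - (\<Sum>k<n. pt b k z x) = (\<Sum>k. pt b (k + n) z x)"
      unfolding F_def by (simp add: suminf_minus_initial_segment[OF sums])
    also have "norm \<dots> \<le> (\<Sum>k. K * (1/2) ^ (k + n) * exp (2 * (norm z + Q') * \<bar>x\<bar>))"
    proof -
      let ?b = "\<lambda>k. K * (1/2) ^ (k + n) * exp (2 * (norm z + Q') * \<bar>x\<bar>)"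
      have b: "summable ?b" by (rule summable_ignore_initial_segment[OF geo])
      have le: "norm (pt b (k + n) z x) \<le> ?b k" for k by (rule bound) simp
      have s: "summable (\<lambda>k. norm (pt b (k + n) z x))"
        by (rule summable_comparison_test'[OF b]) (use le in simp)
      show ?thesis by (rule order_trans[OF summable_norm[OF s] suminf_le[OF le s b]])
    qed
    also have "\<dots> = (\<Sum>k. (1/2) ^ k * (K * (1/2) ^ n * exp (2 * (norm z + Q') * \<bar>x\<bar>)))"
      by (simp add: power_add mult_ac)
    also have "\<dots> = 2 * (K * (1/2) ^ n * exp (2 * (norm z + Q') * \<bar>x\<bar>))"
      by (subst suminf_mult2[symmetric]) (auto simp: suminf_geometric intro: summable_geometric)
    finally show ?thesis by simp
  qed
  define i0 where "i0 = (\<lambda>b. if b then \<alpha> else \<beta>)"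
  define A B where "A = (\<lambda>b::bool. if b then - \<i> else \<i>)" and "B = (\<lambda>b x. if b then \<i> * q x else \<i> * cnj (q x))"
  have Bc: "continuous_on UNIV (B b)" for b
    unfolding B_def by (cases b) (auto intro!: continuous_intros continuous_on_cnj q)
  have Bb: "norm (B b x) \<le> Q'" for b x using Q'(1) by (simp add: B_def norm_mult)
  have rec: "pt b (Suc k) z = primitive (\<lambda>x. A b * (z * pt b k z x) + B b x * pt (\<not> b) k z x)" for b k z
    by (simp add: pt_def A_def B_def)
  have int_eq: "F b z x = i0 b + primitive (\<lambda>x. A b * (z * F b z x) + B b x * F (\<not> b) z x) x" for b z x
  proof -
    define S where "S = (\<lambda>b n x. \<Sum>k<n. pt b k z x)"
    define r where "r = 2 * (norm z + Q')"
    have r: "r > 0" using Q'(2) by (simp add: r_def add_nonneg_pos)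
    have Sc: "continuous_on UNIV (S b n)" for b n
      unfolding S_def by (intro continuous_on_sum entire_family_continuous ef)
    have S_rec: "S b (Suc n) x = i0 b + primitive (\<lambda>x. A b * (z * S b n x) + B b x * S (\<not> b) n x) x" for b n x
    proof (induction n)
      case 0
      show ?case by (simp add: S_def pt_def i0_def primitive_def)
    next
      case (Suc n)
      have "S b (Suc (Suc n)) x = S b (Suc n) x + pt b (Suc n) z x" by (simp add: S_def)
      also have "\<dots> = i0 b + (primitive (\<lambda>x. A b * (z * S b n x) + B b x * S (\<not> b) n x) x
          + primitive (\<lambda>x. A b * (z * pt b n z x) + B b x * pt (\<not> b) n z x) x)"
        using Suc by (simp add: rec)
      also have "\<dots> = i0 b + primitive (\<lambda>x. (A b * (z * S b n x) + B b x * S (\<not> b) n x)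
          + (A b * (z * pt b n z x) + B b x * pt (\<not> b) n z x)) x"
        by (subst primitive_add) (auto intro!: continuous_intros Sc Bc entire_family_continuous[OF ef])
      also have "(\<lambda>x. (A b * (z * S b n x) + B b x * S (\<not> b) n x) + (A b * (z * pt b n z x) + B b x * pt (\<not> b) n z x))
         = (\<lambda>x. A b * (z * S b (Suc n) x) + B b x * S (\<not> b) (Suc n) x)"
        by (simp add: S_def algebra_simps)
      finally show ?case .
    qed
    define I where "I = i0 b + primitive (\<lambda>x. A b * (z * F b z x) + B b x * F (\<not> b) z x) x"
    have conv: "norm (S b (Suc n) x - I) \<le> 2 * K * (1/2) ^ n * exp (r * \<bar>x\<bar>)" for n
    proof -
      have "I - S b (Suc n) x = primitive (\<lambda>x. (A b * (z * F b z x) + B b x * F (\<not> b) z x)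
         - (A b * (z * S b n x) + B b x * S (\<not> b) n x)) x"
        unfolding I_def S_rec by (subst primitive_diff) (auto intro!: continuous_intros Sc Bc cont)
      also have "norm \<dots> \<le> (r * (2 * K * (1/2) ^ n)) / r * exp (r * \<bar>x\<bar>)"
      proof (rule primitive_exp_bound[OF _ _ r])
        show "continuous_on UNIV (\<lambda>x. (A b * (z * F b z x) + B b x * F (\<not> b) z x)
         - (A b * (z * S b n x) + B b x * S (\<not> b) n x))" by (intro continuous_intros Sc Bc cont)
        fix y
        have "(A b * (z * F b z y) + B b y * F (\<not> b) z y) - (A b * (z * S b n y) + B b y * S (\<not> b) n y)
          = A b * (z * (F b z y - S b n y)) + B b y * (F (\<not> b) z y - S (\<not> b) n y)" by (simp add: algebra_simps)
        also have "norm \<dots> \<le> norm z * norm (F b z y - S b n y) + norm (B b y) * norm (F (\<not> b) z y - S (\<not> b) n y)"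
          by (rule order_trans[OF norm_triangle_ineq]) (simp add: norm_mult A_def)
        also have "\<dots> \<le> norm z * (2 * K * (1/2) ^ n * exp (r * \<bar>y\<bar>)) + Q' * (2 * K * (1/2) ^ n * exp (r * \<bar>y\<bar>))"
          unfolding S_def r_def using Q'(2) by (intro add_mono mult_mono tail Bb) auto
        also have "\<dots> = (norm z + Q') * (2 * K * (1/2) ^ n * exp (r * \<bar>y\<bar>))" by (simp add: algebra_simps)
        also have "\<dots> \<le> r * (2 * K * (1/2) ^ n * exp (r * \<bar>y\<bar>))"
          using Q'(2) by (intro mult_right_mono) (auto simp: r_def K_def)
        finally show "norm ((A b * (z * F b z y) + B b y * F (\<not> b) z y) - (A b * (z * S b n y) + B b y * S (\<not> b) n y))
          \<le> r * (2 * K * (1/2) ^ n) * exp (r * \<bar>y\<bar>)" by (simp add: mult_ac)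
      qed
      finally show ?thesis using r by (simp add: norm_minus_commute)
    qed
    have "(\<lambda>n. S b (Suc n) x) \<longlonglongrightarrow> I"
    proof (rule Lim_transform_bound[where g = "\<lambda>n. 0"] | rule LIM_zero_cancel)
      show "(\<lambda>n. S b (Suc n) x - I) \<longlonglongrightarrow> 0"
      proof (rule Lim_null_comparison)
        show "\<forall>\<^sub>F n in sequentially. norm (S b (Suc n) x - I) \<le> 2 * K * (1/2) ^ n * exp (r * \<bar>x\<bar>)"
          using conv by simp
        show "(\<lambda>n. 2 * K * (1/2) ^ n * exp (r * \<bar>x\<bar>)) \<longlonglongrightarrow> 0"
          by (intro tendsto_mult_left_zero tendsto_mult_right_zero LIMSEQ_power_zero) simp
      qed
    qed
    moreover have "(\<lambda>n. S b (Suc n) x) \<longlonglongrightarrow> F b z x"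
      using summable_LIMSEQ[OF sums, of b z x] unfolding S_def F_def by (rule LIMSEQ_Suc)
    ultimately show ?thesis using LIMSEQ_unique unfolding I_def by blast
  qed
  have deriv: "(F b z has_vector_derivative A b * (z * F b z x) + B b x * F (\<not> b) z x) (at x)" for b z x
  proof -
    have "((\<lambda>x. i0 b + primitive (\<lambda>x. A b * (z * F b z x) + B b x * F (\<not> b) z x) x) has_vector_derivative
      0 + (A b * (z * F b z x) + B b x * F (\<not> b) z x)) (at x)"
      by (intro has_vector_derivative_add has_vector_derivative_const primitive_derivative continuous_intros Bc cont)
    moreover have "F b z = (\<lambda>x. i0 b + primitive (\<lambda>x. A b * (z * F b z x) + B b x * F (\<not> b) z x) x)"
      using int_eq by (rule ext)
    ultimately show ?thesis by simp
  qed
  show thesis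
  proof (rule that[of "F True" "F False"])
    show "dirac_system q z (F True z) (F False z)" for z
      unfolding dirac_system_def using deriv[of True z] deriv[of False z] by (simp add: A_def B_def mult.assoc)
    show "F True z 0 = \<alpha>" "F False z 0 = \<beta>" for z
      using int_eq[of True z 0] int_eq[of False z 0] by (simp_all add: i0_def)
  qed (rule hol)+
qed

section \<open>Weyl solutions\<close>

lemma norm_vec2: "(norm (v :: complex ^ 2))\<^sup>2 = (norm (v $ 1))\<^sup>2 + (norm (v $ 2))\<^sup>2"
  by (simp add: norm_vec_def L2_set_def sum_2)

lemma norm_add_square_le: "(norm (a + b))\<^sup>2 \<le> 2 * ((norm a)\<^sup>2 + (norm b)\<^sup>2)" for a b :: complex
proof -
  have "(norm (a + b))\<^sup>2 \<le> (norm a + norm b)\<^sup>2" by (intro power_mono norm_triangle_ineq) auto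
  also have "\<dots> \<le> 2 * ((norm a)\<^sup>2 + (norm b)\<^sup>2)"
    using sum_squares_bound[of "norm a" "norm b"] by (simp add: power2_sum)
  finally show ?thesis .
qed

lemma dirac_system_continuous:
  assumes "dirac_system q z f g" shows "continuous_on UNIV f" "continuous_on UNIV g"
  using assms unfolding dirac_system_def
  by (meson continuous_at_imp_continuous_on has_vector_derivative_continuous)+

text \<open>Two solutions with initial values \<open>(1, 0)\<close> and \<open>(0, 1)\<close>, at a fixed spectral parameter.\<close>

locale fundamental_solutions = approximate_weyl_function +
  fixes f1 g1 f2 g2 :: "real \<Rightarrow> complex"
  assumes sys1: "dirac_system q z f1 g1" and sys2: "dirac_system q z f2 g2"
    and init: "f1 0 = 1" "g1 0 = 0" "f2 0 = 0" "g2 0 = 1"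
begin

text \<open>The value of \<open>f\<^sub>2(0) / f\<^sub>1(0)\<close> for the solution with \<open>f\<^sub>2(L) = 0\<close>, that is, the Weyl function of the problem
on \<open>[0, L]\<close> with this boundary condition.\<close>

definition truncated :: "real \<Rightarrow> complex" where
  "truncated L = - g1 L / g2 L"

text \<open>The solution with initial value \<open>(0, 1)\<close> starts where the form is positive and never enters the cone, which
contains the vectors with vanishing second component.\<close>

lemma g2_nonzero:
  assumes "0 \<le> L" shows "g2 L \<noteq> 0"
proof
  assume "g2 L = 0"
  then have "cone_form 1 f2 g2 L \<le> 0" by (rule cone_form_at_g_0) simp
  moreover have "1 / 2 * (norm (g2 0))\<^sup>2 * exp (- Im z * L) \<le> cone_form 1 f2 g2 L"
    by (rule cone_form_growth[where f = f2 and g = g2 and x = L]) (auto simp: sys2 init assms)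
  moreover have "0 < 1 / 2 * (norm (g2 0))\<^sup>2 * exp (- Im z * L)" using init by simp
  ultimately show False by linarith
qed

lemma combination_system: "dirac_system q z (\<lambda>x. f1 x + c * f2 x) (\<lambda>x. g1 x + c * g2 x)"
  using dirac_system_combination[OF sys1 sys2, of 1 c] by simp

lemma truncated_at_end: "0 \<le> L \<Longrightarrow> g1 L + truncated L * g2 L = 0"
  using g2_nonzero by (simp add: truncated_def)

lemma norm_truncated:
  assumes "0 \<le> L" shows "norm (truncated L) \<le> 2"
proof -
  let ?f = "\<lambda>x. f1 x + truncated L * f2 x" and ?g = "\<lambda>x. g1 x + truncated L * g2 x"
  have "cone_form 1 ?f ?g 0 \<le> cone_form 1 ?f ?g L"
    by (rule cone_form_mono[OF combination_system]) (use e_small lower assms in auto)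
  also have "\<dots> \<le> 0" by (rule cone_form_at_g_0) (simp_all add: truncated_at_end assms)
  finally have "norm (?g 0 - m 0 * ?f 0) \<le> 1 * norm (?f 0 + cnj (m 0) * ?g 0)" by (rule cone_form_nonpos) simp
  from cone_imp_ratio(1)[OF this _ _ m_small] show ?thesis by (simp add: init)
qed

lemma truncated_decay:
  assumes "0 \<le> x" "x \<le> L"
  shows "(norm (f1 x + truncated L * f2 x))\<^sup>2 + (norm (g1 x + truncated L * g2 x))\<^sup>2 \<le> 10 * exp (Im z * x)"
proof -
  have L: "0 \<le> L" using assms by linarith
  have "(norm (truncated L))\<^sup>2 \<le> 2\<^sup>2" by (intro power_mono norm_truncated L) auto
  then have "2 * exp (Im z * x) * ((norm (f1 0 + truncated L * f2 0))\<^sup>2 + (norm (g1 0 + truncated L * g2 0))\<^sup>2) \<le> 2 * exp (Im z * x) * 5"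
    by (intro mult_left_mono) (auto simp: init)
  then show ?thesis
    using norm_decay[OF combination_system[of "truncated L"] truncated_at_end[OF L] assms] by linarith
qed

text \<open>Two truncated solutions decay, so their difference at \<open>L\<close> is small; but the difference is a multiple of the
second fundamental solution, which grows exponentially. So the multiple is tiny.\<close>

lemma truncated_cauchy:
  assumes "0 \<le> L" "L \<le> M"
  shows "norm (truncated L - truncated M) \<le> 9 * exp (Im z * L)"
proof (rule power2_le_imp_le)
  let ?d = "truncated L - truncated M"
  let ?F = "\<lambda>K. f1 L + truncated K * f2 L" and ?G = "\<lambda>K. g1 L + truncated K * g2 L"
  have s: "dirac_system q z (\<lambda>x. ?d * f2 x) (\<lambda>x. ?d * g2 x)"
    using dirac_system_combination[OF sys1 sys2, of 0 ?d] by simp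
  have "1 / 2 * (norm ?d)\<^sup>2 * exp (- Im z * L) \<le> cone_form 1 (\<lambda>x. ?d * f2 x) (\<lambda>x. ?d * g2 x) L"
    using cone_form_growth[OF s _ assms(1)] by (simp add: init)
  also have "\<dots> \<le> (norm (?d * f2 L))\<^sup>2 + (norm (?d * g2 L))\<^sup>2" by (rule cone_form_le)
  also have "\<dots> = (norm (?F L + - ?F M))\<^sup>2 + (norm (?G L + - ?G M))\<^sup>2" by (simp add: algebra_simps)
  also have "\<dots> \<le> 2 * ((norm (?F L))\<^sup>2 + (norm (?F M))\<^sup>2) + 2 * ((norm (?G L))\<^sup>2 + (norm (?G M))\<^sup>2)"
    using norm_add_square_le[of "?F L" "- ?F M"] norm_add_square_le[of "?G L" "- ?G M"] unfolding norm_minus_cancel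
    by (rule add_mono)
  also have "\<dots> \<le> 40 * exp (Im z * L)"
    using truncated_decay[of L L] truncated_decay[of L M] assms by (simp add: distrib_left)
  finally have "1 / 2 * (norm ?d)\<^sup>2 * exp (- Im z * L) * exp (Im z * L) \<le> 40 * exp (Im z * L) * exp (Im z * L)"
    by (rule mult_right_mono) simp
  then have "(norm ?d)\<^sup>2 \<le> 80 * (exp (Im z * L))\<^sup>2"
    by (simp add: mult.assoc power2_eq_square flip: exp_add)
  also have "\<dots> \<le> (9 * exp (Im z * L))\<^sup>2" by (simp add: power_mult_distrib)
  finally show "(norm ?d)\<^sup>2 \<le> (9 * exp (Im z * L))\<^sup>2" .
qed simp

definition weyl_value :: complex where
  "weyl_value = lim (\<lambda>j. truncated (real j))"

lemma truncated_limit: "(\<lambda>j. truncated (real j)) \<longlonglongrightarrow> weyl_value"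
proof -
  have e0: "(\<lambda>j. 9 * exp (Im z * real j)) \<longlonglongrightarrow> 0"
  proof -
    have "(\<lambda>j. (exp (Im z)) ^ j) \<longlonglongrightarrow> 0" using lower by (intro LIMSEQ_power_zero) simp
    then have "(\<lambda>j. 9 * (exp (Im z)) ^ j) \<longlonglongrightarrow> 9 * 0" by (intro tendsto_mult tendsto_const)
    then show ?thesis by (simp add: exp_of_nat_mult[symmetric] mult.commute)
  qed
  have "Cauchy (\<lambda>j. truncated (real j))"
  proof (rule metric_CauchyI)
    fix r :: real assume "r > 0"
    then obtain J where J: "\<And>j. j \<ge> J \<Longrightarrow> 9 * exp (Im z * real j) < r / 2"
      using LIMSEQ_D[OF e0, of "r / 2"] by auto
    have "dist (truncated (real i)) (truncated (real j)) < r" if "i \<ge> J" "j \<ge> J" for i j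
    proof -
      have "dist (truncated (real J)) (truncated (real k)) < r / 2" if "k \<ge> J" for k
        using truncated_cauchy[of "real J" "real k"] J[of J] that by (simp add: dist_norm)
      from this[OF that(1)] this[OF that(2)] show ?thesis
        using dist_triangle_half_r by blast
    qed
    then show "\<exists>J. \<forall>i\<ge>J. \<forall>j\<ge>J. dist (truncated (real i)) (truncated (real j)) < r" by blast
  qed
  then show ?thesis unfolding weyl_value_def by (simp add: Cauchy_convergent_iff convergent_LIMSEQ_iff)
qed

lemma truncated_rate: "norm (truncated (real j) - weyl_value) \<le> 9 * exp (Im z * real j)"
proof (rule tendsto_upperbound)
  show "(\<lambda>i. norm (truncated (real j) - truncated (real i))) \<longlonglongrightarrow> norm (truncated (real j) - weyl_value)"
    by (intro tendsto_intros truncated_limit)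
  show "\<forall>\<^sub>F i in sequentially. norm (truncated (real j) - truncated (real i)) \<le> 9 * exp (Im z * real j)"
    using eventually_ge_at_top[of j] by eventually_elim (rule truncated_cauchy, auto)
qed simp

lemma weyl_decay:
  assumes "0 \<le> x"
  shows "(norm (f1 x + weyl_value * f2 x))\<^sup>2 + (norm (g1 x + weyl_value * g2 x))\<^sup>2 \<le> 10 * exp (Im z * x)"
proof (rule tendsto_upperbound)
  show "(\<lambda>j. (norm (f1 x + truncated (real j) * f2 x))\<^sup>2 + (norm (g1 x + truncated (real j) * g2 x))\<^sup>2)
    \<longlonglongrightarrow> (norm (f1 x + weyl_value * f2 x))\<^sup>2 + (norm (g1 x + weyl_value * g2 x))\<^sup>2"
    by (intro tendsto_intros truncated_limit)
  obtain J where "x \<le> real J" using real_arch_simple by blast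
  then show "\<forall>\<^sub>F j in sequentially. (norm (f1 x + truncated (real j) * f2 x))\<^sup>2 + (norm (g1 x + truncated (real j) * g2 x))\<^sup>2 \<le> 10 * exp (Im z * x)"
    by (intro eventually_sequentiallyI[of J] truncated_decay assms) (simp add: order_trans)
qed simp

definition weyl_vector :: "real \<Rightarrow> complex ^ 2" where
  "weyl_vector x = vector [f1 x + weyl_value * f2 x, g1 x + weyl_value * g2 x]"

lemma weyl_vector_nth: "weyl_vector x $ 1 = f1 x + weyl_value * f2 x" "weyl_vector x $ 2 = g1 x + weyl_value * g2 x"
  by (simp_all add: weyl_vector_def vector_2)

lemma weyl_vector_0: "weyl_vector 0 $ 1 = 1" "weyl_vector 0 $ 2 = weyl_value"
  by (simp_all add: weyl_vector_nth init)

lemma weyl_solution_plus_weyl_vector: "weyl_solution_plus q z weyl_vector"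
  unfolding weyl_solution_plus_def
proof (intro conjI)
  show "dirac_ns_solution q z weyl_vector"
    unfolding dirac_ns_solution_iff weyl_vector_nth by (rule combination_system)
  show "\<exists>x. weyl_vector x \<noteq> 0" 
  proof
    show "weyl_vector 0 \<noteq> 0" using weyl_vector_0(1) by auto
  qed
  show "\<exists>a. set_integrable lborel {a..} (\<lambda>x. (norm (weyl_vector x))\<^sup>2)"
  proof (rule exI[of _ 0], rule set_integrable_bound)
    have "(\<lambda>x. exp (Im z * x)) integrable_on {0..}"
      using integrable_on_exp_minus_to_infinity[of "- Im z" 0] lower by simp
    then have "integrable lebesgue (\<lambda>x. indicator {0..} x *\<^sub>R exp (Im z * x))"
      using nonnegative_absolutely_integrable_1[of "\<lambda>x. exp (Im z * x)" "{0..}"] by (simp add: set_integrable_def)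
    then have "set_integrable lborel {0..} (\<lambda>x. exp (Im z * x))"
      unfolding set_integrable_def by (subst (asm) integrable_completion) auto
    then show "set_integrable lborel {0..} (\<lambda>x. 10 * exp (Im z * x))" by (rule set_integrable_mult_right)
    show "set_borel_measurable lborel {0..} (\<lambda>x. (norm (weyl_vector x))\<^sup>2)"
    proof -
      note c = dirac_system_continuous[OF combination_system[of weyl_value]]
      have "continuous_on UNIV (\<lambda>x. (norm (weyl_vector x))\<^sup>2)"
        unfolding norm_vec2 weyl_vector_nth by (intro continuous_intros c)
      then have "(\<lambda>x. (norm (weyl_vector x))\<^sup>2) \<in> borel_measurable borel" by (rule borel_measurable_continuous_onI)
      then show ?thesis unfolding set_borel_measurable_def by measurable
    qed
    show "AE x in lborel. x \<in> {0..} \<longrightarrow> norm ((norm (weyl_vector x))\<^sup>2) \<le> norm (10 * exp (Im z * x))"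
      using weyl_decay by (auto simp: norm_vec2 weyl_vector_nth)
  qed
qed

lemma weyl_solution_cone:
  assumes f: "weyl_solution_plus q z f" and k: "0 < k" "k \<le> 1" "e \<le> k * (- Im z) / 8"
  shows "norm (f 0 $ 2) \<le> 2 * norm (f 0 $ 1)" "norm (f 0 $ 2 - m 0 * f 0 $ 1) \<le> 2 * k * norm (f 0 $ 1)"
proof -
  have s: "dirac_system q z (\<lambda>x. f x $ 1) (\<lambda>x. f x $ 2)"
    using f by (simp add: weyl_solution_plus_def dirac_ns_solution_iff)
  obtain a where "set_integrable lborel {a..} (\<lambda>x. (norm (f x $ 1))\<^sup>2 + (norm (f x $ 2))\<^sup>2)"
    using f unfolding weyl_solution_plus_def norm_vec2 by blast
  from square_integrable_imp_cone_form_nonpos[OF s k this, of 0]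
  have c: "norm (f 0 $ 2 - m 0 * f 0 $ 1) \<le> k * norm (f 0 $ 1 + cnj (m 0) * f 0 $ 2)"
    by (rule cone_form_nonpos) (use k in simp)
  show "norm (f 0 $ 2) \<le> 2 * norm (f 0 $ 1)" "norm (f 0 $ 2 - m 0 * f 0 $ 1) \<le> 2 * k * norm (f 0 $ 1)"
    using cone_imp_ratio[OF c _ k(2) m_small] k by auto
qed

text \<open>A linear combination of two square integrable solutions is again one, so if its first component vanishes
at 0 then, by the cone condition, it vanishes altogether.\<close>

lemma weyl_solution_unique:
  assumes f: "weyl_solution_plus q z f"
  shows "f 0 $ 1 \<noteq> 0" "f = (\<lambda>x. f 0 $ 1 *s weyl_vector x)"
proof -
  have k: "0 < (1::real)" "(1::real) \<le> 1" "e \<le> 1 * (- Im z) / 8" using e_small lower by auto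
  have s: "dirac_system q z (\<lambda>x. f x $ 1) (\<lambda>x. f x $ 2)"
    using f by (simp add: weyl_solution_plus_def dirac_ns_solution_iff)
  have w: "dirac_system q z (\<lambda>x. weyl_vector x $ 1) (\<lambda>x. weyl_vector x $ 2)"
    using weyl_solution_plus_weyl_vector by (simp add: weyl_solution_plus_def dirac_ns_solution_iff)
  show f0: "f 0 $ 1 \<noteq> 0"
  proof
    assume "f 0 $ 1 = 0"
    then have "f 0 $ 1 = 0" "f 0 $ 2 = 0" using weyl_solution_cone(1)[OF f k] by auto
    then have "f x $ 1 = 0 \<and> f x $ 2 = 0" for x using dirac_system_zero[OF s] by auto
    then have "f x = 0" for x by (simp add: vec_eq_iff forall_2)
    then show False using f by (auto simp: weyl_solution_plus_def)
  qed
  define a where "a = f 0 $ 1"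
  define d where "d = (\<lambda>x. f x - a *s weyl_vector x)"
  have ds: "dirac_system q z (\<lambda>x. d x $ 1) (\<lambda>x. d x $ 2)"
    using dirac_system_combination[OF s w, of 1 "- a"] by (simp add: d_def)
  have "d x = 0" for x
  proof (rule ccontr)
    assume dx: "d x \<noteq> 0"
    have "weyl_solution_plus q z d" unfolding weyl_solution_plus_def
    proof (intro conjI)
      show "dirac_ns_solution q z d" using ds by (simp add: dirac_ns_solution_iff)
      show "\<exists>x. d x \<noteq> 0" using dx by blast
      obtain b where b: "set_integrable lborel {b..} (\<lambda>x. (norm (f x))\<^sup>2)"
        using f unfolding weyl_solution_plus_def by blast
      obtain c where c: "set_integrable lborel {c..} (\<lambda>x. (norm (weyl_vector x))\<^sup>2)"
        using weyl_solution_plus_weyl_vector unfolding weyl_solution_plus_def by blast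
      define r where "r = max b c"
      show "\<exists>r. set_integrable lborel {r..} (\<lambda>x. (norm (d x))\<^sup>2)"
      proof (rule exI[of _ r], rule set_integrable_bound)
        have "set_integrable lborel {r..} (\<lambda>x. (norm (f x))\<^sup>2)" "set_integrable lborel {r..} (\<lambda>x. (norm (weyl_vector x))\<^sup>2)"
          by (rule set_integrable_subset[OF b] set_integrable_subset[OF c]; simp add: r_def)+
        then show "set_integrable lborel {r..} (\<lambda>x. 2 * (norm (f x))\<^sup>2 + 2 * (norm a)\<^sup>2 * (norm (weyl_vector x))\<^sup>2)"
          by (intro set_integral_add set_integrable_mult_right) auto
        show "set_borel_measurable lborel {r..} (\<lambda>x. (norm (d x))\<^sup>2)"
        proof -
          have "continuous_on UNIV (\<lambda>x. (norm (d x))\<^sup>2)"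
            unfolding norm_vec2 by (intro continuous_intros dirac_system_continuous[OF ds])
          then have "(\<lambda>x. (norm (d x))\<^sup>2) \<in> borel_measurable borel" by (rule borel_measurable_continuous_onI)
          then show ?thesis unfolding set_borel_measurable_def by measurable
        qed
        have "(norm (d x))\<^sup>2 \<le> 2 * (norm (f x))\<^sup>2 + 2 * (norm a)\<^sup>2 * (norm (weyl_vector x))\<^sup>2" for x
          using norm_add_square_le[of "f x $ 1" "- (a * weyl_vector x $ 1)"] norm_add_square_le[of "f x $ 2" "- (a * weyl_vector x $ 2)"]
          unfolding norm_vec2 norm_minus_cancel norm_mult power_mult_distrib
          by (simp add: d_def algebra_simps)
        then show "AE x in lborel. x \<in> {r..} \<longrightarrow> norm ((norm (d x))\<^sup>2) \<le> norm (2 * (norm (f x))\<^sup>2 + 2 * (norm a)\<^sup>2 * (norm (weyl_vector x))\<^sup>2)"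
          by (auto intro: order_trans)
      qed
    qed
    moreover have "d 0 $ 1 = 0" by (simp add: d_def a_def weyl_vector_0)
    ultimately have "d 0 $ 1 = 0" "d 0 $ 2 = 0" using weyl_solution_cone(1)[OF _ k, of d] by auto
    then have "d x $ 1 = 0 \<and> d x $ 2 = 0" by (rule dirac_system_zero[OF ds])
    then show False using dx by (simp add: vec_eq_iff forall_2)
  qed
  then have "f x = a *s weyl_vector x" for x by (simp add: d_def)
  then show "f = (\<lambda>x. f 0 $ 1 *s weyl_vector x)" unfolding a_def by (rule ext)
qed

lemma mem_weyl_plus_domain: "z \<in> weyl_plus_domain q"
  unfolding weyl_plus_domain_def
proof (intro CollectI conjI allI impI)
  show "\<exists>f. weyl_solution_plus q z f" using weyl_solution_plus_weyl_vector by blast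
  fix f assume f: "weyl_solution_plus q z f"
  show "f 0 $ 1 \<noteq> 0" by (rule weyl_solution_unique(1)[OF f])
  fix g assume g: "weyl_solution_plus q z g"
  have "g x = (g 0 $ 1 / f 0 $ 1) *s f x" for x
  proof -
    have "(g 0 $ 1 / f 0 $ 1) *s f x = (g 0 $ 1 / f 0 $ 1) *s (f 0 $ 1 *s weyl_vector x)"
      using fun_cong[OF weyl_solution_unique(2)[OF f], of x] by simp
    also have "\<dots> = g 0 $ 1 *s weyl_vector x" using weyl_solution_unique(1)[OF f] by (simp add: vector_smult_assoc)
    also have "\<dots> = g x" using fun_cong[OF weyl_solution_unique(2)[OF g], of x] by simp
    finally show ?thesis by simp
  qed
  then show "\<exists>a. g = (\<lambda>x. a *s f x)" by blast
qed (rule lower)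

lemma weyl_plus_eq: "weyl_plus q z = weyl_value"
  unfolding weyl_plus_def
proof (rule the_equality)
  show "\<exists>f. weyl_solution_plus q z f \<and> weyl_value = f 0 $ 2 / f 0 $ 1"
    using weyl_solution_plus_weyl_vector weyl_vector_0 by (intro exI[of _ weyl_vector]) simp
  fix w assume "\<exists>f. weyl_solution_plus q z f \<and> w = f 0 $ 2 / f 0 $ 1"
  then obtain f where f: "weyl_solution_plus q z f" and w: "w = f 0 $ 2 / f 0 $ 1" by blast
  have "f 0 = f 0 $ 1 *s weyl_vector 0" using fun_cong[OF weyl_solution_unique(2)[OF f], of 0] by simp
  then have "f 0 $ 2 = f 0 $ 1 * weyl_value" by (metis vector_smult_component weyl_vector_0(2))
  then show "w = weyl_value" using w weyl_solution_unique(1)[OF f] by simp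
qed

lemma weyl_plus_near_approximation:
  assumes "0 < k" "k \<le> 1" "e \<le> k * (- Im z) / 8"
  shows "norm (weyl_plus q z - m 0) \<le> 2 * k"
  using weyl_solution_cone(2)[OF weyl_solution_plus_weyl_vector assms] by (simp add: weyl_plus_eq weyl_vector_0)

end

section \<open>Holomorphy and asymptotics in the lower half plane\<close>

text \<open>An open set that contains the region below the graph of \<open>- \<gamma>\<close> for every \<open>\<gamma>\<close> with lower constant at least \<open>K\<close>;
the region itself need not be open, as \<open>\<gamma>\<close> may be discontinuous.\<close>

definition lower_region :: "real \<Rightarrow> nat \<Rightarrow> complex set" where
  "lower_region K n = {z. K * inverse ((1 + \<bar>Re z\<bar>) ^ n) < - Im z}"

text \<open>A large constant \<open>K\<close> has two effects. Points of small modulus are excluded, so that the approximate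
solution is small on the whole region, and \<open>|Im z|\<close> dominates the residual.\<close>

lemma weyl_plus_lower_region:
  fixes p n :: nat
  assumes q: "bounded_smooth p q" and n: "n \<le> p"
  obtains K B where "K > 0" "B > 0" "open (lower_region K n)" "lower_region K n \<subseteq> weyl_plus_domain q"
    "weyl_plus q holomorphic_on lower_region K n"
    "\<And>z. z \<in> lower_region K n \<Longrightarrow>
       norm (weyl_plus q z - (\<Sum>j=1..p-n. dirac_coeff q j 0 * inverse z ^ j)) \<le> B * inverse (norm z) ^ Suc (p - n)"
proof -
  obtain Q where Q: "\<And>x. norm (q x) \<le> Q" by (rule bounded_smooth_lipschitz[OF q]) blast
  have qc: "continuous_on UNIV q" by (rule bounded_smooth_continuous[OF q])
  obtain C where C: "C > 0" and appr: "\<And>z. 1 \<le> norm z \<Longrightarrow> \<exists>m m'. (\<forall>x. (m has_vector_derivative m' x) (at x)) \<and>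
    (\<forall>x. norm (2 * \<i> * z * m x + \<i> * cnj (q x) - \<i> * q x * (m x)\<^sup>2 - m' x) \<le> C * inverse (norm z) ^ Suc p) \<and>
    (\<forall>J\<le>p. \<forall>x. norm (m x - (\<Sum>j=1..J. dirac_coeff q j x * inverse z ^ j)) \<le> C * inverse (norm z) ^ Suc J)"
    using riccati_approximation[OF q] by blast
  obtain f1 g1 where s1: "\<And>z. dirac_system q z (f1 z) (g1 z)" "\<And>z. f1 z 0 = 1" "\<And>z. g1 z 0 = 0"
    "\<And>x. (\<lambda>z. f1 z x) holomorphic_on UNIV" "\<And>x. (\<lambda>z. g1 z x) holomorphic_on UNIV"
    by (rule dirac_system_entire_solution[OF qc Q, of 1 0]) blast
  obtain f2 g2 where s2: "\<And>z. dirac_system q z (f2 z) (g2 z)" "\<And>z. f2 z 0 = 0" "\<And>z. g2 z 0 = 1"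
    "\<And>x. (\<lambda>z. f2 z x) holomorphic_on UNIV" "\<And>x. (\<lambda>z. g2 z x) holomorphic_on UNIV"
    by (rule dirac_system_entire_solution[OF qc Q, of 0 1]) blast
  \<comment> \<open>For \<open>|z| \<ge> R\<close> the approximation is at most \<open>1 / 16\<close>. The first entry of \<open>K\<close> forces \<open>|z| \<ge> R\<close>, the second one makes the residual small against \<open>|Im z|\<close>.\<close>
  define R where "R = max 1 (16 * C)"
  define K where "K = max (R * (1 + R) ^ n) (16 * C * 2 ^ n)"
  define G where "G = {z. K * inverse ((1 + \<bar>Re z\<bar>) ^ n) < - Im z}"
  have R1: "R \<ge> 1" by (simp add: R_def)
  have K: "K > 0" using C by (simp add: K_def less_max_iff_disj)
  have "open G" unfolding G_def
    by (intro open_Collect_less continuous_intros) auto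
  have lower: "Im z < 0" if "z \<in> G" for z
  proof -
    have "0 < K * inverse ((1 + \<bar>Re z\<bar>) ^ n)" using K by simp
    then show ?thesis using that by (simp add: G_def)
  qed
  have large: "R \<le> norm z" if z: "z \<in> G" for z
  proof (rule ccontr)
    assume "\<not> R \<le> norm z"
    then have r: "\<bar>Re z\<bar> \<le> R" "- Im z < R" using abs_Re_le_cmod[of z] abs_Im_le_cmod[of z] by linarith+
    have "R = (R * (1 + R) ^ n) * inverse ((1 + R) ^ n)" using R1 by simp
    also have "\<dots> \<le> K * inverse ((1 + \<bar>Re z\<bar>) ^ n)"
      using r R1 K by (intro mult_mono le_imp_inverse_le power_mono) (auto simp: K_def)
    also have "\<dots> < - Im z" using z by (simp add: G_def)
    finally show False using r by simp
  qed
  have eta: "16 * C * inverse (norm z) ^ n \<le> - Im z" if z: "z \<in> G" for z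
  proof -
    have z1: "1 \<le> norm z" using large[OF z] R1 by linarith
    have "(1 + \<bar>Re z\<bar>) ^ n \<le> (2 * norm z) ^ n"
      using abs_Re_le_cmod[of z] z1 by (intro power_mono) auto
    then have "inverse ((2 * norm z) ^ n) \<le> inverse ((1 + \<bar>Re z\<bar>) ^ n)" by (intro le_imp_inverse_le) auto
    then have "(16 * C * 2 ^ n) * inverse ((2 * norm z) ^ n) \<le> K * inverse ((1 + \<bar>Re z\<bar>) ^ n)"
      using C K by (intro mult_mono) (auto simp: K_def)
    also have "\<dots> \<le> - Im z" using z by (simp add: G_def less_imp_le)
    finally have "(16 * C * 2 ^ n) * inverse ((2 * norm z) ^ n) \<le> - Im z" .
    moreover have "(16 * C * 2 ^ n) * inverse ((2 * norm z) ^ n) = 16 * C * inverse (norm z) ^ n"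
      by (simp add: power_mult_distrib power_inverse field_simps)
    ultimately show ?thesis by (simp only:)
  qed
  have ex: "\<exists>m m'. fundamental_solutions q z m m' (C * inverse (norm z) ^ Suc p) (f1 z) (g1 z) (f2 z) (g2 z) \<and>
      norm (m 0 - (\<Sum>j=1..p-n. dirac_coeff q j 0 * inverse z ^ j)) \<le> C * inverse (norm z) ^ Suc (p - n)"
    if z: "z \<in> G" for z
  proof -
    have z1: "1 \<le> norm z" and zR: "R \<le> norm z" using large[OF z] R1 by linarith+
    define s where "s = inverse (norm z)"
    have s: "0 \<le> s" "s \<le> 1" using z1 by (auto simp: s_def inverse_le_1_iff)
    have sC: "C * s \<le> 1 / 16"
    proof -
      have "16 * C \<le> norm z" using zR by (simp add: R_def)
      moreover have "0 < norm z" using z1 by linarith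
      ultimately show ?thesis unfolding s_def divide_inverse[symmetric] by (simp add: pos_divide_le_eq)
    qed
    obtain m m' where m: "\<And>x. (m has_vector_derivative m' x) (at x)"
      "\<And>x. norm (2 * \<i> * z * m x + \<i> * cnj (q x) - \<i> * q x * (m x)\<^sup>2 - m' x) \<le> C * s ^ Suc p"
      "\<And>J x. J \<le> p \<Longrightarrow> norm (m x - (\<Sum>j=1..J. dirac_coeff q j x * inverse z ^ j)) \<le> C * s ^ Suc J"
      using appr[OF z1] unfolding s_def by blast
    have "fundamental_solutions q z m m' (C * s ^ Suc p) (f1 z) (g1 z) (f2 z) (g2 z)"
    proof
      show "norm (m x) \<le> 1 / 16" for x using m(3)[of 0 x] sC by simp
      have "C * s ^ Suc p \<le> C * s ^ n" using C s n by (intro mult_left_mono power_decreasing) auto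
      then show "C * s ^ Suc p \<le> - Im z / 16" using eta[OF z] by (simp add: s_def)
    qed (use lower[OF z] m(1,2) s1 s2 in auto)
    then show ?thesis using m(3)[of "p - n" 0] unfolding s_def by auto
  qed
  have "\<forall>z\<in>G. \<exists>mm. fundamental_solutions q z (fst mm) (snd mm) (C * inverse (norm z) ^ Suc p) (f1 z) (g1 z) (f2 z) (g2 z) \<and>
      norm (fst mm 0 - (\<Sum>j=1..p-n. dirac_coeff q j 0 * inverse z ^ j)) \<le> C * inverse (norm z) ^ Suc (p - n)"
  proof
    fix z assume "z \<in> G"
    from ex[OF this] show "\<exists>mm. fundamental_solutions q z (fst mm) (snd mm) (C * inverse (norm z) ^ Suc p) (f1 z) (g1 z) (f2 z) (g2 z) \<and>
      norm (fst mm 0 - (\<Sum>j=1..p-n. dirac_coeff q j 0 * inverse z ^ j)) \<le> C * inverse (norm z) ^ Suc (p - n)"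
      unfolding split_paired_Ex fst_conv snd_conv .
  qed
  from bchoice[OF this] obtain mm where mm: "\<forall>z\<in>G. fundamental_solutions q z (fst (mm z)) (snd (mm z)) (C * inverse (norm z) ^ Suc p) (f1 z) (g1 z) (f2 z) (g2 z) \<and>
      norm (fst (mm z) 0 - (\<Sum>j=1..p-n. dirac_coeff q j 0 * inverse z ^ j)) \<le> C * inverse (norm z) ^ Suc (p - n)"
    by (elim exE)
  define m m' where "m = (\<lambda>z. fst (mm z))" and "m' = (\<lambda>z. snd (mm z))"
  have fs: "fundamental_solutions q z (m z) (m' z) (C * inverse (norm z) ^ Suc p) (f1 z) (g1 z) (f2 z) (g2 z)"
    and m0: "norm (m z 0 - (\<Sum>j=1..p-n. dirac_coeff q j 0 * inverse z ^ j)) \<le> C * inverse (norm z) ^ Suc (p - n)"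
    if "z \<in> G" for z
    using mm that unfolding m_def m'_def by blast+
  define \<mu> where "\<mu> = (\<lambda>j z. - g1 z (real j) / g2 z (real j))"
  have \<mu>: "\<mu> j z = fundamental_solutions.truncated (g1 z) (g2 z) (real j)" if "z \<in> G" for j z
    using fundamental_solutions.truncated_def[OF fs[OF that]] by (simp add: \<mu>_def)
  have rate: "norm (\<mu> j z - weyl_plus q z) \<le> 9 * exp (Im z * real j)" if "z \<in> G" for j z
    using fundamental_solutions.truncated_rate[OF fs[OF that], of j]
    by (simp add: \<mu>[OF that] fundamental_solutions.weyl_plus_eq[OF fs[OF that]])
  have hol: "weyl_plus q holomorphic_on G"
  proof (rule holomorphic_uniform_sequence[OF \<open>open G\<close>])
    show "\<mu> j holomorphic_on G" for j
      unfolding \<mu>_def using fundamental_solutions.g2_nonzero[OF fs, of _ "real j"]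
      by (intro holomorphic_intros holomorphic_on_subset[OF s1(5)] holomorphic_on_subset[OF s2(5)]) auto
    fix z assume z: "z \<in> G"
    obtain d1 where d1: "d1 > 0" "cball z d1 \<subseteq> G" using \<open>open G\<close> z open_contains_cball by blast
    \<comment> \<open>On this disc the exponential rate is at least half the one at the centre.\<close>
    define d where "d = min d1 (- Im z / 2)"
    have d: "d > 0" "cball z d \<subseteq> G" using d1 lower[OF z] by (auto simp: d_def)
    have "uniform_limit (cball z d) \<mu> (weyl_plus q) sequentially"
    proof (rule uniform_limitI)
      fix \<epsilon> :: real assume "\<epsilon> > 0"
      have "(\<lambda>j. 9 * (exp (Im z / 2)) ^ j) \<longlonglongrightarrow> 9 * 0"
        using lower[OF z] by (intro tendsto_mult tendsto_const LIMSEQ_power_zero) simp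
      then have "\<forall>\<^sub>F j in sequentially. 9 * (exp (Im z / 2)) ^ j < \<epsilon>"
        using \<open>\<epsilon> > 0\<close> by (intro order_tendstoD) auto
      then show "\<forall>\<^sub>F j in sequentially. \<forall>w\<in>cball z d. dist (\<mu> j w) (weyl_plus q w) < \<epsilon>"
      proof eventually_elim
        case (elim j)
        show ?case
        proof
          fix w assume w: "w \<in> cball z d"
          have "\<bar>Im w - Im z\<bar> \<le> d" using w abs_Im_le_cmod[of "w - z"] by (simp add: dist_norm norm_minus_commute)
          then have "Im w \<le> Im z / 2" by (simp add: d_def min_def abs_le_iff split: if_splits)
          then have "exp (Im w * real j) \<le> exp (Im z / 2 * real j)" by (intro exp_le_cancel_iff[THEN iffD2] mult_right_mono) auto
          then have "9 * exp (Im w * real j) \<le> 9 * (exp (Im z / 2)) ^ j"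
            by (simp add: exp_of_nat_mult[symmetric] mult.commute)
          then show "dist (\<mu> j w) (weyl_plus q w) < \<epsilon>"
            using rate[of w j] w d(2) elim by (auto simp: dist_norm)
        qed
      qed
    qed
    then show "\<exists>d>0. cball z d \<subseteq> G \<and> uniform_limit (cball z d) \<mu> (weyl_plus q) sequentially" using d by blast
  qed
  have asym: "norm (weyl_plus q z - (\<Sum>j=1..p-n. dirac_coeff q j 0 * inverse z ^ j)) \<le> (1 + C) * inverse (norm z) ^ Suc (p - n)"
    if z: "z \<in> G" for z
  proof -
    define s where "s = inverse (norm z)"
    have s: "0 < s" "s \<le> 1" using large[OF z] R1 by (auto simp: s_def inverse_le_1_iff)
    \<comment> \<open>The narrowest cone that the residual permits.\<close>
    define k where "k = 8 * (C * s ^ Suc p) / (- Im z)"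
    have y: "Im z < 0" by (rule lower[OF z])
    have k0: "0 < k" using C s y by (simp add: k_def divide_pos_neg)
    have k2: "2 * k \<le> s ^ Suc (p - n)"
    proof -
      have "Suc p = n + Suc (p - n)" using n by simp
      then have "2 * (8 * (C * s ^ Suc p)) = (16 * C * s ^ n) * s ^ Suc (p - n)" by (simp only: power_add mult_ac)
      also have "\<dots> \<le> (- Im z) * s ^ Suc (p - n)" using eta[OF z] s by (intro mult_right_mono) (auto simp: s_def)
      finally have "2 * (8 * (C * s ^ Suc p)) / (- Im z) \<le> s ^ Suc (p - n)" using y by (subst pos_divide_le_eq) (auto simp: mult.commute)
      then show ?thesis by (simp add: k_def)
    qed
    have "s ^ Suc (p - n) \<le> 1" using s by (intro power_le_one) auto
    then have k1: "k \<le> 1" using k2 by linarith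
    have "C * s ^ Suc p \<le> k * (- Im z) / 8" using y by (simp add: k_def)
    then have "norm (weyl_plus q z - m z 0) \<le> 2 * k"
      using fundamental_solutions.weyl_plus_near_approximation[OF fs[OF z] k0 k1] by (simp add: s_def)
    then have "norm (weyl_plus q z - m z 0) \<le> s ^ Suc (p - n)" using k2 by linarith
    moreover have "norm (weyl_plus q z - (\<Sum>j=1..p-n. dirac_coeff q j 0 * inverse z ^ j))
      \<le> norm (weyl_plus q z - m z 0) + norm (m z 0 - (\<Sum>j=1..p-n. dirac_coeff q j 0 * inverse z ^ j))" by norm
    ultimately show ?thesis using m0[OF z] unfolding s_def distrib_right mult_1 by linarith
  qed
  have dom: "G \<subseteq> weyl_plus_domain q" using fundamental_solutions.mem_weyl_plus_domain[OF fs] by blast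
  have "0 < 1 + C" using C by simp
  then show thesis using that[of K "1 + C"] K \<open>open G\<close> dom hol asym unfolding G_def lower_region_def by blast
qed

section \<open>Reflection\<close>

lemma dirac_system_reflect:
  assumes "dirac_system q z f g"
  shows "dirac_system (\<lambda>x. - q (- x)) (- z) (\<lambda>x. f (- x)) (\<lambda>x. g (- x))"
  using assms reflected_derivative unfolding dirac_system_def by fastforce

lemma set_integrable_reflect:
  fixes h :: "real \<Rightarrow> real"
  assumes "set_integrable lborel {..a} h" shows "set_integrable lborel {- a..} (\<lambda>x. h (- x))"
proof -
  have "integrable lborel (\<lambda>x. indicator {..a} (0 + (- 1) * x) *\<^sub>R h (0 + (- 1) * x))"
    by (rule lborel_integrable_real_affine[OF assms[unfolded set_integrable_def], of "-1" 0]) simp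
  moreover have "indicator {..a} (- x) = (indicator {- a..} x :: real)" for x by (auto simp: indicator_def)
  ultimately show ?thesis by (simp add: set_integrable_def)
qed

lemma set_integrable_reflect':
  fixes h :: "real \<Rightarrow> real"
  assumes "set_integrable lborel {a..} h" shows "set_integrable lborel {..- a} (\<lambda>x. h (- x))"
proof -
  have "integrable lborel (\<lambda>x. indicator {a..} (0 + (- 1) * x) *\<^sub>R h (0 + (- 1) * x))"
    by (rule lborel_integrable_real_affine[OF assms[unfolded set_integrable_def], of "-1" 0]) simp
  moreover have "indicator {a..} (- x) = (indicator {..- a} x :: real)" for x by (auto simp: indicator_def)
  ultimately show ?thesis by (simp add: set_integrable_def)
qed

text \<open>Reflection exchanges the two ends of the line and the two half planes.\<close>

lemma weyl_solution_minus_iff: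
  "weyl_solution_minus q z f \<longleftrightarrow> weyl_solution_plus (\<lambda>x. - q (- x)) (- z) (\<lambda>x. f (- x))"
proof -
  have "dirac_ns_solution q z f \<longleftrightarrow> dirac_ns_solution (\<lambda>x. - q (- x)) (- z) (\<lambda>x. f (- x))"
    unfolding dirac_ns_solution_iff
    using dirac_system_reflect[of q z "\<lambda>x. f x $ 1" "\<lambda>x. f x $ 2"]
      dirac_system_reflect[of "\<lambda>x. - q (- x)" "- z" "\<lambda>x. f (- x) $ 1" "\<lambda>x. f (- x) $ 2"] by auto
  moreover have "(\<exists>x. f x \<noteq> 0) \<longleftrightarrow> (\<exists>x. f (- x) \<noteq> 0)" by (metis minus_minus)
  moreover have "(\<exists>a. set_integrable lborel {..a} (\<lambda>x. (norm (f x))\<^sup>2)) \<longleftrightarrow> (\<exists>a. set_integrable lborel {a..} (\<lambda>x. (norm (f (- x)))\<^sup>2))"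
    using set_integrable_reflect[of _ "\<lambda>x. (norm (f x))\<^sup>2"] set_integrable_reflect'[of _ "\<lambda>x. (norm (f (- x)))\<^sup>2"]
    by fastforce
  ultimately show ?thesis unfolding weyl_solution_minus_def weyl_solution_plus_def by blast
qed

lemma weyl_solution_plus_reflect_iff:
  "weyl_solution_plus (\<lambda>x. - q (- x)) (- z) f \<longleftrightarrow> weyl_solution_minus q z (\<lambda>x. f (- x))"
  unfolding weyl_solution_minus_iff by simp

lemma weyl_minus_eq: "weyl_minus q z = weyl_plus (\<lambda>x. - q (- x)) (- z)"
proof -
  have "(\<exists>f. weyl_solution_minus q z f \<and> w = f 0 $ 2 / f 0 $ 1) \<longleftrightarrow>
    (\<exists>f. weyl_solution_plus (\<lambda>x. - q (- x)) (- z) f \<and> w = f 0 $ 2 / f 0 $ 1)" (is "?l \<longleftrightarrow> ?r") for w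
  proof
    assume ?l
    then obtain f where "weyl_solution_minus q z f" "w = f 0 $ 2 / f 0 $ 1" by blast
    then show ?r unfolding weyl_solution_minus_iff by (intro exI[of _ "\<lambda>x. f (- x)"]) simp
  next
    assume ?r
    then obtain f where "weyl_solution_plus (\<lambda>x. - q (- x)) (- z) f" "w = f 0 $ 2 / f 0 $ 1" by blast
    then show ?l unfolding weyl_solution_plus_reflect_iff by (intro exI[of _ "\<lambda>x. f (- x)"]) simp
  qed
  then show ?thesis unfolding weyl_minus_def weyl_plus_def by simp
qed

lemma mem_weyl_minus_domain:
  assumes "- z \<in> weyl_plus_domain (\<lambda>x. - q (- x))"
  shows "z \<in> weyl_minus_domain q"
  unfolding weyl_minus_domain_def
proof (intro CollectI conjI allI impI)
  note d = assms[unfolded weyl_plus_domain_def, simplified]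
  show "Im z > 0" using d by simp
  obtain f where "weyl_solution_plus (\<lambda>x. - q (- x)) (- z) f" using d by blast
  then show "\<exists>f. weyl_solution_minus q z f" unfolding weyl_solution_plus_reflect_iff by blast
  fix f assume f: "weyl_solution_minus q z f"
  show "f 0 $ 1 \<noteq> 0" using d f[unfolded weyl_solution_minus_iff] by fastforce
  fix g assume g: "weyl_solution_minus q z g"
  obtain a where "(\<lambda>x. g (- x)) = (\<lambda>x. a *s f (- x))"
    using d f[unfolded weyl_solution_minus_iff] g[unfolded weyl_solution_minus_iff] by blast
  then have "g (- (- x)) = a *s f (- (- x))" for x by (rule fun_cong)
  then show "\<exists>a. g = (\<lambda>x. a *s f x)" by (intro exI[of _ a]) (simp add: fun_eq_iff)
qed

text \<open>The sign \<open>(- 1)\<^sup>j\<close> is compensated by the one in \<open>(- z)\<^sup>-\<^sup>j\<close>, so that both Weyl functions have the same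
expansion.\<close>

lemma dirac_coeff_reflect:
  assumes q: "bounded_smooth n q"
  shows "1 \<le> j \<Longrightarrow> j \<le> Suc n \<Longrightarrow> dirac_coeff (\<lambda>x. - q (- x)) j x = (- 1) ^ j * dirac_coeff q j (- x)"
proof (induction j arbitrary: x rule: less_induct)
  case (less j)
  show ?case
  proof (cases "j = 1")
    case True
    then show ?thesis by simp
  next
    case False
    then obtain i where j: "j = Suc (Suc i)" using less.prems by (metis One_nat_def Suc_leD not0_implies_Suc not_one_le_zero)
    have i: "Suc i \<le> n" using less.prems j by simp
    have "bounded_smooth (Suc n - Suc i) (dirac_coeff q (Suc i))"
      by (rule dirac_coeff_bounded_smooth[OF q]) (use i in auto)
    moreover have "Suc n - Suc i = Suc (n - Suc i)" using i by simp
    ultimately have c: "(dirac_coeff q (Suc i) has_vector_derivative vector_derivative (dirac_coeff q (Suc i)) (at y)) (at y)" for y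
      using bounded_smooth_vector_derivative(2) by metis
    have fn: "dirac_coeff (\<lambda>x. - q (- x)) (Suc i) = (\<lambda>x. (- 1) ^ Suc i * dirac_coeff q (Suc i) (- x))"
      using less.IH[of "Suc i"] i j by auto
    have "(dirac_coeff (\<lambda>x. - q (- x)) (Suc i) has_vector_derivative
       (- 1) ^ Suc i * - vector_derivative (dirac_coeff q (Suc i)) (at (- x))) (at x)"
      unfolding fn by (intro has_vector_derivative_mult_right reflected_derivative c)
    then have vd: "vector_derivative (dirac_coeff (\<lambda>x. - q (- x)) (Suc i)) (at x)
       = (- 1) ^ Suc i * - vector_derivative (dirac_coeff q (Suc i)) (at (- x))"
      by (rule vector_derivative_at)
    have "(\<Sum>l=1..i. dirac_coeff (\<lambda>x. - q (- x)) l x * dirac_coeff (\<lambda>x. - q (- x)) (Suc i - l) x)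
      = (\<Sum>l=1..i. (- 1) ^ Suc i * (dirac_coeff q l (- x) * dirac_coeff q (Suc i - l) (- x)))"
    proof (rule sum.cong[OF refl])
      fix l assume l: "l \<in> {1..i}"
      have sgn: "(- 1 :: complex) ^ Suc i = (- 1) ^ l * (- 1) ^ (Suc i - l)" using l by (simp flip: power_add)
      have i1: "dirac_coeff (\<lambda>x. - q (- x)) l x = (- 1) ^ l * dirac_coeff q l (- x)"
        by (rule less.IH) (use l i j in auto)
      have i2: "dirac_coeff (\<lambda>x. - q (- x)) (Suc i - l) x = (- 1) ^ (Suc i - l) * dirac_coeff q (Suc i - l) (- x)"
        by (rule less.IH) (use l i j in auto)
      show "dirac_coeff (\<lambda>x. - q (- x)) l x * dirac_coeff (\<lambda>x. - q (- x)) (Suc i - l) x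
        = (- 1) ^ Suc i * (dirac_coeff q l (- x) * dirac_coeff q (Suc i - l) (- x))"
        unfolding i1 i2 sgn by (simp only: mult_ac)
    qed
    then have sm: "(\<Sum>l=1..i. dirac_coeff (\<lambda>x. - q (- x)) l x * dirac_coeff (\<lambda>x. - q (- x)) (Suc i - l) x)
      = (- 1) ^ Suc i * (\<Sum>l=1..i. dirac_coeff q l (- x) * dirac_coeff q (Suc i - l) (- x))"
      by (simp only: sum_distrib_left)
    show ?thesis unfolding j dirac_coeff.simps(3) vd sm by (simp add: algebra_simps)
  qed
qed

section \<open>The expansion of the Weyl functions\<close>

theorem theorem4:
  fixes N n :: nat and q :: "real \<Rightarrow> complex"
  assumes "N \<ge> 1" and "n \<le> N - 1"
    and "q \<in> sobolev_infinity N" and "continuous_on UNIV q"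
  shows "\<exists>K::real. \<forall>(\<gamma> :: real \<Rightarrow> real) (c :: real) (C :: real).
    (\<forall>t. \<gamma> t > 0) \<and> (\<forall>t. \<gamma> (- t) = \<gamma> t) \<and> c > 0 \<and> C > 0 \<and>
    (\<forall>t. c * (1 + \<bar>t\<bar>) powi (- int n) \<le> \<gamma> t \<and> \<gamma> t \<le> C * (1 + \<bar>t\<bar>) powi (- int n)) \<and>
    c \<ge> K \<longrightarrow>
      region_minus \<gamma> \<subseteq> interior (weyl_plus_domain q) \<and>
      weyl_plus q analytic_on region_minus \<gamma> \<and>
      region_plus \<gamma> \<subseteq> interior (weyl_minus_domain q) \<and>
      weyl_minus q analytic_on region_plus \<gamma> \<and>
      (\<exists>B>0. \<exists>R>0. \<forall>z\<in>region_minus \<gamma>. norm z \<ge> R \<longrightarrow>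
         norm (weyl_plus q z - (\<Sum>j=1..N-n-1. dirac_coeff q j 0 * z powi (- int j)))
           \<le> B * norm z powi (int n - int N)) \<and>
      (\<exists>B>0. \<exists>R>0. \<forall>z\<in>region_plus \<gamma>. norm z \<ge> R \<longrightarrow>
         norm (weyl_minus q z - (\<Sum>j=1..N-n-1. dirac_coeff q j 0 * z powi (- int j)))
           \<le> B * norm z powi (int n - int N))"
proof -
  obtain p where N: "N = Suc p" using assms(1) by (cases N) auto
  have n: "n \<le> p" using assms(2) N by simp
  have q: "bounded_smooth p q"
    using sobolev_infinity_imp_bounded_smooth assms(3,4) unfolding N by blast
  let ?r = "\<lambda>x. - q (- x)"
  have r: "bounded_smooth p ?r"
    using bounded_smooth_mult[OF bounded_smooth_const[of p "-1"] bounded_smooth_reflect[OF q]] by simp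
  define G where "G = (\<lambda>K. lower_region K n)"
  obtain K1 B1 where K1: "K1 > 0" and B1: "B1 > 0" and G1: "open (G K1)" "G K1 \<subseteq> weyl_plus_domain q" "weyl_plus q holomorphic_on G K1"
    and A1: "\<And>z. z \<in> G K1 \<Longrightarrow>
       norm (weyl_plus q z - (\<Sum>j=1..p-n. dirac_coeff q j 0 * inverse z ^ j)) \<le> B1 * inverse (norm z) ^ Suc (p - n)"
    unfolding G_def by (rule weyl_plus_lower_region[OF q n]) blast
  obtain K2 B2 where K2: "K2 > 0" and B2: "B2 > 0" and G2: "open (G K2)" "G K2 \<subseteq> weyl_plus_domain ?r" "weyl_plus ?r holomorphic_on G K2"
    and A2: "\<And>z. z \<in> G K2 \<Longrightarrow>
       norm (weyl_plus ?r z - (\<Sum>j=1..p-n. dirac_coeff ?r j 0 * inverse z ^ j)) \<le> B2 * inverse (norm z) ^ Suc (p - n)"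
    unfolding G_def by (rule weyl_plus_lower_region[OF r n]) blast
  have pw: "N - n - 1 = p - n" "norm z powi (int n - int N) = inverse (norm z) ^ Suc (p - n)" for z :: complex
  proof -
    show "N - n - 1 = p - n" using N n by simp
    have "int n - int N = - int (Suc (p - n))" using N n by simp
    then show "norm z powi (int n - int N) = inverse (norm z) ^ Suc (p - n)"
      by (simp only: power_int_minus power_int_of_nat power_inverse)
  qed
  have pz: "z powi (- int j) = inverse z ^ j" for z :: complex and j
    by (simp add: power_int_minus power_inverse)
  show ?thesis
  proof (intro exI[of _ "max K1 K2"] allI impI, elim conjE)
    fix \<gamma> :: "real \<Rightarrow> real" and c C :: real
    assume even: "\<forall>t. \<gamma> (- t) = \<gamma> t" and c: "max K1 K2 \<le> c"
      and \<gamma>: "\<forall>t. c * (1 + \<bar>t\<bar>) powi (- int n) \<le> \<gamma> t \<and> \<gamma> t \<le> C * (1 + \<bar>t\<bar>) powi (- int n)"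
    have sub: "region_minus \<gamma> \<subseteq> G K" if "K \<le> c" for K
    proof
      fix z assume z: "z \<in> region_minus \<gamma>"
      have "K * inverse ((1 + \<bar>Re z\<bar>) ^ n) \<le> c * inverse ((1 + \<bar>Re z\<bar>) ^ n)" using that by (intro mult_right_mono) auto
      also have "\<dots> = c * (1 + \<bar>Re z\<bar>) powi (- int n)" by (simp add: power_int_minus)
      also have "\<dots> \<le> \<gamma> (Re z)" using \<gamma> by blast
      also have "\<dots> < - Im z" using z by (simp add: region_minus_def)
      finally show "z \<in> G K" by (simp add: G_def lower_region_def)
    qed
    have S1: "region_minus \<gamma> \<subseteq> G K1" and S2: "region_minus \<gamma> \<subseteq> G K2" using sub c by auto
    have neg: "- z \<in> region_minus \<gamma>" if "z \<in> region_plus \<gamma>" for z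
      using that even by (simp add: region_plus_def region_minus_def)
    \<comment> \<open>The open set in the upper half plane that corresponds to \<open>lower_region\<close>.\<close>
    define H where "H = uminus ` G K2"
    have H: "open H" "\<And>z. z \<in> H \<Longrightarrow> - z \<in> G K2" "region_plus \<gamma> \<subseteq> H"
    proof -
      show "open H" unfolding H_def by (rule open_negations[OF G2(1)])
      show "- z \<in> G K2" if "z \<in> H" for z using that by (auto simp: H_def)
      show "region_plus \<gamma> \<subseteq> H"
      proof
        fix z assume "z \<in> region_plus \<gamma>"
        then have "- z \<in> G K2" using neg S2 by blast
        then have "- (- z) \<in> H" unfolding H_def by (rule imageI)
        then show "z \<in> H" by simp
      qed
    qed
    have "region_minus \<gamma> \<subseteq> interior (weyl_plus_domain q)"
      using S1 interior_maximal[OF G1(2,1)] by blast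
    moreover have "weyl_plus q analytic_on region_minus \<gamma>"
      using G1 S1 analytic_on_open analytic_on_subset by blast
    moreover have "region_plus \<gamma> \<subseteq> interior (weyl_minus_domain q)"
    proof -
      have "H \<subseteq> weyl_minus_domain q" using H(2) G2(2) mem_weyl_minus_domain by blast
      then show ?thesis using H interior_maximal by blast
    qed
    moreover have "weyl_minus q analytic_on region_plus \<gamma>"
    proof -
      have "(weyl_plus ?r \<circ> uminus) holomorphic_on H"
        by (rule holomorphic_on_compose_gen[of _ _ _ "G K2"]) (use H(2) G2(3) in \<open>auto intro!: holomorphic_intros\<close>)
      then have "weyl_minus q holomorphic_on H" by (simp add: weyl_minus_eq[abs_def] o_def)
      then show ?thesis using H(1,3) analytic_on_open analytic_on_subset by blast
    qed
    moreover have "\<exists>B>0. \<exists>R>0. \<forall>z\<in>region_minus \<gamma>. norm z \<ge> R \<longrightarrow>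
         norm (weyl_plus q z - (\<Sum>j=1..N-n-1. dirac_coeff q j 0 * z powi (- int j)))
           \<le> B * norm z powi (int n - int N)"
      unfolding pw pz using B1 A1 S1 by (intro exI[of _ B1] exI[of _ 1] conjI) auto
    moreover have "norm (weyl_minus q z - (\<Sum>j=1..p-n. dirac_coeff q j 0 * inverse z ^ j)) \<le> B2 * inverse (norm z) ^ Suc (p - n)"
      if z: "z \<in> region_plus \<gamma>" for z
    proof -
      have "(\<Sum>j=1..p-n. dirac_coeff ?r j 0 * inverse (- z) ^ j) = (\<Sum>j=1..p-n. dirac_coeff q j 0 * inverse z ^ j)"
      proof (rule sum.cong[OF refl])
        fix j assume "j \<in> {1..p-n}"
        then have "1 \<le> j" "j \<le> Suc p" by auto
        then have "dirac_coeff ?r j 0 = (- 1) ^ j * dirac_coeff q j 0" using dirac_coeff_reflect[OF q, of j 0] by simp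
        moreover have "inverse (- z) ^ j = (- 1) ^ j * inverse z ^ j" by (simp flip: power_mult_distrib)
        moreover have "(- 1 :: complex) ^ j * (- 1) ^ j = 1" by (simp flip: power_mult_distrib)
        ultimately show "dirac_coeff ?r j 0 * inverse (- z) ^ j = dirac_coeff q j 0 * inverse z ^ j"
          by (simp add: mult_ac)
      qed
      then show ?thesis using A2[of "- z"] neg[OF z] S2 by (auto simp: weyl_minus_eq)
    qed
    then have "\<exists>B>0. \<exists>R>0. \<forall>z\<in>region_plus \<gamma>. norm z \<ge> R \<longrightarrow>
         norm (weyl_minus q z - (\<Sum>j=1..N-n-1. dirac_coeff q j 0 * z powi (- int j)))
           \<le> B * norm z powi (int n - int N)"
      unfolding pw pz using B2 by (intro exI[of _ B2] exI[of _ 1] conjI) auto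
    ultimately show "region_minus \<gamma> \<subseteq> interior (weyl_plus_domain q) \<and>
      weyl_plus q analytic_on region_minus \<gamma> \<and>
      region_plus \<gamma> \<subseteq> interior (weyl_minus_domain q) \<and>
      weyl_minus q analytic_on region_plus \<gamma> \<and>
      (\<exists>B>0. \<exists>R>0. \<forall>z\<in>region_minus \<gamma>. norm z \<ge> R \<longrightarrow>
         norm (weyl_plus q z - (\<Sum>j=1..N-n-1. dirac_coeff q j 0 * z powi (- int j)))
           \<le> B * norm z powi (int n - int N)) \<and>
      (\<exists>B>0. \<exists>R>0. \<forall>z\<in>region_plus \<gamma>. norm z \<ge> R \<longrightarrow>
         norm (weyl_minus q z - (\<Sum>j=1..N-n-1. dirac_coeff q j 0 * z powi (- int j)))
           \<le> B * norm z powi (int n - int N))" by blast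
  qed
qed

end
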